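(* Let the system $$\frac{d\varrho}{dt}=f(\varrho,\varphi,S(t),t),\qquad \frac{d\varphi}{dt}=\omega+g(\varrho,\varphi,S(t),t)\qquad(\ast)$$ satisfy the standing assumptions of the context (including the resonance condition and the asymptotic expansions), and let $\Lambda_k,\Omega_k$ be the associated averaged coefficients defined in the context. Let $n,m\in[1,q]$ be integers such that $$\Lambda_k\equiv0\ (k<n),\quad \Lambda_n\not\equiv0,\qquad \Omega_k\equiv0\ (k<m),\quad \Omega_m\not\equiv0,$$ and let $\varrho_\ast\in(0,\mathcal R)$, $\varphi_\ast\in\mathbb R$ be such that $$\Lambda_n(\varrho_\ast,\varphi_\ast)=0,\qquad \Omega_m(\varrho_\ast,\varphi_\ast)=0,\qquad \mathcal D_{n,m}\ne0 .$$ Let $\beta_{n,m,1},\beta_{n,m,2}$ be defined as in the context. (i) If $\beta_{n,m,1}<0$ and $\beta_{n,m,2}<0$, let $(\rho_\ast(t),\phi_\ast(t))$ be a particular solution of the truncated system $$\frac{d\rho}{dt}=\sum_{k=1}^N t^{-\frac kq}\Lambda_k(\rho,\phi),\qquad \frac{d\phi}{dt}=\sum_{k=1}^N t^{-\frac kq}\Omega_k(\rho,\phi),\qquad N\ge\max\{n,m\},$$ with $\rho_\ast(t)=\varrho_\ast+o(1)$, $\phi_\ast(t)=\varphi_\ast+o(1)$ as $t\to\infty$ (such a solution exists). Then for all $\varepsilon>0$ there exist $\delta_\varepsilon\in(0,\varepsilon)$ and $t_\varepsilon>0$ such that for all $t_s\ge t_\varepsilon$ any solution $\varrho(t),\varphi(t)$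 of $(\ast)$ with initial data satisfying $$|\varrho(t_s)-\rho_\ast(t_s)|+\Big|\varphi(t_s)-\frac{\kappa}{\varkappa}S(t_s)-\phi_\ast(t_s)\Big|\le\delta_\varepsilon$$ satisfies $$|\varrho(t)-\rho_\ast(t)|+\Big|\varphi(t)-\frac{\kappa}{\varkappa}S(t)-\phi_\ast(t)\Big|<\varepsilon\qquad\text{for all } t>t_s .$$ (ii) If $\beta_{n,m,1}>0$, $\beta_{n,m,2}>0$ and $\max\{n,m\}<q$, then there are $\varepsilon>0$ and $t_\ast>0$ such that for all $\delta\in(0,\varepsilon)$ there exist $t_s\ge t_\ast$ and a solution $\varrho(t),\varphi(t)$ of $(\ast)$ with initial data satisfying $$|\varrho(t_s)-\varrho_\ast|+\Big|\varphi(t_s)-\frac{\kappa}{\varkappa}S(t_s)-\varphi_\ast\Big|\le\delta$$ such that $$|\varrho(t_e)-\varrho_\ast|+\Big|\varphi(t_e)-\frac{\kappa}{\varkappa}S(t_e)-\varphi_\ast\Big|\ge\varepsilon\qquad\text{at some } t_e>t_s .$$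
   Context: Standing assumptions. $\omega>0$, $\mathcal R>0$, $q\in\mathbb Z_+$ (positive integers). The functions $f(\varrho,\varphi,S,t)$ and $g(\varrho,\varphi,S,t)$ are infinitely differentiable, defined for all $\varrho\in(0,\mathcal R]$, $(\varphi,S)\in\mathbb R^2$, $t>0$, and $2\pi$-periodic in $\varphi$ and in $S$. The function $S(t)$ is smooth for $t>0$ and $S'(t)\sim s_0$ as $t\to\infty$, where $s_0>0$ satisfies the resonance condition: there are coprime integers $\kappa,\varkappa$ with $\kappa s_0=\varkappa\omega$. For each fixed $\varrho,\varphi$, $\lim_{t\to\infty}f(\varrho,\varphi,S(t),t)=\lim_{t\to\infty}g(\varrho,\varphi,S(t),t)=0$. The following asymptotic expansions hold as $t\to\infty$ for all $\varrho\in(0,\mathcal R]$ and $(\varphi,S)\in\mathbb R^2$: $$f\sim\sum_{k=1}^\infty t^{-\frac kq}f_k(\varrho,\varphi,S),\quad g\sim\sum_{k=1}^\infty t^{-\frac kq}g_k(\varrho,\varphi,S),\quad S'(t)\sim s_0+\sum_{k=1}^\infty t^{-\frac kq}s_k,$$ where $f_k,g_k$ are smooth and $2\pi$-periodic in $\varphi$ and $S$, and $s_k$ are real parameters. Averaged coefficients $\Lambda_k,\Omega_k$. Put $F_k(R,\Psi,S)=f_k(R,\frac{\kappa}{\varkappa}S+\Psi,S)$ and $G_k(R,\Psi,S)=g_k(R,\frac{\kappa}{\varkappa}S+\Psi,S)-\frac{\kappa}{\varkappa}s_k$. Smooth functions $u_k(R,\Psi,S),v_k(R,\Psi,S)$ ($2\pi$-periodic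 in $\Psi$, $2\pi\varkappa$-periodic in $S$) and $\Lambda_k(R,\Psi),\Omega_k(R,\Psi)$ ($2\pi$-periodic in $\Psi$), $k\ge1$, are determined recursively by requiring that, with $U=R+\sum_{k\ge1}t^{-k/q}u_k$, $V=\Psi+\sum_{k\ge1}t^{-k/q}v_k$, the coefficients of every power $t^{-k/q}$ agree in the formal identity $$\Big(\sum_{j\ge1}t^{-\frac jq}F_j\,\partial_R+\sum_{j\ge1}t^{-\frac jq}G_j\,\partial_\Psi+\big(s_0+\sum_{j\ge1}t^{-\frac jq}s_j\big)\partial_S+\partial_t\Big)\begin{pmatrix} U \\ V \end{pmatrix}=\sum_{k\ge1}t^{-\frac kq}\begin{pmatrix} \Lambda_k(U,V) \\ \Omega_k(U,V) \end{pmatrix},$$ the right-hand side being Taylor expanded about $(R,\Psi)$. At order $k$ this reads $s_0\partial_S(u_k,v_k)^T=(\Lambda_k-F_k+\tilde F_k,\ \Omega_k-G_k+\tilde G_k)^T$ with $\tilde F_k,\tilde G_k$ depending only on earlier terms ($\tilde F_1=\tilde G_1=0$), so $\Lambda_k$ and $\Omega_k$ are the averages over $S\in[0,2\pi\varkappa]$ of $F_k-\tilde F_k$ and $G_k-\tilde G_k$. (The $u_k,v_k$ are determined up to additive functions of $(R,\Psi)$; any one choice is fixed.) This construction is the one by which $(\ast)$ is transformed, via $R=\varrho$, $\Psi=\varphi-\kappa S/\varkappa$ and a near-identity change $(R,\Psi)\mapsto(r,\psi)$, into a system $\dot r=\sum_{k=1}^N t^{-k/q}\Lambda_k(r,\psi)+\mathcal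 O(t^{-(N+1)/q})$, $\dot\psi=\sum_{k=1}^N t^{-k/q}\Omega_k(r,\psi)+\mathcal O(t^{-(N+1)/q})$. Parameters. Let $$\lambda_n=\partial_\rho\Lambda_n(\varrho_\ast,\varphi_\ast),\quad \nu_n=\partial_\phi\Lambda_n(\varrho_\ast,\varphi_\ast),\quad \eta_m=\partial_\rho\Omega_m(\varrho_\ast,\varphi_\ast),\quad \omega_m=\partial_\phi\Omega_m(\varrho_\ast,\varphi_\ast),$$ $\mathcal D_{n,m}=\lambda_n\omega_m-\nu_n\eta_m$. If $n=m$, set $\alpha^0_{1,2}=\frac12\big(\lambda_n+\omega_m\pm\sqrt{(\lambda_n+\omega_m)^2-4\mathcal D_{n,m}}\big)$ (possibly complex). If $n<m$, set $\alpha_1^0=\lambda_n$, $\alpha_2^0=\lambda_n^{-1}\mathcal D_{n,m}$. If $n>m$, set $\alpha_1^0=\omega_m^{-1}\mathcal D_{n,m}$, $\alpha_2^0=\omega_m$. (When $n<m$ it is understood that $\lambda_n\neq0$, when $n>m$ that $\omega_m\ne0$.) With $\delta_{i,j}$ the Kronecker delta, $$\beta_{n,m,1}=\begin{cases}\Re\alpha_1^0,&n=m,\\ \alpha_1^0+\frac{n-m}{2q}\delta_{n,q},&n\ne m,\end{cases}\qquad \beta_{n,m,2}=\begin{cases}\Re\alpha_2^0,&n=m,\\ \alpha_2^0+\frac{m-n}{2q}\delta_{m,q},&n\ne m.\end{cases}$$ *)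

theory Defs
  imports
    "HOL-Analysis.Analysis"
    "HOL-Computational_Algebra.Formal_Power_Series"
    "HOL-Library.Landau_Symbols"
begin

section \<open>Smoothness\<close>

text \<open>
  Directional derivative relative to a set \<open>A\<close>.  All sets used below are products of intervals of
  positive length, so the derivative within \<open>A\<close> is unique at every point of \<open>A\<close>; it is one-sided
  at the boundary \<open>\<rho> = \<R>\<close>.
\<close>

definition pdiff :: "'a::real_normed_vector set \<Rightarrow> 'a \<Rightarrow> ('a \<Rightarrow> real) \<Rightarrow> 'a \<Rightarrow> real" where
  "pdiff A e h = (\<lambda>x. frechet_derivative h (at x within A) e)"

primrec Ck_on :: "nat \<Rightarrow> 'a::real_normed_vector set \<Rightarrow> ('a \<Rightarrow> real) \<Rightarrow> bool" where
  "Ck_on 0 A h \<longleftrightarrow> continuous_on A h"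
| "Ck_on (Suc n) A h \<longleftrightarrow> h differentiable_on A \<and> (\<forall>e. Ck_on n A (pdiff A e h))"

definition smooth_on :: "'a::real_normed_vector set \<Rightarrow> ('a \<Rightarrow> real) \<Rightarrow> bool" where
  "smooth_on A h \<longleftrightarrow> (\<forall>n. Ck_on n A h)"


section \<open>The perturbed system\<close>

text \<open>
  The amplitude ranges over \<open>(0, \<R>]\<close>, every other variable over the whole line.
  Points are \<open>(\<rho>, \<phi>, S)\<close> for the original system and \<open>(R, \<Psi>, S)\<close>, \<open>(R, \<Psi>)\<close> for the averaged one.
\<close>

abbreviation strip :: "real \<Rightarrow> (real \<times> 'a) set" where
  "strip \<R> \<equiv> {0<..\<R>} \<times> UNIV"

text \<open>
  The expansion \<open>h(x,t) ~ \<Sum>k\<ge>1. t\<^sup>-\<^sup>k\<^sup>/\<^sup>q c\<^sub>k(x)\<close> as \<open>t \<rightarrow> \<infinity>\<close> in the sense of Poincare, the remainders being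
  uniform in \<open>x\<close> on compact subsets of \<open>A\<close>.
\<close>

definition has_expansion_on ::
    "nat \<Rightarrow> 'a::topological_space set \<Rightarrow> ('a \<Rightarrow> real \<Rightarrow> real) \<Rightarrow> (nat \<Rightarrow> 'a \<Rightarrow> real) \<Rightarrow> bool" where
  "has_expansion_on q A h c \<longleftrightarrow>
     (\<forall>K N. compact K \<and> K \<subseteq> A \<longrightarrow>
        (\<exists>C. \<forall>\<^sub>F t in at_top. \<forall>x\<in>K.
           \<bar>h x t - (\<Sum>k=1..N. t powr (- real k / real q) * c k x)\<bar>
             \<le> C * t powr (- real (Suc N) / real q)))"

text \<open>
  \<open>s 0\<close> is the limit frequency \<open>s\<^sub>0\<close>; \<open>fc k\<close>, \<open>gc k\<close> are the coefficients \<open>f\<^sub>k\<close>, \<open>g\<^sub>k\<close>, used for \<open>k \<ge> 1\<close> only.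
  The resonance condition with \<open>s\<^sub>0, \<omega> > 0\<close> and coprimality forces \<open>\<kappa>\<close> and \<open>\<kappa>'\<close> to be nonzero.
\<close>

definition standing_assumptions ::
    "real \<Rightarrow> real \<Rightarrow> nat \<Rightarrow> int \<Rightarrow> int \<Rightarrow> (real \<Rightarrow> real) \<Rightarrow> (nat \<Rightarrow> real) \<Rightarrow>
     (real \<times> real \<times> real \<Rightarrow> real \<Rightarrow> real) \<Rightarrow> (real \<times> real \<times> real \<Rightarrow> real \<Rightarrow> real) \<Rightarrow>
     (nat \<Rightarrow> real \<times> real \<times> real \<Rightarrow> real) \<Rightarrow> (nat \<Rightarrow> real \<times> real \<times> real \<Rightarrow> real) \<Rightarrow> bool" where
  "standing_assumptions \<omega> \<R> q \<kappa> \<kappa>' S s f g fc gc \<longleftrightarrow>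
     0 < \<omega> \<and> 0 < \<R> \<and> 0 < q \<and>
     (\<forall>h\<in>{f, g}.
        smooth_on (strip \<R> \<times> {0<..}) (\<lambda>(x, t). h x t) \<and>
        (\<forall>\<rho>\<in>{0<..\<R>}. \<forall>\<phi> \<sigma>. \<forall>t>0.
           h (\<rho>, \<phi> + 2 * pi, \<sigma>) t = h (\<rho>, \<phi>, \<sigma>) t \<and> h (\<rho>, \<phi>, \<sigma> + 2 * pi) t = h (\<rho>, \<phi>, \<sigma>) t) \<and>
        (\<forall>\<rho>\<in>{0<..\<R>}. \<forall>\<phi>. ((\<lambda>t. h (\<rho>, \<phi>, S t) t) \<longlongrightarrow> 0) at_top)) \<and>
     (\<forall>c\<in>{fc, gc}. \<forall>k\<ge>1.
        smooth_on (strip \<R>) (c k) \<and>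
        (\<forall>\<rho>\<in>{0<..\<R>}. \<forall>\<phi> \<sigma>.
           c k (\<rho>, \<phi> + 2 * pi, \<sigma>) = c k (\<rho>, \<phi>, \<sigma>) \<and> c k (\<rho>, \<phi>, \<sigma> + 2 * pi) = c k (\<rho>, \<phi>, \<sigma>))) \<and>
     has_expansion_on q (strip \<R>) f fc \<and>
     has_expansion_on q (strip \<R>) g gc \<and>
     smooth_on {0<..} S \<and>
     deriv S \<sim>[at_top] (\<lambda>_. s 0) \<and>
     (\<forall>N. (\<lambda>t. deriv S t - (\<Sum>k\<le>N. t powr (- real k / real q) * s k))
            \<in> O[at_top](\<lambda>t. t powr (- real (Suc N) / real q))) \<and>
     0 < s 0 \<and> coprime \<kappa> \<kappa>' \<and> of_int \<kappa> * s 0 = of_int \<kappa>' * \<omega>"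

text \<open>
  \<open>(\<rho>, \<phi>)\<close> solves \<open>\<rho>' = P (\<rho>, \<phi>) t\<close>, \<open>\<phi>' = Q (\<rho>, \<phi>) t\<close> on the interval \<open>J\<close>, staying in the domain
  \<open>0 < \<rho> \<le> \<R>\<close> of the right-hand sides.
\<close>

definition solves_on ::
    "real \<Rightarrow> (real \<times> real \<Rightarrow> real \<Rightarrow> real) \<Rightarrow> (real \<times> real \<Rightarrow> real \<Rightarrow> real) \<Rightarrow> real set \<Rightarrow>
     (real \<Rightarrow> real) \<Rightarrow> (real \<Rightarrow> real) \<Rightarrow> bool" where
  "solves_on \<R> P Q J \<rho> \<phi> \<longleftrightarrow>
     (\<forall>t\<in>J. \<rho> t \<in> {0<..\<R>} \<and>
        (\<rho> has_real_derivative P (\<rho> t, \<phi> t) t) (at t within J) \<and>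
        (\<phi> has_real_derivative Q (\<rho> t, \<phi> t) t) (at t within J))"

definition full_solution ::
    "real \<Rightarrow> real \<Rightarrow> (real \<Rightarrow> real) \<Rightarrow> (real \<times> real \<times> real \<Rightarrow> real \<Rightarrow> real) \<Rightarrow>
     (real \<times> real \<times> real \<Rightarrow> real \<Rightarrow> real) \<Rightarrow> real set \<Rightarrow> (real \<Rightarrow> real) \<Rightarrow> (real \<Rightarrow> real) \<Rightarrow> bool" where
  "full_solution \<omega> \<R> S f g =
     solves_on \<R> (\<lambda>(\<rho>, \<phi>) t. f (\<rho>, \<phi>, S t) t) (\<lambda>(\<rho>, \<phi>) t. \<omega> + g (\<rho>, \<phi>, S t) t)"

definition truncated_solution ::
    "real \<Rightarrow> nat \<Rightarrow> nat \<Rightarrow> (nat \<Rightarrow> real \<times> real \<Rightarrow> real) \<Rightarrow> (nat \<Rightarrow> real \<times> real \<Rightarrow> real) \<Rightarrow>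
     real set \<Rightarrow> (real \<Rightarrow> real) \<Rightarrow> (real \<Rightarrow> real) \<Rightarrow> bool" where
  "truncated_solution \<R> q N \<Lambda> \<Omega> =
     solves_on \<R> (\<lambda>y t. \<Sum>k=1..N. t powr (- real k / real q) * \<Lambda> k y)
                 (\<lambda>y t. \<Sum>k=1..N. t powr (- real k / real q) * \<Omega> k y)"


section \<open>Averaged coefficients\<close>

text \<open>
  Formal series in \<open>t\<^sup>-\<^sup>1\<^sup>/\<^sup>q\<close> are formal power series in one variable \<open>\<tau>\<close>
  (\<^const>\<open>fps_X\<close>), with the point \<open>(R, \<Psi>, S)\<close> held fixed.
\<close>

definition coeffs_F ::
    "int \<Rightarrow> int \<Rightarrow> (nat \<Rightarrow> real \<times> real \<times> real \<Rightarrow> real) \<Rightarrow> nat \<Rightarrow> real \<times> real \<times> real \<Rightarrow> real" where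
  "coeffs_F \<kappa> \<kappa>' fc k = (\<lambda>(R, \<Psi>, \<sigma>). fc k (R, of_int \<kappa> / of_int \<kappa>' * \<sigma> + \<Psi>, \<sigma>))"

definition coeffs_G ::
    "int \<Rightarrow> int \<Rightarrow> (nat \<Rightarrow> real) \<Rightarrow> (nat \<Rightarrow> real \<times> real \<times> real \<Rightarrow> real) \<Rightarrow>
     nat \<Rightarrow> real \<times> real \<times> real \<Rightarrow> real" where
  "coeffs_G \<kappa> \<kappa>' s gc k =
     (\<lambda>(R, \<Psi>, \<sigma>). gc k (R, of_int \<kappa> / of_int \<kappa>' * \<sigma> + \<Psi>, \<sigma>) - of_int \<kappa> / of_int \<kappa>' * s k)"

definition series_from_1 :: "(nat \<Rightarrow> 'a \<Rightarrow> real) \<Rightarrow> 'a \<Rightarrow> real fps" where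
  "series_from_1 c x = Abs_fps (\<lambda>k. if k = 0 then 0 else c k x)"

text \<open>
  The operator \<open>(\<Sum>\<tau>\<^sup>jF\<^sub>j) \<partial>\<^sub>R + (\<Sum>\<tau>\<^sup>jG\<^sub>j) \<partial>\<^sub>\<Psi> + (s\<^sub>0 + \<Sum>\<tau>\<^sup>js\<^sub>j) \<partial>\<^sub>S + \<partial>\<^sub>t\<close> applied to \<open>\<Sum>k\<ge>0. \<tau>\<^sup>k W\<^sub>k\<close>.
  As \<open>\<tau> = t\<^sup>-\<^sup>1\<^sup>/\<^sup>q\<close>, one has \<open>\<partial>\<^sub>t = - (1/q) \<tau>\<^sup>q\<^sup>+\<^sup>1 d/d\<tau>\<close>.
\<close>

definition formal_transport ::
    "real \<Rightarrow> nat \<Rightarrow> (nat \<Rightarrow> real \<times> real \<times> real \<Rightarrow> real) \<Rightarrow> (nat \<Rightarrow> real \<times> real \<times> real \<Rightarrow> real) \<Rightarrow>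
     (nat \<Rightarrow> real) \<Rightarrow> (nat \<Rightarrow> real \<times> real \<times> real \<Rightarrow> real) \<Rightarrow> real \<times> real \<times> real \<Rightarrow> real fps" where
  "formal_transport \<R> q F G s W x =
       series_from_1 F x * Abs_fps (\<lambda>k. pdiff (strip \<R>) (1, 0, 0) (W k) x)
     + series_from_1 G x * Abs_fps (\<lambda>k. pdiff (strip \<R>) (0, 1, 0) (W k) x)
     + Abs_fps s * Abs_fps (\<lambda>k. pdiff (strip \<R>) (0, 0, 1) (W k) x)
     - fps_const (1 / real q) * fps_X ^ (q + 1) * fps_deriv (Abs_fps (\<lambda>k. W k x))"

text \<open>
  Taylor expansion of \<open>L(R + a, \<Psi> + b)\<close> about \<open>(R, \<Psi>)\<close> for series \<open>a\<close>, \<open>b\<close> without constant term;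
  only \<open>i + j \<le> N\<close> contributes to the coefficient of \<open>\<tau>\<^sup>N\<close>.
\<close>

definition formal_taylor ::
    "real \<Rightarrow> (real \<times> real \<Rightarrow> real) \<Rightarrow> real \<times> real \<Rightarrow> real fps \<Rightarrow> real fps \<Rightarrow> real fps" where
  "formal_taylor \<R> L y a b = Abs_fps (\<lambda>N. \<Sum>i\<le>N. \<Sum>j\<le>N.
     (pdiff (strip \<R>) (1, 0) ^^ i) ((pdiff (strip \<R>) (0, 1) ^^ j) L) y / (fact i * fact j)
       * fps_nth (a ^ i * b ^ j) N)"

text \<open>The formal series \<open>\<Sum>k\<ge>1. \<tau>\<^sup>k L\<^sub>k(R + a, \<Psi> + b)\<close>.\<close>

definition formal_rhs ::
    "real \<Rightarrow> (nat \<Rightarrow> real \<times> real \<Rightarrow> real) \<Rightarrow> real \<times> real \<Rightarrow> real fps \<Rightarrow> real fps \<Rightarrow> real fps" where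
  "formal_rhs \<R> L y a b =
     Abs_fps (\<lambda>N. \<Sum>k=1..N. fps_nth (fps_X ^ k * formal_taylor \<R> (L k) y a b) N)"

text \<open>
  \<open>\<Lambda>\<close>, \<open>\<Omega>\<close> are averaged coefficients, obtained with the choice \<open>u\<close>, \<open>v\<close> of transformation coefficients.
  In the formal identities the leading terms \<open>R\<close> and \<open>\<Psi>\<close> of \<open>U\<close> and \<open>V\<close> are put at index \<open>0\<close>.
\<close>

definition averaged_coefficients ::
    "real \<Rightarrow> nat \<Rightarrow> int \<Rightarrow> int \<Rightarrow> (nat \<Rightarrow> real) \<Rightarrow>
     (nat \<Rightarrow> real \<times> real \<times> real \<Rightarrow> real) \<Rightarrow> (nat \<Rightarrow> real \<times> real \<times> real \<Rightarrow> real) \<Rightarrow>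
     (nat \<Rightarrow> real \<times> real \<times> real \<Rightarrow> real) \<Rightarrow> (nat \<Rightarrow> real \<times> real \<times> real \<Rightarrow> real) \<Rightarrow>
     (nat \<Rightarrow> real \<times> real \<Rightarrow> real) \<Rightarrow> (nat \<Rightarrow> real \<times> real \<Rightarrow> real) \<Rightarrow> bool" where
  "averaged_coefficients \<R> q \<kappa> \<kappa>' s fc gc u v \<Lambda> \<Omega> \<longleftrightarrow>
     (\<forall>w\<in>{u, v}. \<forall>k\<ge>1.
        smooth_on (strip \<R>) (w k) \<and>
        (\<forall>R\<in>{0<..\<R>}. \<forall>\<Psi> \<sigma>.
           w k (R, \<Psi> + 2 * pi, \<sigma>) = w k (R, \<Psi>, \<sigma>) \<and>
           w k (R, \<Psi>, \<sigma> + 2 * pi * of_int \<kappa>') = w k (R, \<Psi>, \<sigma>))) \<and>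
     (\<forall>L\<in>{\<Lambda>, \<Omega>}. \<forall>k\<ge>1.
        smooth_on (strip \<R>) (L k) \<and>
        (\<forall>R\<in>{0<..\<R>}. \<forall>\<Psi>. L k (R, \<Psi> + 2 * pi) = L k (R, \<Psi>))) \<and>
     (\<forall>R\<in>{0<..\<R>}. \<forall>\<Psi> \<sigma>.
        let F = coeffs_F \<kappa> \<kappa>' fc; G = coeffs_G \<kappa> \<kappa>' s gc;
            U = u(0 := \<lambda>(R, \<Psi>, \<sigma>). R); V = v(0 := \<lambda>(R, \<Psi>, \<sigma>). \<Psi>);
            a = series_from_1 u (R, \<Psi>, \<sigma>); b = series_from_1 v (R, \<Psi>, \<sigma>)
        in formal_transport \<R> q F G s U (R, \<Psi>, \<sigma>) = formal_rhs \<R> \<Lambda> (R, \<Psi>) a b \<and>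
           formal_transport \<R> q F G s V (R, \<Psi>, \<sigma>) = formal_rhs \<R> \<Omega> (R, \<Psi>) a b)"


section \<open>Stability parameters\<close>

text \<open>
  The arguments \<open>l\<close>, \<open>\<nu>\<close>, \<open>\<eta>\<close>, \<open>w\<close> stand for \<open>\<lambda>\<^sub>n\<close>, \<open>\<nu>\<^sub>n\<close>, \<open>\<eta>\<^sub>m\<close>, \<open>\<omega>\<^sub>m\<close>.  The numbers \<open>\<alpha>\<^sub>1\<close>, \<open>\<alpha>\<^sub>2\<close> are complex only
  when \<open>n = m\<close>, so taking real parts changes nothing for \<open>n \<noteq> m\<close>.
\<close>

definition det2 :: "real \<Rightarrow> real \<Rightarrow> real \<Rightarrow> real \<Rightarrow> real" where
  "det2 l \<nu> \<eta> w = l * w - \<nu> * \<eta>"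

definition alpha1 :: "nat \<Rightarrow> nat \<Rightarrow> real \<Rightarrow> real \<Rightarrow> real \<Rightarrow> real \<Rightarrow> complex" where
  "alpha1 n m l \<nu> \<eta> w =
     (if n = m then (of_real (l + w) + csqrt (of_real ((l + w)\<^sup>2 - 4 * det2 l \<nu> \<eta> w))) / 2
      else if n < m then of_real l
      else of_real (det2 l \<nu> \<eta> w / w))"

definition alpha2 :: "nat \<Rightarrow> nat \<Rightarrow> real \<Rightarrow> real \<Rightarrow> real \<Rightarrow> real \<Rightarrow> complex" where
  "alpha2 n m l \<nu> \<eta> w =
     (if n = m then (of_real (l + w) - csqrt (of_real ((l + w)\<^sup>2 - 4 * det2 l \<nu> \<eta> w))) / 2
      else if n < m then of_real (det2 l \<nu> \<eta> w / l)
      else of_real w)"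

definition beta1 :: "nat \<Rightarrow> nat \<Rightarrow> nat \<Rightarrow> real \<Rightarrow> real \<Rightarrow> real \<Rightarrow> real \<Rightarrow> real" where
  "beta1 q n m l \<nu> \<eta> w =
     (if n = m then Re (alpha1 n m l \<nu> \<eta> w)
      else Re (alpha1 n m l \<nu> \<eta> w) + (real n - real m) / (2 * real q) * of_bool (n = q))"

definition beta2 :: "nat \<Rightarrow> nat \<Rightarrow> nat \<Rightarrow> real \<Rightarrow> real \<Rightarrow> real \<Rightarrow> real \<Rightarrow> real" where
  "beta2 q n m l \<nu> \<eta> w =
     (if n = m then Re (alpha2 n m l \<nu> \<eta> w)
      else Re (alpha2 n m l \<nu> \<eta> w) + (real m - real n) / (2 * real q) * of_bool (m = q))"

end

theory Submission
  imports Defs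
begin

text \<open>
  In the variables \<open>R = \<rho>\<close>, \<open>\<Psi> = \<phi> - \<kappa>/\<kappa>' S(t)\<close> put \<open>r = R + \<Sum>k\<le>n. t\<^sup>-\<^sup>k\<^sup>/\<^sup>q u\<^sub>k\<close>, \<open>\<psi> = \<Psi> + \<Sum>k\<le>m. t\<^sup>-\<^sup>k\<^sup>/\<^sup>q v\<^sub>k\<close>.
  As \<open>n, m \<le> q\<close> and the lower averaged coefficients vanish, only the orders \<open>\<le> n\<close> and \<open>\<le> m\<close> of the formal
  identities matter, where neither \<open>\<partial>\<^sub>t\<close> nor the Taylor expansion contributes: \<open>r' = t\<^sup>-\<^sup>n\<^sup>/\<^sup>q (\<Lambda>\<^sub>n + O(t\<^sup>-\<^sup>1\<^sup>/\<^sup>q))\<close>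
  and \<open>\<psi>' = t\<^sup>-\<^sup>m\<^sup>/\<^sup>q (\<Omega>\<^sub>m + O(t\<^sup>-\<^sup>1\<^sup>/\<^sup>q))\<close>.  Near the equilibrium this is a linear system with two time scales up to
  a small relative error and a decaying forcing.  The signs of the \<open>\<beta>\<close>'s give a positive determinant together
  with a sign of the trace (\<open>n = m\<close>) or of the fast diagonal entry (\<open>n \<noteq> m\<close>).  Then the sublevel sets of an
  explicit quadratic form, respectively rectangles in the variables \<open>(l x + \<nu> y, y)\<close>, are forward invariant;
  this stays true when their size shrinks like a small negative power of \<open>t\<close>, which yields the convergent
  solution of the truncated system.  Since the truncated solution tends to the equilibrium, stability near the
  one is stability near the other.  In the unstable case the quadratic form, respectively the fast variable in a
  cone around its axis, grows at least like \<open>ln t\<close> until the solution leaves the neighbourhood.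
\<close>

section \<open>Global solutions of Lipschitz equations\<close>

text \<open>The right-hand sides exist only for amplitudes in (0, R], so a given solution may live
  on a short interval and the stability claim has to supply its continuation. This is why global
  existence is proved: the field is composed with the nearest-point projection onto a box around the
  equilibrium and solved for all time, and the trapping estimate then shows that the projection
  never acts. The order of the constants shapes the statements. The relative error \<mu> is fixed by
  the matrix alone; then the linearization yields the box and the forcing constant C; the starting
  time comes last. Hence C is quantified after \<mu> in every trapping and growth statement. The
  corrections in the \<beta>'s belong to the slow variable: the smaller of two distinct orders is
  never q, and the correction attached to the larger one is nonnegative. A negative \<beta>
  therefore forces a negative \<alpha>, while for positive \<beta>'s the condition max n m < q
  removes the correction.\<close>

lemma nonpos_derivative_within_le:
  fixes f f' :: "real \<Rightarrow> real"
  assumes "a \<le> b"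
    and "\<And>t. t \<in> {a..b} \<Longrightarrow> (f has_real_derivative f' t) (at t within {a..b})"
    and "\<And>t. t \<in> {a..b} \<Longrightarrow> f' t \<le> 0"
  shows "f b \<le> f a"
proof (rule DERIV_nonpos_imp_decreasing_open[OF assms(1)])
  show "\<exists>y. (f has_real_derivative y) (at t) \<and> y \<le> 0" if "a < t" "t < b" for t
    using assms(2,3)[of t] that at_within_interior[of t "{a..b}"] by auto
  show "continuous_on {a..b} f"
    using assms(2) by (meson DERIV_continuous_on)
qed

lemma has_real_derivative_inner:
  fixes f g :: "real \<Rightarrow> 'a::real_inner"
  assumes "(f has_vector_derivative f') (at t within A)" "(g has_vector_derivative g') (at t within A)"
  shows "((\<lambda>t. f t \<bullet> g t) has_real_derivative f t \<bullet> g' + f' \<bullet> g t) (at t within A)"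
  using bounded_bilinear.has_vector_derivative[OF bounded_bilinear_inner assms]
  by (simp add: has_real_derivative_iff_has_vector_derivative)

text \<open>Picard's factorial estimate by induction: the difference of consecutive iterates has a
  derivative of at most \<open>L\<close> times the preceding difference, and integrating
  \<open>(t - a) ^ k / fact k\<close> raises the power by one. The integration is a comparison with
  the explicit primitive \<open>g\<close>.\<close>

lemma ode_iterate_bound:
  fixes H :: "real \<Rightarrow> 'a::euclidean_space \<Rightarrow> 'a"
  assumes ab: "a \<le> b"
    and y: "\<And>k t. t \<in> {a..b} \<Longrightarrow> (y (Suc k) has_vector_derivative H t (y k t)) (at t within {a..b})"
    and y0: "\<And>t. t \<in> {a..b} \<Longrightarrow> norm (y 1 t - y 0 t) \<le> M"
    and init: "\<And>k. y k a = c"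
    and L: "\<And>t u v. t \<in> {a..b} \<Longrightarrow> norm (H t u - H t v) \<le> L * norm (u - v)" "0 \<le> L"
    and t: "t \<in> {a..b}"
  shows "norm (y (Suc k) t - y k t) \<le> M * (L * (t - a)) ^ k / fact k"
  using t
proof (induction k arbitrary: t)
  case 0
  then show ?case using y0 by simp
next
  case (Suc k)
  define g where "g = (\<lambda>t. M * L ^ Suc k * (t - a) ^ Suc k / fact (Suc k))"
  have g': "(g has_vector_derivative M * L ^ Suc k * (s - a) ^ k / fact k) (at s)" for s
  proof -
    have "(g has_real_derivative M * L ^ Suc k / fact (Suc k) * (real (Suc k) * (s - a) ^ k)) (at s)"
      unfolding g_def by (auto intro!: derivative_eq_intros simp del: fact_Suc power_Suc)
    also have "M * L ^ Suc k / fact (Suc k) * (real (Suc k) * (s - a) ^ k) = M * L ^ Suc k * (s - a) ^ k / fact k"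
      by (simp add: divide_simps)
    finally show ?thesis by (simp add: has_real_derivative_iff_has_vector_derivative)
  qed
  have d: "((\<lambda>t. y (Suc (Suc k)) t - y (Suc k) t) has_vector_derivative
          H s (y (Suc k) s) - H s (y k s)) (at s within {a..b})" if "s \<in> {a..b}" for s
    by (intro has_vector_derivative_diff y that)
  show ?case
  proof (cases "a = t")
    case True
    then show ?thesis using init by simp
  next
    case False
    with Suc.prems have at: "a < t" "t \<le> b" by auto
    have "norm ((y (Suc (Suc k)) t - y (Suc k) t) - (y (Suc (Suc k)) a - y (Suc k) a)) \<le> g t - g a"
    proof (rule differentiable_bound_general[OF at(1)])
      show "continuous_on {a..t} (\<lambda>t. y (Suc (Suc k)) t - y (Suc k) t)"
      proof (rule continuous_on_subset)
        show "continuous_on {a..b} (\<lambda>t. y (Suc (Suc k)) t - y (Suc k) t)"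
          unfolding continuous_on_eq_continuous_within
          by (intro ballI, rule has_vector_derivative_continuous, rule d)
      qed (use at in auto)
      show "continuous_on {a..t} g"
        unfolding g_def by (intro continuous_intros) auto
      fix s assume s: "a < s" "s < t"
      then have sab: "s \<in> {a..b}" using at by auto
      have "at s within {a..b} = at s"
        by (rule at_within_interior) (use s at in auto)
      then show "((\<lambda>t. y (Suc (Suc k)) t - y (Suc k) t) has_vector_derivative
          H s (y (Suc k) s) - H s (y k s)) (at s)" using d[OF sab] by simp
      show "(g has_vector_derivative M * L ^ Suc k * (s - a) ^ k / fact k) (at s)" by (rule g')
      have "norm (H s (y (Suc k) s) - H s (y k s)) \<le> L * norm (y (Suc k) s - y k s)"
        by (rule L(1)[OF sab])
      also have "\<dots> \<le> L * (M * (L * (s - a)) ^ k / fact k)"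
        by (rule mult_left_mono[OF Suc.IH[OF sab] L(2)])
      finally show "norm (H s (y (Suc k) s) - H s (y k s)) \<le> M * L ^ Suc k * (s - a) ^ k / fact k"
        by (simp add: power_mult_distrib mult_ac)
    qed
    then show ?thesis using init by (simp add: g_def power_mult_distrib mult_ac)
  qed
qed

text \<open>The Lipschitz constant may depend on the time horizon but not on the state, so the
  Picard series converges uniformly on every \<open>{a..b}\<close>. The iterates do not depend on
  \<open>b\<close> and have one limit on the whole half-line; local solutions need not be
  continued.\<close>

lemma ode_global_existence:
  fixes H :: "real \<Rightarrow> 'a::euclidean_space \<Rightarrow> 'a"
  assumes cont: "continuous_on ({a..} \<times> UNIV) (\<lambda>(t, u). H t u)"
    and lip: "\<And>b. \<exists>L. \<forall>t\<in>{a..b}. \<forall>u v. norm (H t u - H t v) \<le> L * norm (u - v)"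
  shows "\<exists>y. y a = c \<and> (\<forall>t\<in>{a..}. (y has_vector_derivative H t (y t)) (at t within {a..}))"
proof -
  define y where "y = rec_nat (\<lambda>_. c) (\<lambda>k z t. c + integral {a..t} (\<lambda>s. H s (z s)))"
  have y_0: "y 0 = (\<lambda>_. c)" and y_Suc: "y (Suc k) = (\<lambda>t. c + integral {a..t} (\<lambda>s. H s (y k s)))" for k
    by (simp_all add: y_def)
  have comp: "continuous_on {a..b} (\<lambda>s. H s (z s))" if "continuous_on {a..b} z" for z b
  proof -
    have "continuous_on {a..b} ((\<lambda>(t, u). H t u) \<circ> (\<lambda>s. (s, z s)))"
      by (intro continuous_on_compose continuous_on_subset[OF cont] continuous_intros that) auto
    then show ?thesis by (simp add: o_def)
  qed
  have int: "((\<lambda>t. c + integral {a..t} (\<lambda>s. H s (z s))) has_vector_derivative H t (z t)) (at t within {a..b})"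
    if "continuous_on {a..b} z" "t \<in> {a..b}" for z b t
    using integral_has_vector_derivative[OF comp[OF that(1)] that(2)]
    by (auto intro!: derivative_eq_intros)
  have ycont: "continuous_on {a..b} (y k)" for k b
  proof (induction k)
    case (Suc k)
    show ?case unfolding y_Suc
      unfolding continuous_on_eq_continuous_within
      by (intro ballI, rule has_vector_derivative_continuous, rule int[OF Suc])
  qed (simp add: y_0)
  have yder: "(y (Suc k) has_vector_derivative H t (y k t)) (at t within {a..b})"
    if "t \<in> {a..b}" for k t b
    unfolding y_Suc by (rule int[OF ycont that])
  have init: "y k a = c" for k
    by (cases k) (simp_all add: y_0 y_Suc)
  have unif: "\<exists>l. uniform_limit {a..b} y l sequentially" if ab: "a \<le> b" for b
  proof -
    obtain L0 where L0: "\<And>t u v. t \<in> {a..b} \<Longrightarrow> norm (H t u - H t v) \<le> L0 * norm (u - v)"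
      using lip by blast
    define L where "L = max L0 0"
    have L: "norm (H t u - H t v) \<le> L * norm (u - v)" if "t \<in> {a..b}" for t u v
      using L0[OF that, of u v] mult_right_mono[of L0 L "norm (u - v)"] by (simp add: L_def)
    have "compact ((\<lambda>t. y 1 t - y 0 t) ` {a..b})"
      by (intro compact_continuous_image continuous_intros ycont) auto
    then obtain M where M: "\<And>t. t \<in> {a..b} \<Longrightarrow> norm (y 1 t - y 0 t) \<le> M"
      by (meson bounded_iff compact_imp_bounded image_eqI)
    have M0: "0 \<le> M" by (rule order_trans[OF norm_ge_zero M[of a]]) (use ab in simp)
    \<comment> \<open>The iterates are the partial sums of their increments, which are majorized by
      an exponential series; \<open>M\<close> bounds the first increment.\<close>
    have "uniform_limit {a..b} (\<lambda>k t. \<Sum>i<k. y (Suc i) t - y i t) (\<lambda>t. suminf (\<lambda>i. y (Suc i) t - y i t)) sequentially"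
    proof (rule Weierstrass_m_test)
      show "norm (y (Suc k) t - y k t) \<le> M * ((L * (b - a)) ^ k / fact k)" if "t \<in> {a..b}" for k t
      proof -
        have "norm (y (Suc k) t - y k t) \<le> M * (L * (t - a)) ^ k / fact k"
          using ode_iterate_bound[where y=y and H=H and L=L and M=M and k=k, OF ab yder M init L _ that]
          by (simp add: L_def)
        also have "\<dots> \<le> M * (L * (b - a)) ^ k / fact k"
          using that M0 by (intro divide_right_mono mult_left_mono power_mono) (auto simp: L_def)
        finally show ?thesis by simp
      qed
      have "summable (\<lambda>k. (L * (b - a)) ^ k / fact k)"
        using summable_exp[of "L * (b - a)"] by (simp add: divide_inverse mult.commute)
      then show "summable (\<lambda>k. M * ((L * (b - a)) ^ k / fact k))"
        by (rule summable_mult)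
    qed
    moreover have "(\<Sum>i<k. y (Suc i) t - y i t) = y k t - c" for k t
      by (subst sum_lessThan_telescope) (simp add: y_0)
    ultimately have "uniform_limit {a..b} (\<lambda>k t. (y k t - c) + c) (\<lambda>t. suminf (\<lambda>i. y (Suc i) t - y i t) + c) sequentially"
      by (intro uniform_limit_intros) auto
    then show ?thesis by auto
  qed
  define Y where "Y = (\<lambda>t. lim (\<lambda>k. y k t))"
  have Yu: "uniform_limit {a..b} y Y sequentially" if ab: "a \<le> b" for b
  proof -
    obtain l where l: "uniform_limit {a..b} y l sequentially" using unif[OF ab] by blast
    have "l t = Y t" if "t \<in> {a..b}" for t
      using tendsto_uniform_limitI[OF l that] by (simp add: Y_def limI)
    then show ?thesis 
      using l uniform_limit_cong'[of "{a..b}" y y l Y sequentially] by blast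
  qed
  have Ycont: "continuous_on {a..b} Y" if "a \<le> b" for b
    by (rule uniform_limit_theorem[OF _ Yu[OF that]]) (simp_all add: ycont)
  have Yeq: "Y t = c + integral {a..t} (\<lambda>s. H s (Y s))" if at: "a \<le> t" for t
  proof -
    obtain L where L: "\<And>s u v. s \<in> {a..t} \<Longrightarrow> norm (H s u - H s v) \<le> L * norm (u - v)"
      using lip by blast
    \<comment> \<open>The Lipschitz bound carries uniform convergence from the iterates to the
      integrands, so the limit can be taken in the integral equation.\<close>
    have "uniform_limit {a..t} (\<lambda>k s. H s (y k s)) (\<lambda>s. H s (Y s)) sequentially"
    proof (rule uniform_limitI)
      fix e :: real assume e: "0 < e"
      define L' where "L' = max L 1"
      have "\<forall>\<^sub>F k in sequentially. \<forall>s\<in>{a..t}. dist (y k s) (Y s) < e / L'"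
        by (rule uniform_limitD[OF Yu[OF at]]) (use e in \<open>auto simp: L'_def\<close>)
      then show "\<forall>\<^sub>F k in sequentially. \<forall>s\<in>{a..t}. dist (H s (y k s)) (H s (Y s)) < e"
      proof eventually_elim
        case (elim k)
        show ?case
        proof
          fix s assume s: "s \<in> {a..t}"
          have "norm (H s (y k s) - H s (Y s)) \<le> L * norm (y k s - Y s)" by (rule L[OF s])
          also have "\<dots> \<le> L' * norm (y k s - Y s)" by (intro mult_right_mono) (auto simp: L'_def)
          also have "\<dots> < L' * (e / L')"
            using elim s by (intro mult_strict_left_mono) (auto simp: dist_norm L'_def)
          finally show "dist (H s (y k s)) (H s (Y s)) < e" by (simp add: dist_norm L'_def)
        qed
      qed
    qed
    from uniform_limit_integral[OF this comp[OF ycont]]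
    obtain I J where IJ: "\<And>n. ((\<lambda>s. H s (y n s)) has_integral I n) {a..t}"
       "((\<lambda>s. H s (Y s)) has_integral J) {a..t}" "I \<longlonglongrightarrow> J" by auto
    have "(\<lambda>k. y (Suc k) t) = (\<lambda>k. c + I k)"
      using IJ(1) by (auto simp: y_Suc integral_unique)
    moreover have "(\<lambda>k. y (Suc k) t) \<longlonglongrightarrow> Y t"
      by (rule LIMSEQ_Suc, rule tendsto_uniform_limitI[OF Yu[OF at]]) (use at in auto)
    moreover have "(\<lambda>k. c + I k) \<longlonglongrightarrow> c + J" by (intro tendsto_intros IJ(3))
    ultimately show ?thesis using IJ(2) LIMSEQ_unique by (metis integral_unique)
  qed
  show ?thesis
  proof (intro exI[of _ Y] conjI ballI)
    show "Y a = c" using Yeq[of a] by simp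
    fix t assume t: "t \<in> {a..}"
    have ab: "a \<le> t + 1" using t by simp
    have "((\<lambda>t. c + integral {a..t} (\<lambda>s. H s (Y s))) has_vector_derivative H t (Y t)) (at t within {a..t+1})"
      by (rule int[OF Ycont[OF ab]]) (use t in auto)
    then have "(Y has_vector_derivative H t (Y t)) (at t within {a..t+1})"
      by (rule has_vector_derivative_transform[rotated 2]) (use Yeq t in auto)
    \<comment> \<open>The interval up to \<open>t + 1\<close> contains a neighbourhood of
      \<open>t\<close> relative to \<open>{a..}\<close>, so the derivative found on a compact
      interval is the one on the half-line.\<close>
    moreover have "at t within {a..t+1} = at t within {a..}"
      by (rule at_within_nhd[where S="{..<t+1}"]) auto
    ultimately show "(Y has_vector_derivative H t (Y t)) (at t within {a..})" by simp
  qed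
qed

text \<open>Gronwall's argument: the squared distance of two solutions grows at most at rate
  \<open>2 * L\<close>, so the weight \<open>exp (- (2 * L * t))\<close> makes it nonincreasing, and
  it starts at zero.\<close>

lemma ode_unique:
  fixes H :: "real \<Rightarrow> 'a::real_inner \<Rightarrow> 'a"
  assumes ab: "a \<le> b"
    and L: "\<And>t u v. t \<in> {a..b} \<Longrightarrow> norm (H t u - H t v) \<le> L * norm (u - v)"
    and y: "\<And>t. t \<in> {a..b} \<Longrightarrow> (y has_vector_derivative H t (y t)) (at t within {a..b})"
    and z: "\<And>t. t \<in> {a..b} \<Longrightarrow> (z has_vector_derivative H t (z t)) (at t within {a..b})"
    and init: "y a = z a"
  shows "y b = z b"
proof -
  define V where "V = (\<lambda>t. exp (- (2 * L * t)) * ((y t - z t) \<bullet> (y t - z t)))"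
  define V' where "V' = (\<lambda>t. exp (- (2 * L * t)) * (2 * ((y t - z t) \<bullet> (H t (y t) - H t (z t))) - 2 * L * ((y t - z t) \<bullet> (y t - z t))))"
  have V': "(V has_real_derivative V' t) (at t within {a..b})" if "t \<in> {a..b}" for t
    unfolding V_def V'_def
    by (rule derivative_eq_intros has_real_derivative_inner has_vector_derivative_diff y z that refl)+
      (simp add: algebra_simps inner_commute)
  have V'_le: "V' t \<le> 0" if "t \<in> {a..b}" for t
  proof -
    have "(y t - z t) \<bullet> (H t (y t) - H t (z t)) \<le> norm (y t - z t) * norm (H t (y t) - H t (z t))"
      by (rule norm_cauchy_schwarz)
    also have "\<dots> \<le> norm (y t - z t) * (L * norm (y t - z t))"
      by (intro mult_left_mono L that) auto
    also have "\<dots> = L * ((y t - z t) \<bullet> (y t - z t))"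
      by (simp add: dot_square_norm power2_eq_square)
    finally show ?thesis
      unfolding V'_def by (intro mult_nonneg_nonpos) auto
  qed
  have "V b \<le> V a"
    by (rule nonpos_derivative_within_le[OF ab V' V'_le])
  then have "(y b - z b) \<bullet> (y b - z b) \<le> 0"
    using init by (simp add: V_def mult_le_0_iff)
  then show ?thesis
    by (metis antisym inner_eq_zero_iff inner_ge_zero right_minus_eq)
qed

section \<open>Trapping regions and growth for almost linear systems\<close>

text \<open>The infimum of the times with \<open>p t = c\<close> is attained because these times
  form a closed set; an earlier value of at least \<open>c\<close> would produce an earlier such
  time by the intermediate value theorem.\<close>

lemma first_hitting_time:
  fixes p :: "real \<Rightarrow> real"
  assumes "a \<le> b" "continuous_on {a..b} p" "p a < c" "c \<le> p b"
  obtains t where "a < t" "t \<le> b" "p t = c" "\<And>r. a \<le> r \<Longrightarrow> r < t \<Longrightarrow> p r < c"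
proof -
  define Z where "Z = {t \<in> {a..b}. p t = c}"
  have "closed Z" unfolding Z_def
    by (intro continuous_closed_preimage_constant assms closed_atLeastAtMost)
  moreover have "Z \<noteq> {}"
    using IVT'[of p a c b] assms by (auto simp: Z_def)
  moreover have bdd: "bdd_below Z" by (auto simp: Z_def intro: bdd_belowI[of _ a])
  ultimately have Z: "Inf Z \<in> Z" by (intro closed_contains_Inf)
  show thesis
  proof (rule that[of "Inf Z"])
    have "Inf Z \<noteq> a" using Z assms(3) by (auto simp: Z_def)
    then show "a < Inf Z" "Inf Z \<le> b" "p (Inf Z) = c" using Z by (auto simp: Z_def)
    fix r assume r: "a \<le> r" "r < Inf Z"
    show "p r < c"
    proof (rule ccontr)
      assume "\<not> p r < c"
      moreover have "continuous_on {a..r} p"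
        by (rule continuous_on_subset[OF assms(2)]) (use r Z in \<open>auto simp: Z_def\<close>)
      ultimately obtain t where "a \<le> t" "t \<le> r" "p t = c"
        using IVT'[of p a c r] assms r by auto
      then have "t \<in> Z" using r Z by (auto simp: Z_def)
      then show False using cInf_lower[OF _ bdd] \<open>t \<le> r\<close> r by fastforce
    qed
  qed
qed

text \<open>Bootstrap principle: it suffices to improve the weak bound on \<open>{a..t}\<close> to a
  strict one at \<open>t\<close>, since the weak bound still holds at a first time with
  \<open>p = c\<close>. The interval \<open>J\<close> is arbitrary because solutions are given on
  such sets.\<close>

lemma continuous_induction_below:
  fixes p :: "real \<Rightarrow> real"
  assumes J: "is_interval J" "a \<in> J" and cont: "continuous_on J p" and init: "p a < c"
    and step: "\<And>t. t \<in> J \<Longrightarrow> a \<le> t \<Longrightarrow> (\<And>r. r \<in> {a..t} \<Longrightarrow> p r \<le> c) \<Longrightarrow> p t < c"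
    and t: "t \<in> J" "a \<le> t"
  shows "p t < c"
proof (rule ccontr)
  assume "\<not> p t < c"
  then have ge: "c \<le> p t" by simp
  have sub: "{a..t} \<subseteq> J"
  proof
    fix r assume "r \<in> {a..t}"
    then show "r \<in> J" using mem_is_interval_1_I[OF J(1) J(2) t(1), of r] by simp
  qed
  obtain r where r: "a < r" "r \<le> t" "p r = c" "\<And>r'. a \<le> r' \<Longrightarrow> r' < r \<Longrightarrow> p r' < c"
    using first_hitting_time[OF t(2) continuous_on_subset[OF cont sub] init ge] by blast
  have "p r < c"
  proof (rule step)
    show "r \<in> J" "a \<le> r" using r sub by auto
    show "p r' \<le> c" if "r' \<in> {a..r}" for r'
      using r(3) r(4)[of r'] that by (cases "r' = r") auto
  qed
  then show False using r by simp
qed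

text \<open>Covers regions with corners: each derivative condition is imposed only where the other
  function is nonpositive. At the first time when the larger function vanishes, the vanishing one
  has a negative derivative and so was positive shortly before. A single barrier is the case
  \<open>f = g\<close>.\<close>

lemma two_barriers:
  fixes f g f' g' :: "real \<Rightarrow> real"
  assumes f: "\<And>t. t \<in> {a..b} \<Longrightarrow> (f has_real_derivative f' t) (at t within {a..b})"
    and g: "\<And>t. t \<in> {a..b} \<Longrightarrow> (g has_real_derivative g' t) (at t within {a..b})"
    and init: "f a < 0" "g a < 0"
    and in1: "\<And>t. t \<in> {a..b} \<Longrightarrow> f t = 0 \<Longrightarrow> g t \<le> 0 \<Longrightarrow> f' t < 0"
    and in2: "\<And>t. t \<in> {a..b} \<Longrightarrow> g t = 0 \<Longrightarrow> f t \<le> 0 \<Longrightarrow> g' t < 0"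
    and t: "t \<in> {a..b}"
  shows "f t < 0 \<and> g t < 0"
proof (rule ccontr)
  assume neg: "\<not> (f t < 0 \<and> g t < 0)"
  define p where "p = (\<lambda>t. max (f t) (g t))"
  have "continuous_on {a..b} f" "continuous_on {a..b} g"
    using f g by (meson DERIV_continuous_on)+
  then have "continuous_on {a..b} p" unfolding p_def by (intro continuous_intros)
  then have "continuous_on {a..t} p" by (rule continuous_on_subset) (use t in auto)
  then obtain r where r: "a < r" "r \<le> t" "p r = 0" "\<And>r'. a \<le> r' \<Longrightarrow> r' < r \<Longrightarrow> p r' < 0"
  proof -
    have "a \<le> t" "p a < 0" "0 \<le> p t" using t init neg by (auto simp: p_def)
    then show thesis
      using first_hitting_time[of a t p 0] \<open>continuous_on {a..t} p\<close> that by blast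
  qed
  have rab: "r \<in> {a..b}" using r t by auto
  have *: False if P: "(P has_real_derivative P') (at r within {a..b})" "P' < 0" "P r = 0"
    "\<And>r'. P r' \<le> p r'" for P P'
  proof -
    obtain d where d: "d > 0" "\<And>h. h > 0 \<Longrightarrow> r - h \<in> {a..b} \<Longrightarrow> h < d \<Longrightarrow> P r < P (r - h)"
      using has_real_derivative_neg_dec_left[OF P(1,2)] by blast
    \<comment> \<open>Going back by \<open>h\<close> stays in \<open>{a..b}\<close> and within the
      range where the negative derivative makes \<open>P\<close> larger than at
      \<open>r\<close>.\<close>
    define h where "h = min (d / 2) (r - a)"
    have "P r < P (r - h)" by (rule d(2)) (use d(1) r t in \<open>auto simp: h_def min_def field_simps\<close>)
    moreover have "p (r - h) < 0" by (rule r(4)) (use d(1) r t in \<open>auto simp: h_def\<close>)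
    ultimately show False using P(3) P(4)[of "r - h"] by simp
  qed
  have "f r \<le> 0" "g r \<le> 0" "f r = 0 \<or> g r = 0"
    using r(3) by (auto simp: p_def max_def split: if_splits)
  then show False
    using *[OF f[OF rab] in1[OF rab]] *[OF g[OF rab] in2[OF rab]] by (auto simp: p_def)
qed

text \<open>The lower bound \<open>c / t\<close> has the primitive \<open>c * ln t\<close>, which
  diverges: logarithmic growth is all that the slowest admissible rate provides.\<close>

lemma unbounded_if_derivative_ge_inverse:
  fixes p p' :: "real \<Rightarrow> real"
  assumes a: "0 < a" and c: "0 < c"
    and p: "\<And>t. a \<le> t \<Longrightarrow> (p has_real_derivative p' t) (at t within {a..})"
    and p': "\<And>t. a \<le> t \<Longrightarrow> c / t \<le> p' t"
  shows "\<exists>t\<ge>a. B < p t"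
proof -
  \<comment> \<open>Chosen so that \<open>c * ln b\<close> exceeds \<open>c * ln a\<close> by
    \<open>\<bar>B - p a\<bar> + 1\<close>.\<close>
  define b where "b = a * exp ((\<bar>B - p a\<bar> + 1) / c)"
  have ab: "a \<le> b" using a c by (simp add: b_def)
  have "c * ln b - p b \<le> c * ln a - p a"
  proof (rule DERIV_nonpos_imp_decreasing_open[OF ab])
    show "\<exists>y. ((\<lambda>t. c * ln t - p t) has_real_derivative y) (at t) \<and> y \<le> 0" if t: "a < t" "t < b" for t
    proof -
      have "(p has_real_derivative p' t) (at t)"
        using p[of t] t at_within_interior[of t "{a..}"] by auto
      then have "((\<lambda>t. c * ln t - p t) has_real_derivative c * (1 / t) - p' t) (at t)"
        using t a by (auto intro!: derivative_eq_intros)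
      then show ?thesis using p'[of t] t by (intro exI[of _ "c * (1 / t) - p' t"]) auto
    qed
    have "continuous_on {a..} p" using p by (intro DERIV_continuous_on[of _ p p']) auto
    then show "continuous_on {a..b} (\<lambda>t. c * ln t - p t)"
      using a by (intro continuous_intros) (auto intro: continuous_on_subset)
  qed
  moreover have "c * ln b = c * ln a + (\<bar>B - p a\<bar> + 1)"
    using a c by (simp add: b_def ln_mult field_simps)
  ultimately show ?thesis using ab by (intro exI[of _ b]) auto
qed

text \<open>The errors stand inside the power of \<open>t\<close> of their own equation, so they are
  small relative to the rate of that component. They are given for each \<open>t\<close> separately;
  only pointwise bounds enter the estimates.\<close>

definition almost_linear ::
    "nat \<Rightarrow> nat \<Rightarrow> nat \<Rightarrow> real \<Rightarrow> real \<Rightarrow> real \<Rightarrow> real \<Rightarrow> real \<Rightarrow> real \<Rightarrow> real set \<Rightarrow>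
     (real \<Rightarrow> real) \<Rightarrow> (real \<Rightarrow> real) \<Rightarrow> bool" where
  "almost_linear q n m l \<nu> \<eta> w \<mu> C J x y \<longleftrightarrow>
     (\<forall>t\<in>J. \<exists>e1 e2.
        (x has_real_derivative t powr (- real n / real q) * (l * x t + \<nu> * y t + e1)) (at t within J) \<and>
        (y has_real_derivative t powr (- real m / real q) * (\<eta> * x t + w * y t + e2)) (at t within J) \<and>
        \<bar>e1\<bar> \<le> \<mu> * (\<bar>x t\<bar> + \<bar>y t\<bar>) + C * t powr (- 1 / real q) \<and>
        \<bar>e2\<bar> \<le> \<mu> * (\<bar>x t\<bar> + \<bar>y t\<bar>) + C * t powr (- 1 / real q))"

text \<open>The size of a trapping region that moves with \<open>t\<close>. A relative decay of at
  most \<open>\<mu> / t\<close> is slower than the damping because \<open>1 / t\<close> is at most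
  every admissible rate, and the forcing is a small fraction of the radius. A constant radius yields
  stability, a small negative power of \<open>t\<close> yields convergence.\<close>

abbreviation "slow_radius q \<mu> C I d d' \<equiv>
  (\<forall>t\<in>I. 0 < d t \<and> (d has_real_derivative d' t) (at t within I) \<and>
     - \<mu> * d t / t \<le> d' t \<and> t powr (- 1 / real q) \<le> \<mu> \<and> C * t powr (- 1 / real q) \<le> \<mu> * d t)"

text \<open>\<open>C\<close> is quantified after \<open>M\<close> and \<open>\<mu>\<close>, because
  the constant of the forcing is known only after \<open>\<mu>\<close> has fixed the box of
  linearization.\<close>

abbreviation "traps q n m l \<nu> \<eta> w M \<mu> \<equiv> \<forall>C a b x y d d'.
   0 \<le> C \<longrightarrow> 1 \<le> a \<longrightarrow> almost_linear q n m l \<nu> \<eta> w \<mu> C {a..b} x y \<longrightarrow>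
   slow_radius q \<mu> C {a..b} d d' \<longrightarrow> \<bar>x a\<bar> + \<bar>y a\<bar> \<le> d a / M \<longrightarrow>
   (\<forall>t\<in>{a..b}. \<bar>x t\<bar> + \<bar>y t\<bar> \<le> M * d t)"

text \<open>The forcing is compared with the initial size \<open>\<delta>\<close> at the starting
  time only: it decays, while the solution keeps at least a fixed fraction of that size. Solutions
  on a whole half-line are meant, since unboundedness will contradict never leaving a box.\<close>

abbreviation "grows_from_axis q n m l \<nu> \<eta> w \<mu> \<equiv> \<forall>C \<delta> a x y.
   0 \<le> C \<longrightarrow> 1 \<le> a \<longrightarrow> 0 < \<delta> \<longrightarrow> almost_linear q n m l \<nu> \<eta> w \<mu> C {a..} x y \<longrightarrow> 
   a powr (- 1 / real q) \<le> \<mu> \<longrightarrow> C * a powr (- 1 / real q) \<le> \<mu> * \<delta> \<longrightarrow>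
   \<bar>x a - \<delta>\<bar> + \<bar>y a\<bar> \<le> \<mu> * \<delta> \<longrightarrow> (\<forall>B. \<exists>t\<ge>a. B < \<bar>x t\<bar> + \<bar>y t\<bar>)"

abbreviation "grows q n m l \<nu> \<eta> w x0 y0 \<mu> \<equiv> \<forall>C \<delta> a x y.
   0 \<le> C \<longrightarrow> 1 \<le> a \<longrightarrow> 0 < \<delta> \<longrightarrow> almost_linear q n m l \<nu> \<eta> w \<mu> C {a..} x y \<longrightarrow> 
   a powr (- 1 / real q) \<le> \<mu> \<longrightarrow> C * a powr (- 1 / real q) \<le> \<mu> * \<delta> \<longrightarrow>
   \<bar>x a - \<delta> * x0\<bar> + \<bar>y a - \<delta> * y0\<bar> \<le> \<mu> * \<delta> \<longrightarrow> (\<forall>B. \<exists>t\<ge>a. B < \<bar>x t\<bar> + \<bar>y t\<bar>)"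

text \<open>Exchanging the two variables reduces \<open>m < n\<close> to
  \<open>n < m\<close>.\<close>

lemma almost_linear_swap:
  "almost_linear q n m l \<nu> \<eta> w \<mu> C J x y \<longleftrightarrow> almost_linear q m n w \<eta> \<nu> l \<mu> C J y x"
proof -
  have "almost_linear q m n w \<eta> \<nu> l \<mu> C J y x"
    if al: "almost_linear q n m l \<nu> \<eta> w \<mu> C J x y" for n m l \<nu> \<eta> w x y
    unfolding almost_linear_def
  proof
    fix t assume "t \<in> J"
    then obtain e1 e2 where
        "(x has_real_derivative t powr (- real n / real q) * (l * x t + \<nu> * y t + e1)) (at t within J)"
        "(y has_real_derivative t powr (- real m / real q) * (\<eta> * x t + w * y t + e2)) (at t within J)"
        "\<bar>e1\<bar> \<le> \<mu> * (\<bar>x t\<bar> + \<bar>y t\<bar>) + C * t powr (- 1 / real q)"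
        "\<bar>e2\<bar> \<le> \<mu> * (\<bar>x t\<bar> + \<bar>y t\<bar>) + C * t powr (- 1 / real q)"
      using al unfolding almost_linear_def by blast
    then show "\<exists>e1 e2.
        (y has_real_derivative t powr (- real m / real q) * (w * y t + \<eta> * x t + e1)) (at t within J) \<and>
        (x has_real_derivative t powr (- real n / real q) * (\<nu> * y t + l * x t + e2)) (at t within J) \<and>
        \<bar>e1\<bar> \<le> \<mu> * (\<bar>y t\<bar> + \<bar>x t\<bar>) + C * t powr (- 1 / real q) \<and>
        \<bar>e2\<bar> \<le> \<mu> * (\<bar>y t\<bar> + \<bar>x t\<bar>) + C * t powr (- 1 / real q)"
      by (intro exI[of _ e2] exI[of _ e1]) (simp add: add.commute)
  qed
  then show ?thesis by blast
qed

section \<open>Elementary estimates for rates and linear combinations\<close>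

lemma abs_add_le_twice:
  fixes e1 e2 u v p r :: real
  assumes "\<bar>e1\<bar> \<le> u + v" "\<bar>e2\<bar> \<le> u + v" "u \<le> p" "v \<le> r"
  shows "\<bar>e1\<bar> + \<bar>e2\<bar> \<le> 2 * (p + r)"
  using add_mono[OF order_trans[OF assms(1) add_mono[OF assms(3,4)]] order_trans[OF assms(2) add_mono[OF assms(3,4)]]]
  by simp

text \<open>The way in which \<open>n <= q\<close> enters the dynamics: every admissible rate is at
  least \<open>1 / t\<close>, hence not integrable at infinity.\<close>

lemma inverse_le_powr:
  assumes "1 \<le> t" "n \<le> q" "0 < q"
  shows "1 / t \<le> t powr (- real n / real q)"
proof -
  have "t powr (- 1) \<le> t powr (- real n / real q)"
    using assms by (intro powr_mono) (auto simp: field_simps)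
  then show ?thesis using assms by (simp add: powr_minus_divide)
qed

text \<open>Distinct integer orders differ by at least one step \<open>1 / q\<close>, so the slow
  rate is smaller than the fast one by a factor that tends to zero.\<close>

lemma powr_gap:
  assumes "1 \<le> t" "n < m" "0 < q"
  shows "t powr (- real m / real q) \<le> t powr (- real n / real q) * t powr (- 1 / real q)"
proof -
  have "- real m / real q \<le> - real n / real q + - 1 / real q"
    using assms by (simp add: field_simps)
  then show ?thesis using assms by (simp add: powr_mono flip: powr_add)
qed

lemma powr_rate_antimono:
  assumes "0 < s" "s \<le> t"
  shows "t powr (- 1 / real q) \<le> s powr (- 1 / real q)"
  using assms by (intro powr_mono2') auto

lemma sum_abs_squares:
  fixes x y :: real
  shows "x\<^sup>2 + y\<^sup>2 \<le> (\<bar>x\<bar> + \<bar>y\<bar>)\<^sup>2" "(\<bar>x\<bar> + \<bar>y\<bar>)\<^sup>2 \<le> 2 * (x\<^sup>2 + y\<^sup>2)"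
proof -
  show "x\<^sup>2 + y\<^sup>2 \<le> (\<bar>x\<bar> + \<bar>y\<bar>)\<^sup>2" by (simp add: power2_sum)
  have "2 * (x\<^sup>2 + y\<^sup>2) - (\<bar>x\<bar> + \<bar>y\<bar>)\<^sup>2 = (\<bar>x\<bar> - \<bar>y\<bar>)\<^sup>2"
    by (simp add: power2_sum power2_diff)
  then show "(\<bar>x\<bar> + \<bar>y\<bar>)\<^sup>2 \<le> 2 * (x\<^sup>2 + y\<^sup>2)" using zero_le_power2[of "\<bar>x\<bar> - \<bar>y\<bar>"] by linarith
qed

lemma abs_lincomb_le:
  fixes a b x y k :: real
  assumes "\<bar>a\<bar> \<le> k" "\<bar>b\<bar> \<le> k"
  shows "\<bar>a * x + b * y\<bar> \<le> k * (\<bar>x\<bar> + \<bar>y\<bar>)"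
proof -
  have "\<bar>a * x + b * y\<bar> \<le> \<bar>a\<bar> * \<bar>x\<bar> + \<bar>b\<bar> * \<bar>y\<bar>" by (metis abs_mult abs_triangle_ineq)
  also have "\<dots> \<le> k * \<bar>x\<bar> + k * \<bar>y\<bar>" by (intro add_mono mult_right_mono assms) auto
  finally show ?thesis by (simp add: distrib_left)
qed

text \<open>For the matrix A with rows \<open>(l, \<nu>)\<close> and \<open>(\<eta>, w)\<close> and
  determinant D this is D |z|^2 + |adj(A) z|^2 with the adjugate adj(A). Since adj(A) A = D I and A
  + adj(A) = tr(A) I, its derivative along z' = A z is 2 D z . (A + adj(A)) z = 2 D tr(A) |z|^2. So
  for D > 0 the form is positive definite and its derivative has the sign of the trace, whether the
  eigenvalues are real or complex.\<close>

definition lyapunov :: "real \<Rightarrow> real \<Rightarrow> real \<Rightarrow> real \<Rightarrow> real \<Rightarrow> real \<Rightarrow> real" where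
  "lyapunov l \<nu> \<eta> w x y =
     (l * w - \<nu> * \<eta>) * (x\<^sup>2 + y\<^sup>2) + (w * x - \<nu> * y)\<^sup>2 + (l * y - \<eta> * x)\<^sup>2"

text \<open>The main term comes from the adjugate identity. The rest, \<open>E\<close>, is bilinear
  in the state and the errors, which gives its bound by a product.\<close>

lemma lyapunov_derivative:
  assumes x: "(x has_real_derivative a * (l * x t + \<nu> * y t + e1)) (at t within J)"
    and y: "(y has_real_derivative a * (\<eta> * x t + w * y t + e2)) (at t within J)"
    and D: "0 < l * w - \<nu> * \<eta>"
  shows "\<exists>E. ((\<lambda>t. lyapunov l \<nu> \<eta> w (x t) (y t)) has_real_derivative
             a * (2 * (l * w - \<nu> * \<eta>) * (l + w) * ((x t)\<^sup>2 + (y t)\<^sup>2) + E)) (at t within J) \<and>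
           \<bar>E\<bar> \<le> (2 * (l * w - \<nu> * \<eta>) + 4 * (\<bar>l\<bar> + \<bar>\<nu>\<bar> + \<bar>\<eta>\<bar> + \<bar>w\<bar>)\<^sup>2) * (\<bar>x t\<bar> + \<bar>y t\<bar>) * (\<bar>e1\<bar> + \<bar>e2\<bar>)"
proof (intro exI conjI)
  let ?D = "l * w - \<nu> * \<eta>" and ?k = "\<bar>l\<bar> + \<bar>\<nu>\<bar> + \<bar>\<eta>\<bar> + \<bar>w\<bar>"
  let ?s = "\<bar>x t\<bar> + \<bar>y t\<bar>" and ?e = "\<bar>e1\<bar> + \<bar>e2\<bar>"
  let ?E = "2 * ?D * (x t * e1 + y t * e2) + 2 * ((w * x t - \<nu> * y t) * (w * e1 - \<nu> * e2))
            + 2 * ((l * y t - \<eta> * x t) * (l * e2 - \<eta> * e1))"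
  show "((\<lambda>t. lyapunov l \<nu> \<eta> w (x t) (y t)) has_real_derivative
             a * (2 * ?D * (l + w) * ((x t)\<^sup>2 + (y t)\<^sup>2) + ?E)) (at t within J)"
    unfolding lyapunov_def
    by (rule derivative_eq_intros x y refl)+ (simp add: algebra_simps power2_eq_square)
  have prod: "\<bar>p * r\<bar> \<le> (?k * ?s) * (?k * ?e)" if "\<bar>p\<bar> \<le> ?k * ?s" "\<bar>r\<bar> \<le> ?k * ?e" for p r
    unfolding abs_mult by (intro mult_mono that) auto
  have "\<bar>x t * e1 + y t * e2\<bar> \<le> ?s * ?e"
    by (intro abs_lincomb_le) auto
  then have "\<bar>2 * ?D * (x t * e1 + y t * e2)\<bar> \<le> 2 * ?D * (?s * ?e)"
    using D by (simp add: abs_mult)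
  moreover have "\<bar>(w * x t - \<nu> * y t) * (w * e1 - \<nu> * e2)\<bar> \<le> (?k * ?s) * (?k * ?e)"
    using abs_lincomb_le[of w ?k "-\<nu>" "x t" "y t"] abs_lincomb_le[of w ?k "-\<nu>" e1 e2]
    by (intro prod) auto
  moreover have "\<bar>(l * y t - \<eta> * x t) * (l * e2 - \<eta> * e1)\<bar> \<le> (?k * ?s) * (?k * ?e)"
    using abs_lincomb_le[of "-\<eta>" ?k l "x t" "y t"] abs_lincomb_le[of "-\<eta>" ?k l e1 e2]
    by (intro prod) (auto simp: algebra_simps)
  moreover have "\<bar>p1 + 2 * p2 + 2 * p3\<bar> \<le> q1 + 2 * q2 + 2 * q3"
    if "\<bar>p1\<bar> \<le> q1" "\<bar>p2\<bar> \<le> q2" "\<bar>p3\<bar> \<le> q3" for p1 p2 p3 q1 q2 q3 :: real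
    using that by linarith
  ultimately have "\<bar>?E\<bar> \<le> 2 * ?D * (?s * ?e) + 2 * ((?k * ?s) * (?k * ?e)) + 2 * ((?k * ?s) * (?k * ?e))"
    by blast
  also have "2 * D * (s * e) + 2 * ((k * s) * (k * e)) + 2 * ((k * s) * (k * e)) = (2 * D + 4 * k\<^sup>2) * s * e"
    for D k s e :: real
    by (simp add: algebra_simps power2_eq_square)
  finally show "\<bar>?E\<bar> \<le> (2 * ?D + 4 * ?k\<^sup>2) * ?s * ?e" .
qed

lemma lyapunov_bounds:
  assumes D: "0 < l * w - \<nu> * \<eta>"
  shows "(l * w - \<nu> * \<eta>) * (x\<^sup>2 + y\<^sup>2) \<le> lyapunov l \<nu> \<eta> w x y"
    and "lyapunov l \<nu> \<eta> w x y \<le> ((l * w - \<nu> * \<eta>) + 4 * (\<bar>l\<bar> + \<bar>\<nu>\<bar> + \<bar>\<eta>\<bar> + \<bar>w\<bar>)\<^sup>2) * (x\<^sup>2 + y\<^sup>2)"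
proof -
  show "(l * w - \<nu> * \<eta>) * (x\<^sup>2 + y\<^sup>2) \<le> lyapunov l \<nu> \<eta> w x y"
    by (simp add: lyapunov_def)
  let ?k = "\<bar>l\<bar> + \<bar>\<nu>\<bar> + \<bar>\<eta>\<bar> + \<bar>w\<bar>"
  have sq: "p\<^sup>2 \<le> 2 * ?k\<^sup>2 * (x\<^sup>2 + y\<^sup>2)" if "\<bar>p\<bar> \<le> ?k * (\<bar>x\<bar> + \<bar>y\<bar>)" for p
  proof -
    have "\<bar>p\<bar>\<^sup>2 \<le> (?k * (\<bar>x\<bar> + \<bar>y\<bar>))\<^sup>2" by (intro power_mono that) auto
    also have "\<dots> \<le> ?k\<^sup>2 * (2 * (x\<^sup>2 + y\<^sup>2))"
      unfolding power_mult_distrib by (intro mult_left_mono sum_abs_squares) auto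
    finally show ?thesis by (simp only: power2_abs mult_ac)
  qed
  have "(w * x - \<nu> * y)\<^sup>2 \<le> 2 * ?k\<^sup>2 * (x\<^sup>2 + y\<^sup>2)"
    using abs_lincomb_le[of w ?k "-\<nu>" x y] by (intro sq) auto
  moreover have "(l * y - \<eta> * x)\<^sup>2 \<le> 2 * ?k\<^sup>2 * (x\<^sup>2 + y\<^sup>2)"
    using abs_lincomb_le[of "-\<eta>" ?k l x y] by (intro sq) (auto simp: algebra_simps)
  ultimately show "lyapunov l \<nu> \<eta> w x y \<le> ((l * w - \<nu> * \<eta>) + 4 * ?k\<^sup>2) * (x\<^sup>2 + y\<^sup>2)"
    unfolding lyapunov_def by (simp add: distrib_right)
qed

text \<open>The region \<open>V <= d^2\<close> is kept although it shrinks. On its boundary, in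
  units of \<open>A * (d t)\<^sup>2\<close>, the damping contributes at most -c, the errors at most
  c/4, and the decay of the radius at most c/2 to the derivative of \<open>V - d^2\<close>.\<close>

lemma trapping_equal_rates:
  assumes q: "n \<le> q" "0 < q" and D: "0 < l * w - \<nu> * \<eta>" and tr: "l + w < 0"
  shows "\<exists>M\<ge>1. \<exists>\<mu>>0. traps q n n l \<nu> \<eta> w M \<mu>"
proof -
  define D where "D = l * w - \<nu> * \<eta>"
  define k where "k = \<bar>l\<bar> + \<bar>\<nu>\<bar> + \<bar>\<eta>\<bar> + \<bar>w\<bar>"
  define K1 where "K1 = D + 4 * k\<^sup>2"
  define K2 where "K2 = 2 * D + 4 * k\<^sup>2"
  \<comment> \<open>\<open>B\<close> turns \<open>V <= d^2\<close> into a bound \<open>B * d\<close>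
    for the sum of the absolute values; \<open>c\<close> in the next line is the damping rate
    relative to \<open>V\<close>.\<close>
  define B where "B = sqrt (2 / D)"
  define c where "c = - 2 * D * (l + w) / K1"
  \<comment> \<open>Small enough for \<open>2 * \<mu> <= c / 2\<close>, which pays for the decay of
    the radius, and for an error of at most \<open>c / 4\<close>.\<close>
  define \<mu> where "\<mu> = c / (4 + 8 * (K2 * B * (B + 1)))"
  \<comment> \<open>\<open>1 + sqrt K1\<close> puts the initial point strictly inside the region,
    and \<open>B\<close> bounds the region by the radius.\<close>
  define M where "M = 1 + sqrt K1 + B"
  have D0: "0 < D" using D by (simp add: D_def)
  have K: "0 < K1" "0 < K2" "0 < B" using D0 by (simp_all add: K1_def K2_def B_def add_pos_nonneg)
  have c0: "0 < c" unfolding c_def using D0 tr K(1) by (intro divide_pos_pos) (auto simp: mult_pos_neg)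
  have KB: "0 < K2 * B * (B + 1)" using K by simp
  have pos: "0 < 4 + 8 * (K2 * B * (B + 1))" using KB by linarith
  have \<mu>0: "0 < \<mu>" unfolding \<mu>_def by (rule divide_pos_pos[OF c0 pos])
  have "\<mu> * (4 + 8 * (K2 * B * (B + 1))) = c"
    unfolding \<mu>_def by (rule nonzero_eq_divide_eq[THEN iffD1, OF _ refl]) (use pos in linarith)
  then have \<mu>c: "4 * \<mu> + 8 * (\<mu> * (K2 * B * (B + 1))) = c" by (simp add: algebra_simps)
  have P: "0 < \<mu> * (K2 * B * (B + 1))" "K2 * B * (\<mu> * B + \<mu>) = \<mu> * (K2 * B * (B + 1))"
    using mult_pos_pos[OF \<mu>0 KB] by (simp_all add: algebra_simps)
  have \<mu>1: "2 * \<mu> \<le> c / 2" using \<mu>c P(1) \<mu>0 by linarith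
  have \<mu>2: "2 * (K2 * B * (\<mu> * B + \<mu>)) \<le> c / 4" unfolding P(2) using \<mu>c \<mu>0 by linarith
  have M1: "1 \<le> M" using K by (simp add: M_def)
  show ?thesis
  proof (rule exI[of _ M], rule conjI[OF M1], rule exI[of _ \<mu>], rule conjI[OF \<mu>0], intro allI impI ballI)
    fix C a b t and x y d d' :: "real \<Rightarrow> real"
    assume "0 \<le> C" and a: "1 \<le> a" and al: "almost_linear q n n l \<nu> \<eta> w \<mu> C {a..b} x y"
      and d: "slow_radius q \<mu> C {a..b} d d'"
      and init: "\<bar>x a\<bar> + \<bar>y a\<bar> \<le> d a / M" and t: "t \<in> {a..b}"
    define V where "V = (\<lambda>t. lyapunov l \<nu> \<eta> w (x t) (y t))"
    have V_le: "V t \<le> K1 * ((x t)\<^sup>2 + (y t)\<^sup>2)" and V_ge: "D * ((x t)\<^sup>2 + (y t)\<^sup>2) \<le> V t" for t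
      using lyapunov_bounds[OF D, of "x t" "y t"] by (simp_all add: V_def D_def K1_def k_def)
    have s_le: "\<bar>x t\<bar> + \<bar>y t\<bar> \<le> B * d t" if "V t \<le> (d t)\<^sup>2" "0 < d t" for t
    proof (rule power2_le_imp_le)
      have "(\<bar>x t\<bar> + \<bar>y t\<bar>)\<^sup>2 \<le> 2 * ((x t)\<^sup>2 + (y t)\<^sup>2)" by (rule sum_abs_squares)
      also have "\<dots> \<le> 2 * ((d t)\<^sup>2 / D)"
        using V_ge[of t] that D0 by (simp add: field_simps)
      also have "\<dots> = (B * d t)\<^sup>2" using D0 by (simp add: B_def power_mult_distrib)
      finally show "(\<bar>x t\<bar> + \<bar>y t\<bar>)\<^sup>2 \<le> (B * d t)\<^sup>2" .
      show "0 \<le> B * d t" using K that by simp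
    qed
    have "\<exists>V'. (V has_real_derivative V') (at t within {a..b}) \<and>
        (V t = (d t)\<^sup>2 \<longrightarrow> V' - 2 * d t * d' t < 0)" if t: "t \<in> {a..b}" for t
    proof -
      define A where "A = t powr (- real n / real q)"
      define s where "s = \<bar>x t\<bar> + \<bar>y t\<bar>"
      have t1: "1 \<le> t" using a t by auto
      have A: "1 / t \<le> A" "0 < A"
        unfolding A_def using inverse_le_powr[OF t1 q] t1 by auto
      obtain e1 e2 where xd: "(x has_real_derivative A * (l * x t + \<nu> * y t + e1)) (at t within {a..b})"
        and yd: "(y has_real_derivative A * (\<eta> * x t + w * y t + e2)) (at t within {a..b})"
        and e: "\<bar>e1\<bar> \<le> \<mu> * s + C * t powr (- 1 / real q)" "\<bar>e2\<bar> \<le> \<mu> * s + C * t powr (- 1 / real q)"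
        using al t unfolding almost_linear_def A_def s_def by blast
      from lyapunov_derivative[OF xd yd D] obtain E where
        V': "(V has_real_derivative A * (2 * D * (l + w) * ((x t)\<^sup>2 + (y t)\<^sup>2) + E)) (at t within {a..b})"
        and E: "\<bar>E\<bar> \<le> K2 * s * (\<bar>e1\<bar> + \<bar>e2\<bar>)"
        unfolding V_def D_def K2_def k_def s_def by blast
      have dt: "0 < d t" "- \<mu> * d t / t \<le> d' t" "C * t powr (- 1 / real q) \<le> \<mu> * d t"
        using d t by auto
      have "A * (2 * D * (l + w) * ((x t)\<^sup>2 + (y t)\<^sup>2) + E) - 2 * d t * d' t < 0" if V: "V t = (d t)\<^sup>2"
      proof -
        have s: "0 \<le> s" "s \<le> B * d t" using s_le[of t] V dt by (auto simp: s_def)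
        have "\<mu> * s \<le> \<mu> * (B * d t)" using s(2) \<mu>0 by (intro mult_left_mono) auto
        then have "\<bar>e1\<bar> + \<bar>e2\<bar> \<le> 2 * (\<mu> * (B * d t) + \<mu> * d t)"
          using abs_add_le_twice[OF e] dt(3) by blast
        then have e12: "\<bar>e1\<bar> + \<bar>e2\<bar> \<le> 2 * ((\<mu> * B + \<mu>) * d t)"
          by (simp add: algebra_simps)
        have "E \<le> K2 * s * (\<bar>e1\<bar> + \<bar>e2\<bar>)" using E by linarith
        also have "\<dots> \<le> K2 * (B * d t) * (2 * ((\<mu> * B + \<mu>) * d t))"
          using K s(1) dt(1) by (intro mult_mono mult_left_mono s(2) e12) auto
        also have "\<dots> = 2 * (K2 * B * (\<mu> * B + \<mu>)) * (d t)\<^sup>2" by (simp add: power2_eq_square)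
        also have "\<dots> \<le> c / 4 * (d t)\<^sup>2" by (intro mult_right_mono \<mu>2) auto
        finally have E': "E \<le> c / 4 * (d t)\<^sup>2" .
        have "(d t)\<^sup>2 / K1 \<le> (x t)\<^sup>2 + (y t)\<^sup>2"
          using V_le[of t] V K(1) by (simp add: field_simps)
        then have "2 * D * (- (l + w)) * ((d t)\<^sup>2 / K1) \<le> 2 * D * (- (l + w)) * ((x t)\<^sup>2 + (y t)\<^sup>2)"
          using D0 tr by (intro mult_left_mono) auto
        moreover have "2 * D * S * X \<le> - (- 2 * D * S / K1) * Y"
          if "2 * D * (- S) * (Y / K1) \<le> 2 * D * (- S) * X" for S X Y
          using that by simp
        ultimately have "2 * D * (l + w) * ((x t)\<^sup>2 + (y t)\<^sup>2) \<le> - c * (d t)\<^sup>2"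
          unfolding c_def by blast
        with E' have "2 * D * (l + w) * ((x t)\<^sup>2 + (y t)\<^sup>2) + E \<le> - (3 / 4) * (c * (d t)\<^sup>2)" by simp
        then have 1: "A * (2 * D * (l + w) * ((x t)\<^sup>2 + (y t)\<^sup>2) + E) \<le> A * (- (3 / 4) * (c * (d t)\<^sup>2))"
          using A by (intro mult_left_mono) auto
        have "2 * d t * (- \<mu> * d t / t) \<le> 2 * d t * d' t"
          using dt(1) by (intro mult_left_mono dt(2)) auto
        then have "- (2 * d t * d' t) \<le> - (2 * d t * (- \<mu> * d t / t))"
          by (rule le_imp_neg_le)
        also have "\<dots> = 2 * \<mu> * (d t)\<^sup>2 * (1 / t)" by (simp add: power2_eq_square)
        also have "\<dots> \<le> 2 * \<mu> * (d t)\<^sup>2 * A"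
          using \<mu>0 A by (intro mult_left_mono) auto
        also have "\<dots> \<le> c / 2 * (d t)\<^sup>2 * A"
          using A(2) by (intro mult_right_mono \<mu>1) auto
        finally have 2: "- (2 * d t * d' t) \<le> c / 2 * (d t)\<^sup>2 * A" .
        have "u - v < 0" if "u \<le> A * (- (3 / 4) * (c * (d t)\<^sup>2))" "- v \<le> c / 2 * (d t)\<^sup>2 * A" for u v
        proof -
          have "0 < c * (d t)\<^sup>2 * A" using c0 A dt by simp
          moreover have "u \<le> - (3 / 4) * (c * (d t)\<^sup>2 * A)" "- v \<le> 1 / 2 * (c * (d t)\<^sup>2 * A)"
            using that by (simp_all add: mult_ac)
          ultimately show ?thesis by linarith
        qed
        then show ?thesis using 1 2 by blast
      qed
      with V' show ?thesis by blast
    qed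
    then obtain V' where V': "\<And>t. t \<in> {a..b} \<Longrightarrow> (V has_real_derivative V' t) (at t within {a..b})"
      "\<And>t. t \<in> {a..b} \<Longrightarrow> V t = (d t)\<^sup>2 \<Longrightarrow> V' t - 2 * d t * d' t < 0" by metis
    have p: "((\<lambda>t. V t - (d t)\<^sup>2) has_real_derivative V' t - 2 * d t * d' t) (at t within {a..b})"
      if "t \<in> {a..b}" for t
      using d that by (auto intro!: derivative_eq_intros V')
    have da: "0 < d a" using d t by auto
    have "V a \<le> K1 * (\<bar>x a\<bar> + \<bar>y a\<bar>)\<^sup>2"
      using V_le[of a] sum_abs_squares(1)[of "x a" "y a"] K(1) by (meson mult_left_mono less_imp_le order_trans)
    also have "\<dots> \<le> K1 * (d a / M)\<^sup>2"
      using K(1) init by (intro mult_left_mono power_mono) auto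
    also have "\<dots> < (d a)\<^sup>2"
    proof -
      have "(sqrt K1)\<^sup>2 < M\<^sup>2" using K by (intro power_strict_mono) (auto simp: M_def)
      then have "K1 < M\<^sup>2" using K by simp
      then show ?thesis using da M1 by (simp add: power_divide field_simps)
    qed
    finally have "V a - (d a)\<^sup>2 < 0" by simp
    then have "V t - (d t)\<^sup>2 < 0"
      using two_barriers[OF p p, of t] V' t by auto
    then have "\<bar>x t\<bar> + \<bar>y t\<bar> \<le> B * d t" using s_le[of t] d t by auto
    also have "\<dots> \<le> M * d t"
    proof (rule mult_right_mono)
      show "B \<le> M" using K by (simp add: M_def)
      show "0 \<le> d t" using bspec[OF d t] by (elim conjE) (rule less_imp_le)
    qed
    finally show "\<bar>x t\<bar> + \<bar>y t\<bar> \<le> M * d t" .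
  qed
qed

text \<open>
  For \<open>n < m\<close> the variable \<open>z = l x + \<nu> y\<close> decouples to leading order: it evolves on the faster time scale,
  while \<open>y\<close> evolves with the effective rate \<open>(l w - \<nu> \<eta>) / l\<close>.
\<close>

lemma distinct_rates_change:
  assumes al: "almost_linear q n m l \<nu> \<eta> w \<mu> C J x y" and t: "t \<in> J" "1 \<le> t"
    and nm: "n < m" "0 < q" and l: "l \<noteq> 0" and C: "0 \<le> C" and \<mu>: "0 < \<mu>"
  defines "z \<equiv> \<lambda>t. l * x t + \<nu> * y t"
    and "K \<equiv> (1 + \<bar>l\<bar> + \<bar>\<nu>\<bar>) * (1 + \<bar>\<eta>\<bar> + \<bar>w\<bar>)"
    and "\<tau> \<equiv> t powr (- 1 / real q)"
    and "s \<equiv> \<bar>x t\<bar> + \<bar>y t\<bar>"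
  shows "\<exists>E e. (z has_real_derivative t powr (- real n / real q) * (l * z t + E)) (at t within J) \<and>
      (y has_real_derivative t powr (- real m / real q) * (\<eta> / l * z t + (l * w - \<nu> * \<eta>) / l * y t + e)) (at t within J) \<and>
      \<bar>E\<bar> \<le> K * (\<mu> * s + C * \<tau> + \<tau> * s) \<and> \<bar>e\<bar> \<le> \<mu> * s + C * \<tau>"
proof -
  define a where "a = t powr (- real n / real q)"
  define b where "b = t powr (- real m / real q)"
  have ab: "0 < a" "0 < b" "b \<le> a * \<tau>"
    using powr_gap[OF t(2) nm] t(2) by (auto simp: a_def b_def \<tau>_def)
  have \<tau>: "0 < \<tau>" "\<tau> \<le> 1"
    using powr_mono[of "- 1 / real q" 0 t] t(2) by (auto simp: \<tau>_def)
  have s: "0 \<le> s" by (simp add: s_def)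
  obtain e1 e2 where xd: "(x has_real_derivative a * (l * x t + \<nu> * y t + e1)) (at t within J)"
    and yd: "(y has_real_derivative b * (\<eta> * x t + w * y t + e2)) (at t within J)"
    and e: "\<bar>e1\<bar> \<le> \<mu> * s + C * \<tau>" "\<bar>e2\<bar> \<le> \<mu> * s + C * \<tau>"
    using al t unfolding almost_linear_def a_def b_def s_def \<tau>_def by blast
  \<comment> \<open>The slow variable enters the derivative of \<open>z\<close> with its own rate
    \<open>b\<close>. After division by the rate \<open>a\<close> of \<open>z\<close> this term has
    the factor \<open>b / a <= \<tau>\<close> and counts as an error.\<close>
  define E where "E = l * e1 + \<nu> * (b / a) * (\<eta> * x t + w * y t + e2)"
  have "(z has_real_derivative l * (a * (l * x t + \<nu> * y t + e1)) + \<nu> * (b * (\<eta> * x t + w * y t + e2))) (at t within J)"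
    unfolding z_def by (auto intro!: derivative_eq_intros xd yd)
  also have "l * (a * (l * x t + \<nu> * y t + e1)) + \<nu> * (b * (\<eta> * x t + w * y t + e2)) = a * (l * z t + E)"
    using ab(1) by (simp add: E_def z_def field_simps)
  finally have zd: "(z has_real_derivative a * (l * z t + E)) (at t within J)" .
  \<comment> \<open>Eliminating \<open>x\<close> in favour of \<open>z\<close> leaves the Schur
    complement of \<open>l\<close> as the coefficient of \<open>y\<close>.\<close>
  have "\<eta> * x t + w * y t = \<eta> / l * z t + (l * w - \<nu> * \<eta>) / l * y t"
    using l by (simp add: z_def field_simps)
  with yd have yd': "(y has_real_derivative b * (\<eta> / l * z t + (l * w - \<nu> * \<eta>) / l * y t + e2)) (at t within J)"
    by simp
  have "\<bar>E\<bar> \<le> K * (\<mu> * s + C * \<tau> + \<tau> * s)"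
  proof -
    have r: "0 < b / a" "b / a \<le> \<tau>" using ab by (auto simp: field_simps)
    have "\<bar>\<eta> * x t + w * y t\<bar> \<le> (\<bar>\<eta>\<bar> + \<bar>w\<bar>) * s"
      unfolding s_def by (intro abs_lincomb_le) auto
    then have 1: "\<bar>\<eta> * x t + w * y t + e2\<bar> \<le> (\<bar>\<eta>\<bar> + \<bar>w\<bar>) * s + (\<mu> * s + C * \<tau>)" using e by linarith
    have "\<bar>\<nu> * (b / a) * (\<eta> * x t + w * y t + e2)\<bar> = \<bar>\<nu>\<bar> * ((b / a) * \<bar>\<eta> * x t + w * y t + e2\<bar>)"
      using ab by (simp add: abs_mult)
    also have "\<dots> \<le> \<bar>\<nu>\<bar> * (\<tau> * ((\<bar>\<eta>\<bar> + \<bar>w\<bar>) * s + (\<mu> * s + C * \<tau>)))"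
      using r 1 \<tau> by (intro mult_left_mono mult_mono) auto
    also have "\<dots> = \<bar>\<nu>\<bar> * ((\<bar>\<eta>\<bar> + \<bar>w\<bar>) * (\<tau> * s)) + \<bar>\<nu>\<bar> * (\<tau> * (\<mu> * s + C * \<tau>))"
      by (simp add: algebra_simps)
    also have "\<dots> \<le> \<bar>\<nu>\<bar> * ((\<bar>\<eta>\<bar> + \<bar>w\<bar>) * (\<tau> * s)) + \<bar>\<nu>\<bar> * (1 * (\<mu> * s + C * \<tau>))"
      using \<tau> s \<mu> C by (intro add_left_mono mult_left_mono mult_right_mono) auto
    finally have 2: "\<bar>\<nu> * (b / a) * (\<eta> * x t + w * y t + e2)\<bar> \<le>
      \<bar>\<nu>\<bar> * (\<bar>\<eta>\<bar> + \<bar>w\<bar>) * (\<tau> * s) + \<bar>\<nu>\<bar> * (\<mu> * s + C * \<tau>)" by simp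
    have 3: "\<bar>l * e1\<bar> \<le> \<bar>l\<bar> * (\<mu> * s + C * \<tau>)"
      unfolding abs_mult by (intro mult_left_mono e) auto
    have "\<bar>E\<bar> \<le> (\<bar>l\<bar> + \<bar>\<nu>\<bar>) * (\<mu> * s + C * \<tau>) + \<bar>\<nu>\<bar> * (\<bar>\<eta>\<bar> + \<bar>w\<bar>) * (\<tau> * s)"
    proof -
      have "\<bar>E\<bar> \<le> \<bar>l * e1\<bar> + \<bar>\<nu> * (b / a) * (\<eta> * x t + w * y t + e2)\<bar>"
        unfolding E_def by (rule abs_triangle_ineq)
      also have "\<dots> \<le> \<bar>l\<bar> * (\<mu> * s + C * \<tau>) +
          (\<bar>\<nu>\<bar> * (\<bar>\<eta>\<bar> + \<bar>w\<bar>) * (\<tau> * s) + \<bar>\<nu>\<bar> * (\<mu> * s + C * \<tau>))"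
        by (intro add_mono 2 3)
      finally show ?thesis by (simp only: distrib_right ac_simps)
    qed
    also have "\<dots> \<le> K * (\<mu> * s + C * \<tau>) + K * (\<tau> * s)"
    proof (intro add_mono mult_right_mono)
      have "(\<bar>l\<bar> + \<bar>\<nu>\<bar>) * 1 \<le> K" "\<bar>\<nu>\<bar> * (\<bar>\<eta>\<bar> + \<bar>w\<bar>) \<le> K"
        unfolding K_def by (intro mult_mono; simp)+
      then show "\<bar>l\<bar> + \<bar>\<nu>\<bar> \<le> K" "\<bar>\<nu>\<bar> * (\<bar>\<eta>\<bar> + \<bar>w\<bar>) \<le> K" by auto
    qed (use \<tau> s \<mu> C in auto)
    finally show ?thesis by (simp add: algebra_simps)
  qed
  with zd yd' e(2) show ?thesis unfolding a_def b_def by blast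
qed

text \<open>Bounds for the inverse of the linear change of variables and for the change
  itself.\<close>

lemma distinct_rates_norm:
  fixes l \<nu> x y :: real
  assumes "l \<noteq> 0"
  shows "\<bar>x\<bar> + \<bar>y\<bar> \<le> (1 + (1 + \<bar>\<nu>\<bar>) / \<bar>l\<bar>) * (\<bar>l * x + \<nu> * y\<bar> + \<bar>y\<bar>)"
    and "\<bar>l * x + \<nu> * y\<bar> \<le> (\<bar>l\<bar> + \<bar>\<nu>\<bar>) * (\<bar>x\<bar> + \<bar>y\<bar>)"
proof -
  define z where "z = l * x + \<nu> * y"
  have "x = (z - \<nu> * y) / l" using assms by (simp add: z_def)
  then have "\<bar>x\<bar> = \<bar>z - \<nu> * y\<bar> / \<bar>l\<bar>" by (metis abs_divide)
  also have "\<dots> \<le> (\<bar>z\<bar> + \<bar>\<nu>\<bar> * \<bar>y\<bar>) / \<bar>l\<bar>"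
    by (intro divide_right_mono) (auto simp flip: abs_mult)
  also have "\<dots> \<le> (1 + \<bar>\<nu>\<bar>) * (\<bar>z\<bar> + \<bar>y\<bar>) / \<bar>l\<bar>"
    by (intro divide_right_mono) (auto simp: algebra_simps)
  finally have "\<bar>x\<bar> \<le> (1 + \<bar>\<nu>\<bar>) / \<bar>l\<bar> * (\<bar>z\<bar> + \<bar>y\<bar>)" by simp
  moreover have "u + v \<le> (1 + k) * (r + v)" if "u \<le> k * (r + v)" "0 \<le> r" for u v r k :: real
    using that by (simp add: distrib_right)
  ultimately show "\<bar>x\<bar> + \<bar>y\<bar> \<le> (1 + (1 + \<bar>\<nu>\<bar>) / \<bar>l\<bar>) * (\<bar>l * x + \<nu> * y\<bar> + \<bar>y\<bar>)"
    unfolding z_def by (meson abs_ge_zero)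
  show "\<bar>l * x + \<nu> * y\<bar> \<le> (\<bar>l\<bar> + \<bar>\<nu>\<bar>) * (\<bar>x\<bar> + \<bar>y\<bar>)"
    by (intro abs_lincomb_le) auto
qed

text \<open>One pair of opposite sides of the rectangle; squares treat both signs of
  \<open>z\<close> together. For half of the derivative, in units of
  \<open>a * (\<theta> * d)\<^sup>2\<close>, the damping takes away c, the disturbance gives back at
  most c/2 and the decay of the radius at most c/4.\<close>

lemma inward_component:
  fixes z a c d d' t E \<theta> \<mu> F :: real
  assumes z: "z\<^sup>2 = (\<theta> * d)\<^sup>2" and a: "1 / t \<le> a" "0 < a" and F: "F = - c * z + E"
    and E: "\<bar>E\<bar> \<le> c / 2 * (\<theta> * d)" and d: "0 < d" "- \<mu> * d / t \<le> d'" and \<theta>: "0 < \<theta>"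
    and c: "0 < c" and \<mu>: "0 < \<mu>" "\<mu> \<le> c / 4"
  shows "2 * z * (a * F) - 2 * (\<theta> * d) * (\<theta> * d') < 0"
proof -
  define p where "p = \<theta> * d"
  have p: "0 < p" using d \<theta> by (simp add: p_def)
  have "\<bar>z\<bar> = p" using z p abs_le_square_iff[of z p] abs_le_square_iff[of p z] by (simp add: p_def)
  have "z * E \<le> \<bar>z\<bar> * \<bar>E\<bar>" by (metis abs_ge_self abs_mult)
  also have "\<dots> \<le> p * (c / 2 * p)"
    unfolding \<open>\<bar>z\<bar> = p\<close> using E p by (intro mult_left_mono) (auto simp: p_def)
  finally have "z * F \<le> - c * p\<^sup>2 + c / 2 * p\<^sup>2"
    using z by (simp add: F p_def power2_eq_square algebra_simps)
  then have 1: "a * (2 * (z * F)) \<le> a * (- c * p\<^sup>2)" using a by (intro mult_left_mono) auto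
  have "p * (\<theta> * (- \<mu> * d / t)) \<le> p * (\<theta> * d')"
    using p \<theta> d by (intro mult_left_mono) auto
  moreover have "p * (\<theta> * (- \<mu> * d / t)) = - \<mu> * p\<^sup>2 * (1 / t)"
    by (simp add: p_def power2_eq_square)
  moreover have "\<mu> * p\<^sup>2 * (1 / t) \<le> \<mu> * p\<^sup>2 * a" using \<mu> a by (intro mult_left_mono) auto
  moreover have "\<mu> * p\<^sup>2 * a \<le> c / 4 * p\<^sup>2 * a" using \<mu> a by (intro mult_right_mono) auto
  ultimately have 2: "- (p * (\<theta> * d')) \<le> c / 4 * p\<^sup>2 * a" by linarith
  have "0 < c * p\<^sup>2 * a" using c a p by simp
  then show ?thesis using 1 2 unfolding p_def[symmetric] by (simp add: algebra_simps)
qed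

text \<open>The two couplings are controlled differently. In the fast equation \<open>y\<close>
  enters only through an error with the factor \<open>\<tau> <= \<mu>\<close>. In the slow equation
  \<open>z\<close> has the fixed coefficient \<open>\<eta> / l\<close>, so the rectangle is made
  narrow: |z| <= \<theta> d against |y| <= d. The remaining slow coefficient, determinant over
  \<open>l\<close>, is negative.\<close>

lemma trapping_distinct_rates:
  assumes q: "n < m" "m \<le> q" "0 < q" and D: "0 < l * w - \<nu> * \<eta>" and l: "l < 0"
  shows "\<exists>M\<ge>1. \<exists>\<mu>>0. traps q n m l \<nu> \<eta> w M \<mu>"
proof -
  define D where "D = l * w - \<nu> * \<eta>"
  define K where "K = (1 + \<bar>l\<bar> + \<bar>\<nu>\<bar>) * (1 + \<bar>\<eta>\<bar> + \<bar>w\<bar>)"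
  define K3 where "K3 = 1 + (1 + \<bar>\<nu>\<bar>) / \<bar>l\<bar>"
  define c1 where "c1 = - l"
  define c2 where "c2 = - (D / l)"
  \<comment> \<open>Makes the coupling at most \<open>c2 / 4\<close>; together with an error of at
    most \<open>c2 / 4\<close> it uses up the half of the damping that
    \<open>inward_component\<close> allows.\<close>
  define \<theta> where "\<theta> = min 1 (c2 / 4 / (\<bar>\<eta> / l\<bar> + 1))"
  \<comment> \<open>One bound each for the fast error, the slow error, and the decay of the radius
    on the two pairs of sides.\<close>
  define \<mu> where "\<mu> = Min {c1 * \<theta> / 4 / (K * (1 + 4 * K3)), c2 / 4 / (2 * K3 + 1), c1 / 4, c2 / 4}"
  \<comment> \<open>The middle term puts the initial point strictly inside
    \<open>\<bar>z\<bar> < \<theta> * d\<close>; the last one bounds the rectangle in the original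
    variables.\<close>
  define M where "M = 1 + (\<bar>l\<bar> + \<bar>\<nu>\<bar>) / \<theta> + 2 * K3"
  have c: "0 < c1" "0 < c2" using D l by (auto simp: c1_def c2_def D_def divide_less_0_iff)
  define h where "h = \<bar>\<eta> / l\<bar>"
  have h: "0 \<le> h" "0 < h + 1" by (simp_all add: h_def add_nonneg_pos)
  have \<theta>_le: "\<theta> \<le> c2 / 4 / (h + 1)" unfolding \<theta>_def h_def by (rule min.cobounded2)
  have \<theta>: "0 < \<theta>" "\<theta> \<le> 1" unfolding \<theta>_def h_def[symmetric] using c h by auto
  have "h * \<theta> \<le> (h + 1) * \<theta>" using \<theta> by simp
  also have "\<dots> \<le> c2 / 4" using \<theta>_le unfolding pos_le_divide_eq[OF h(2)] by (simp only: mult.commute)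
  finally have \<theta>c: "\<bar>\<eta> / l\<bar> * \<theta> \<le> c2 / 4" by (simp add: h_def)
  have "1 * 1 \<le> K" unfolding K_def by (intro mult_mono) auto
  then have K: "1 \<le> K" "1 \<le> K3" by (auto simp: K3_def)
  have \<mu>0: "0 < \<mu>" using c \<theta> K by (simp add: \<mu>_def)
  have "\<mu> \<le> c1 * \<theta> / 4 / (K * (1 + 4 * K3))" "\<mu> \<le> c2 / 4 / (2 * K3 + 1)"
    unfolding \<mu>_def by (intro Min_le; simp)+
  moreover have "0 < K * (1 + 4 * K3)" "0 < 2 * K3 + 1" using K by auto
  ultimately have "\<mu> * (K * (1 + 4 * K3)) \<le> c1 * \<theta> / 4" "\<mu> * (2 * K3 + 1) \<le> c2 / 4"
    by (simp_all only: pos_le_divide_eq)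
  then have \<mu>: "K * ((1 + 4 * K3) * \<mu>) \<le> c1 * \<theta> / 4" "(2 * K3 + 1) * \<mu> \<le> c2 / 4"
    by (simp_all only: ac_simps)
  have \<mu>c: "\<mu> \<le> c1 / 4" "\<mu> \<le> c2 / 4"
    unfolding \<mu>_def by (intro Min_le; simp)+
  have M1: "1 \<le> M" using K \<theta> by (simp add: M_def add_nonneg_nonneg)
  show ?thesis
  proof (rule exI[of _ M], rule conjI[OF M1], rule exI[of _ \<mu>], rule conjI[OF \<mu>0], intro allI impI ballI)
    fix C a b t and x y d d' :: "real \<Rightarrow> real"
    assume C: "0 \<le> C" and a: "1 \<le> a" and al: "almost_linear q n m l \<nu> \<eta> w \<mu> C {a..b} x y"
      and d: "slow_radius q \<mu> C {a..b} d d'"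
      and init: "\<bar>x a\<bar> + \<bar>y a\<bar> \<le> d a / M" and t: "t \<in> {a..b}"
    define z where "z = (\<lambda>t. l * x t + \<nu> * y t)"
    have s_le: "\<bar>x t\<bar> + \<bar>y t\<bar> \<le> 2 * K3 * d t"
      if "(z t)\<^sup>2 \<le> (\<theta> * d t)\<^sup>2" "(y t)\<^sup>2 \<le> (1 * d t)\<^sup>2" "0 < d t" for t
    proof -
      have "\<bar>z t\<bar> \<le> \<theta> * d t" "\<bar>y t\<bar> \<le> d t"
        using that \<theta> by (metis abs_of_pos abs_le_square_iff mult_pos_pos, metis abs_of_pos abs_le_square_iff mult_1)
      moreover have "\<theta> * d t \<le> 1 * d t" using \<theta> that by (intro mult_right_mono) auto
      ultimately have "\<bar>z t\<bar> + \<bar>y t\<bar> \<le> 2 * d t" by simp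
      then have "K3 * (\<bar>z t\<bar> + \<bar>y t\<bar>) \<le> K3 * (2 * d t)" using K by (intro mult_left_mono) auto
      moreover have "\<bar>x t\<bar> + \<bar>y t\<bar> \<le> K3 * (\<bar>z t\<bar> + \<bar>y t\<bar>)"
        unfolding z_def K3_def by (rule distinct_rates_norm(1)) (use l in simp)
      ultimately show ?thesis by simp
    qed
    \<comment> \<open>States what is known at one instant, with the two derivatives as arguments, so
      that they can afterwards be chosen as functions of \<open>t\<close>.\<close>
    define P where "P = (\<lambda>t z' y'. (z has_real_derivative z') (at t within {a..b}) \<and>
        (y has_real_derivative y') (at t within {a..b}) \<and>
        ((z t)\<^sup>2 = (\<theta> * d t)\<^sup>2 \<longrightarrow> (y t)\<^sup>2 \<le> (1 * d t)\<^sup>2 \<longrightarrow> 2 * z t * z' - 2 * (\<theta> * d t) * (\<theta> * d' t) < 0) \<and>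
        ((y t)\<^sup>2 = (1 * d t)\<^sup>2 \<longrightarrow> (z t)\<^sup>2 \<le> (\<theta> * d t)\<^sup>2 \<longrightarrow> 2 * y t * y' - 2 * (1 * d t) * (1 * d' t) < 0))"
    have "\<exists>z' y'. P t z' y'"
      if t: "t \<in> {a..b}" for t
    proof -
      define A where "A = t powr (- real n / real q)"
      define B where "B = t powr (- real m / real q)"
      define \<tau> where "\<tau> = t powr (- 1 / real q)"
      define s where "s = \<bar>x t\<bar> + \<bar>y t\<bar>"
      have t1: "1 \<le> t" using a t by auto
      have A: "1 / t \<le> A" "0 < A" and B: "1 / t \<le> B" "0 < B"
        unfolding A_def B_def using inverse_le_powr[OF t1, of _ q] q t1 by auto
      have dt: "0 < d t" "- \<mu> * d t / t \<le> d' t" "\<tau> \<le> \<mu>" "C * \<tau> \<le> \<mu> * d t"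
        using d t by (auto simp: \<tau>_def)
      obtain E e where zd: "(z has_real_derivative A * (l * z t + E)) (at t within {a..b})"
        and yd: "(y has_real_derivative B * (\<eta> / l * z t + D / l * y t + e)) (at t within {a..b})"
        and E: "\<bar>E\<bar> \<le> K * (\<mu> * s + C * \<tau> + \<tau> * s)" and e: "\<bar>e\<bar> \<le> \<mu> * s + C * \<tau>"
        using distinct_rates_change[OF al t t1 q(1,3) _ C \<mu>0] l
        unfolding A_def B_def z_def s_def \<tau>_def K_def D_def by auto
      have *: "\<bar>E\<bar> \<le> c1 / 2 * (\<theta> * d t)" "\<bar>e\<bar> \<le> c2 / 4 * d t" if "(z t)\<^sup>2 \<le> (\<theta> * d t)\<^sup>2" "(y t)\<^sup>2 \<le> (1 * d t)\<^sup>2"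
      proof -
        have s: "s \<le> 2 * K3 * d t" unfolding s_def by (rule s_le[OF that dt(1)])
        have s0: "0 \<le> s" by (simp add: s_def)
        have ms: "\<mu> * s \<le> \<mu> * (2 * K3 * d t)" "\<tau> * s \<le> \<mu> * (2 * K3 * d t)"
          using mult_left_mono[OF s, of \<mu>] mult_mono[OF dt(3) s] \<mu>0 s0 by auto
        then have "\<mu> * s + C * \<tau> + \<tau> * s \<le> (1 + 4 * K3) * \<mu> * d t"
          using dt(4) by (simp add: algebra_simps)
        then have "K * (\<mu> * s + C * \<tau> + \<tau> * s) \<le> K * ((1 + 4 * K3) * \<mu>) * d t"
          using K by (simp add: mult.assoc mult_left_mono)
        also have "\<dots> \<le> c1 * \<theta> / 4 * d t" using dt by (intro mult_right_mono \<mu>) auto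
        also have "\<dots> \<le> c1 / 2 * (\<theta> * d t)" using dt c \<theta> by (simp add: field_simps)
        finally show "\<bar>E\<bar> \<le> c1 / 2 * (\<theta> * d t)" using E by simp
        have "\<mu> * s + C * \<tau> \<le> (2 * K3 + 1) * \<mu> * d t" using ms dt(4) by (simp add: algebra_simps)
        also have "\<dots> \<le> c2 / 4 * d t" using dt by (intro mult_right_mono \<mu>) auto
        finally show "\<bar>e\<bar> \<le> c2 / 4 * d t" using e by simp
      qed
      show ?thesis unfolding P_def
      proof (intro exI conjI impI)
        show "(z has_real_derivative A * (l * z t + E)) (at t within {a..b})" by (rule zd)
        show "(y has_real_derivative B * (\<eta> / l * z t + D / l * y t + e)) (at t within {a..b})" by (rule yd)
        assume h: "(z t)\<^sup>2 = (\<theta> * d t)\<^sup>2" "(y t)\<^sup>2 \<le> (1 * d t)\<^sup>2"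
        show "2 * z t * (A * (l * z t + E)) - 2 * (\<theta> * d t) * (\<theta> * d' t) < 0"
          by (rule inward_component[OF h(1) A _ _ dt(1,2) \<theta>(1) c(1) \<mu>0 \<mu>c(1)])
            (use * h in \<open>auto simp: c1_def\<close>)
      next
        assume h: "(y t)\<^sup>2 = (1 * d t)\<^sup>2" "(z t)\<^sup>2 \<le> (\<theta> * d t)\<^sup>2"
        have "\<bar>\<eta> / l * z t\<bar> \<le> \<bar>\<eta> / l\<bar> * (\<theta> * d t)"
          unfolding abs_mult
          using h(2) \<theta> dt(1) by (intro mult_left_mono) (metis abs_of_pos abs_le_square_iff mult_pos_pos, simp)
        also have "\<dots> \<le> c2 / 4 * d t"
          using mult_right_mono[OF \<theta>c, of "d t"] dt by (simp add: mult_ac)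
        finally have "\<bar>\<eta> / l * z t + e\<bar> \<le> c2 / 2 * (1 * d t)"
          using *(2)[OF h(2) eq_refl[OF h(1)]] abs_triangle_ineq[of "\<eta> / l * z t" e] by linarith
        then show "2 * y t * (B * (\<eta> / l * z t + D / l * y t + e)) - 2 * (1 * d t) * (1 * d' t) < 0"
          by (intro inward_component[OF h(1) B _ _ dt(1,2) _ c(2) \<mu>0 \<mu>c(2)]) (auto simp: c2_def)
      qed
    qed
    then obtain z' y' where zy: "\<And>t. t \<in> {a..b} \<Longrightarrow> P t (z' t) (y' t)" by metis
    have z': "(z has_real_derivative z' t) (at t within {a..b})"
      and y': "(y has_real_derivative y' t) (at t within {a..b})"
      and in1: "(z t)\<^sup>2 = (\<theta> * d t)\<^sup>2 \<Longrightarrow> (y t)\<^sup>2 \<le> (1 * d t)\<^sup>2 \<Longrightarrow>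
        2 * z t * z' t - 2 * (\<theta> * d t) * (\<theta> * d' t) < 0"
      and in2: "(y t)\<^sup>2 = (1 * d t)\<^sup>2 \<Longrightarrow> (z t)\<^sup>2 \<le> (\<theta> * d t)\<^sup>2 \<Longrightarrow>
        2 * y t * y' t - 2 * (1 * d t) * (1 * d' t) < 0"
      if "t \<in> {a..b}" for t
      using zy[OF that] unfolding P_def by blast+
    have sq: "((\<lambda>t. (u t)\<^sup>2 - (r * d t)\<^sup>2) has_real_derivative 2 * u t * u' t - 2 * (r * d t) * (r * d' t)) (at t within {a..b})"
      if "t \<in> {a..b}" "(u has_real_derivative u' t) (at t within {a..b})" for t r and u u' :: "real \<Rightarrow> real"
      using d that by (auto intro!: derivative_eq_intros)
    have "a \<in> {a..b}" using t by auto
    then have da: "0 < d a" using d by blast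
    have s0: "\<bar>x a\<bar> + \<bar>y a\<bar> \<le> d a / M" by (rule init)
    have "(\<bar>l\<bar> + \<bar>\<nu>\<bar>) * (\<bar>x a\<bar> + \<bar>y a\<bar>) \<le> (\<bar>l\<bar> + \<bar>\<nu>\<bar>) * (d a / M)"
      by (intro mult_left_mono init) auto
    also have "\<dots> < \<theta> * M * (d a / M)"
    proof (rule mult_strict_right_mono)
      have "\<theta> * M = \<theta> * 1 + \<theta> * ((\<bar>l\<bar> + \<bar>\<nu>\<bar>) / \<theta>) + \<theta> * (2 * K3)"
        by (simp only: M_def distrib_left)
      also have "\<theta> * ((\<bar>l\<bar> + \<bar>\<nu>\<bar>) / \<theta>) = \<bar>l\<bar> + \<bar>\<nu>\<bar>" using \<theta> by simp
      finally show "\<bar>l\<bar> + \<bar>\<nu>\<bar> < \<theta> * M" using \<theta> K by (simp add: add_pos_nonneg)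
      show "0 < d a / M" using da M1 by simp
    qed
    finally have lt: "(\<bar>l\<bar> + \<bar>\<nu>\<bar>) * (\<bar>x a\<bar> + \<bar>y a\<bar>) < \<theta> * d a"
      using M1 by simp
    have "\<bar>z a\<bar> < \<theta> * d a"
      unfolding z_def by (rule order_le_less_trans[OF distinct_rates_norm(2)[OF less_imp_neq[OF l]] lt])
    then have "\<bar>z a\<bar>\<^sup>2 < (\<theta> * d a)\<^sup>2" by (intro power_strict_mono) auto
    then have za: "(z a)\<^sup>2 - (\<theta> * d a)\<^sup>2 < 0" by simp
    have "0 \<le> (\<bar>l\<bar> + \<bar>\<nu>\<bar>) / \<theta>" using \<theta> by (intro divide_nonneg_pos) auto
    then have "1 < M" unfolding M_def using K by linarith
    then have "d a / M < d a" using da by (simp add: divide_less_eq)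
    then have "\<bar>y a\<bar> < 1 * d a" using s0 by simp
    then have "\<bar>y a\<bar>\<^sup>2 < (1 * d a)\<^sup>2" by (intro power_strict_mono) auto
    then have ya: "(y a)\<^sup>2 - (1 * d a)\<^sup>2 < 0" by simp
    have zi: "2 * z t * z' t - 2 * (\<theta> * d t) * (\<theta> * d' t) < 0"
      if "t \<in> {a..b}" "(z t)\<^sup>2 - (\<theta> * d t)\<^sup>2 = 0" "(y t)\<^sup>2 - (1 * d t)\<^sup>2 \<le> 0" for t
      by (rule in1) (use that in auto)
    have yi: "2 * y t * y' t - 2 * (1 * d t) * (1 * d' t) < 0"
      if "t \<in> {a..b}" "(y t)\<^sup>2 - (1 * d t)\<^sup>2 = 0" "(z t)\<^sup>2 - (\<theta> * d t)\<^sup>2 \<le> 0" for t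
      by (rule in2) (use that in auto)
    have dz: "((\<lambda>t. (z t)\<^sup>2 - (\<theta> * d t)\<^sup>2) has_real_derivative
        2 * z t * z' t - 2 * (\<theta> * d t) * (\<theta> * d' t)) (at t within {a..b})" if "t \<in> {a..b}" for t
      by (rule sq[where u' = z', OF that z'[OF that]])
    have dy: "((\<lambda>t. (y t)\<^sup>2 - (1 * d t)\<^sup>2) has_real_derivative
        2 * y t * y' t - 2 * (1 * d t) * (1 * d' t)) (at t within {a..b})" if "t \<in> {a..b}" for t
      by (rule sq[where u' = y', OF that y'[OF that]])
    have zy: "(z t)\<^sup>2 - (\<theta> * d t)\<^sup>2 < 0 \<and> (y t)\<^sup>2 - (1 * d t)\<^sup>2 < 0"
      by (rule two_barriers[OF dz dy za ya zi yi t])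
    have "\<bar>x t\<bar> + \<bar>y t\<bar> \<le> 2 * K3 * d t"
    proof (rule s_le)
      show "(z t)\<^sup>2 \<le> (\<theta> * d t)\<^sup>2" "(y t)\<^sup>2 \<le> (1 * d t)\<^sup>2" using zy by auto
      show "0 < d t" using bspec[OF d t] by (elim conjE)
    qed
    also have "\<dots> \<le> M * d t"
    proof (rule mult_right_mono)
      show "2 * K3 \<le> M" using \<theta> by (simp add: M_def)
      show "0 \<le> d t" using bspec[OF d t] by (elim conjE) (rule less_imp_le)
    qed
    finally show "\<bar>x t\<bar> + \<bar>y t\<bar> \<le> M * d t" .
  qed
qed

lemma trapping:
  assumes q: "n \<in> {1..q}" "m \<in> {1..q}" and D: "0 < l * w - \<nu> * \<eta>"
    and stable: "(n = m \<longrightarrow> l + w < 0) \<and> (n < m \<longrightarrow> l < 0) \<and> (m < n \<longrightarrow> w < 0)"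
  shows "\<exists>M\<ge>1. \<exists>\<mu>>0. traps q n m l \<nu> \<eta> w M \<mu>"
proof -
  have nq: "n \<le> q" and mq: "m \<le> q" and q0: "0 < q" using q by auto
  consider "n = m" | "n < m" | "m < n" by linarith
  then show ?thesis
  proof cases
    case 1
    from trapping_equal_rates[OF nq q0 D stable[THEN conjunct1, THEN mp, OF 1]] show ?thesis unfolding 1 .
  next
    case 2
    from trapping_distinct_rates[OF 2 mq q0 D stable[THEN conjunct2, THEN conjunct1, THEN mp, OF 2]] show ?thesis .
  next
    case 3
    have "0 < w * l - \<eta> * \<nu>" using D by (simp add: mult.commute)
    from trapping_distinct_rates[OF 3 nq q0 this stable[THEN conjunct2, THEN conjunct2, THEN mp, OF 3]]
    obtain M \<mu> where M: "1 \<le> M" "0 < \<mu>" and *: "traps q m n w \<eta> \<nu> l M \<mu>"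
      by (elim exE conjE) (rule that)
    show ?thesis
    proof (rule exI[of _ M], rule conjI[OF M(1)], rule exI[of _ \<mu>], rule conjI[OF M(2)], intro allI impI)
      fix C a b and x y d d' :: "real \<Rightarrow> real"
      assume C: "0 \<le> C" and a: "1 \<le> a" and al: "almost_linear q n m l \<nu> \<eta> w \<mu> C {a..b} x y"
        and d: "slow_radius q \<mu> C {a..b} d d'"
        and init: "\<bar>x a\<bar> + \<bar>y a\<bar> \<le> d a / M"
      have al': "almost_linear q m n w \<eta> \<nu> l \<mu> C {a..b} y x"
        using al by (rule almost_linear_swap[THEN iffD1])
      have init': "\<bar>y a\<bar> + \<bar>x a\<bar> \<le> d a / M" using init by (simp only: add.commute)
      have "\<forall>t\<in>{a..b}. \<bar>y t\<bar> + \<bar>x t\<bar> \<le> M * d t"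
        using *[THEN spec, of C, THEN spec, of a, THEN spec, of b, THEN spec, of y, THEN spec, of x,
            THEN spec, of d, THEN spec, of d', THEN mp, OF C, THEN mp, OF a, THEN mp, OF al', THEN mp, OF d,
            THEN mp, OF init'] .
      then show "\<forall>t\<in>{a..b}. \<bar>x t\<bar> + \<bar>y t\<bar> \<le> M * d t" by (simp only: add.commute)
    qed
  qed
qed

text \<open>While \<open>V\<close> is at least \<open>V0\<close>, the solution has at least a fixed
  multiple of the size \<open>\<delta>\<close>, so the forcing is a relative error as well and the
  trace term dominates. The derivative of \<open>V\<close> is then at least a constant over
  \<open>t\<close>; in particular \<open>V\<close> cannot return to \<open>V0\<close>.\<close>

lemma growth_equal_rates:
  assumes q: "n \<le> q" "0 < q" and D: "0 < l * w - \<nu> * \<eta>" and tr: "0 < l + w"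
  shows "\<exists>\<mu>>0. grows_from_axis q n n l \<nu> \<eta> w \<mu>"
proof -
  define D where "D = l * w - \<nu> * \<eta>"
  define k where "k = \<bar>l\<bar> + \<bar>\<nu>\<bar> + \<bar>\<eta>\<bar> + \<bar>w\<bar>"
  define K1 where "K1 = D + 4 * k\<^sup>2"
  define K2 where "K2 = 2 * D + 4 * k\<^sup>2"
  \<comment> \<open>From \<open>V0 <= V <= K1 * s^2\<close> with
    \<open>V0 = D * \<delta>^2 / 4\<close> follows \<open>\<delta> <= K4 * s\<close>.\<close>
  define K4 where "K4 = 2 * sqrt (K1 / D)"
  define T where "T = l + w"
  \<comment> \<open>The bound \<open>1 / 4\<close> keeps \<open>x a\<close> above
    \<open>3 / 4 * \<delta>\<close>; the other one keeps the error below half of the lower bound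
    \<open>D * T * s^2\<close> for the trace term.\<close>
  define \<mu> where "\<mu> = min (1 / 4) (D * T / (4 * K2 * (1 + K4)))"
  have D0: "0 < D" and T0: "0 < T" using D tr by (simp_all add: D_def T_def)
  have K: "0 < K1" "0 < K2" using D0 by (simp_all add: K1_def K2_def add_pos_nonneg)
  have K4: "0 < K4" using K D0 by (simp add: K4_def)
  have Kp: "0 < 4 * K2 * (1 + K4)" using K K4 by simp
  have "0 < D * T / (4 * K2 * (1 + K4))" by (rule divide_pos_pos[OF mult_pos_pos[OF D0 T0] Kp])
  then have \<mu>0: "0 < \<mu>" by (simp only: \<mu>_def min_less_iff_conj) simp
  have \<mu>1: "\<mu> \<le> 1 / 4" unfolding \<mu>_def by (rule min.cobounded1)
  have "\<mu> \<le> D * T / (4 * K2 * (1 + K4))" unfolding \<mu>_def by (rule min.cobounded2)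
  then have \<mu>: "\<mu> * (4 * K2 * (1 + K4)) \<le> D * T" unfolding pos_le_divide_eq[OF Kp] .
  show ?thesis
  proof (rule exI[of _ \<mu>], rule conjI[OF \<mu>0], intro allI impI)
    fix C \<delta> a B and x y :: "real \<Rightarrow> real"
    assume C: "0 \<le> C" and a: "1 \<le> a" and \<delta>: "0 < \<delta>"
      and al: "almost_linear q n n l \<nu> \<eta> w \<mu> C {a..} x y"
      and small: "C * a powr (- 1 / real q) \<le> \<mu> * \<delta>"
      and init: "\<bar>x a - \<delta>\<bar> + \<bar>y a\<bar> \<le> \<mu> * \<delta>"
    define V where "V = (\<lambda>t. lyapunov l \<nu> \<eta> w (x t) (y t))"
    \<comment> \<open>Strictly below the initial value of \<open>V\<close>, which is at least
      \<open>D * (3 / 4 * \<delta>)\<^sup>2\<close>.\<close>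
    define V0 where "V0 = D * \<delta>\<^sup>2 / 4"
    have V_le: "V t \<le> K1 * (\<bar>x t\<bar> + \<bar>y t\<bar>)\<^sup>2" and V_ge: "D * ((x t)\<^sup>2 + (y t)\<^sup>2) \<le> V t" for t
    proof -
      have "V t \<le> K1 * ((x t)\<^sup>2 + (y t)\<^sup>2)"
        using lyapunov_bounds(2)[OF D, of "x t" "y t"] by (simp add: V_def D_def K1_def k_def)
      also have "\<dots> \<le> K1 * (\<bar>x t\<bar> + \<bar>y t\<bar>)\<^sup>2" using K by (intro mult_left_mono sum_abs_squares) auto
      finally show "V t \<le> K1 * (\<bar>x t\<bar> + \<bar>y t\<bar>)\<^sup>2" .
      show "D * ((x t)\<^sup>2 + (y t)\<^sup>2) \<le> V t"
        using lyapunov_bounds(1)[OF D, of "x t" "y t"] by (simp add: V_def D_def)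
    qed
    define P where "P = (\<lambda>t V'. (V has_real_derivative V') (at t within {a..}) \<and>
        (V0 \<le> V t \<longrightarrow> D * T * V0 / (2 * K1) / t \<le> V'))"
    have "\<exists>V'. P t V'" if t: "a \<le> t" for t
    proof -
      define A where "A = t powr (- real n / real q)"
      define \<tau> where "\<tau> = t powr (- 1 / real q)"
      define s where "s = \<bar>x t\<bar> + \<bar>y t\<bar>"
      have t1: "1 \<le> t" using a t by auto
      have A: "1 / t \<le> A" "0 < A"
        unfolding A_def using inverse_le_powr[OF t1 q] t1 by auto
      have "\<tau> \<le> a powr (- 1 / real q)" unfolding \<tau>_def using a t by (intro powr_rate_antimono) auto
      then have C\<tau>: "C * \<tau> \<le> \<mu> * \<delta>" using small C by (meson mult_left_mono order_trans)
      have "t \<in> {a..}" using t by simp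
      then obtain e1 e2 where xd: "(x has_real_derivative A * (l * x t + \<nu> * y t + e1)) (at t within {a..})"
        and yd: "(y has_real_derivative A * (\<eta> * x t + w * y t + e2)) (at t within {a..})"
        and e: "\<bar>e1\<bar> \<le> \<mu> * s + C * \<tau>" "\<bar>e2\<bar> \<le> \<mu> * s + C * \<tau>"
        using al unfolding almost_linear_def A_def s_def \<tau>_def by blast
      from lyapunov_derivative[OF xd yd D] obtain E where
        V': "(V has_real_derivative A * (2 * D * T * ((x t)\<^sup>2 + (y t)\<^sup>2) + E)) (at t within {a..})"
        and E: "\<bar>E\<bar> \<le> K2 * s * (\<bar>e1\<bar> + \<bar>e2\<bar>)"
        unfolding V_def D_def K2_def k_def s_def T_def by blast
      have "D * T * V0 / (2 * K1) / t \<le> A * (2 * D * T * ((x t)\<^sup>2 + (y t)\<^sup>2) + E)" if V: "V0 \<le> V t"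
      proof -
        have s0: "0 \<le> s" by (simp add: s_def)
        have Vs: "V t \<le> K1 * s\<^sup>2" using V_le by (simp add: s_def)
        have "\<delta> \<le> K4 * s"
        proof (rule power2_le_imp_le)
          have "D * \<delta>\<^sup>2 \<le> 4 * (K1 * s\<^sup>2)" using V Vs by (simp add: V0_def)
          then have "\<delta>\<^sup>2 \<le> 4 * (K1 * s\<^sup>2) / D" using D0 by (simp add: pos_le_divide_eq mult.commute)
          also have "\<dots> = (K4 * s)\<^sup>2" using K D0 by (simp add: K4_def power_mult_distrib)
          finally show "\<delta>\<^sup>2 \<le> (K4 * s)\<^sup>2" .
          show "0 \<le> K4 * s" using K4 s0 by simp
        qed
        then have "\<mu> * \<delta> \<le> \<mu> * (K4 * s)" using \<mu>0 by (intro mult_left_mono) auto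
        then have e12: "\<bar>e1\<bar> + \<bar>e2\<bar> \<le> 2 * (\<mu> * s + \<mu> * (K4 * s))"
          using abs_add_le_twice[OF e order_refl] C\<tau> by (meson order_trans)
        have "\<bar>E\<bar> \<le> K2 * s * (2 * (\<mu> * s + \<mu> * (K4 * s)))"
          by (rule order_trans[OF E mult_left_mono[OF e12]]) (use K s0 in simp)
        also have "\<dots> = \<mu> * (4 * K2 * (1 + K4)) * (s\<^sup>2 / 2)"
          by (simp add: power2_eq_square algebra_simps)
        also have "\<dots> \<le> D * T * (s\<^sup>2 / 2)" by (intro mult_right_mono \<mu>) auto
        finally have E': "- (D * T * (s\<^sup>2 / 2)) \<le> E" by linarith
        have "D * T * s\<^sup>2 \<le> D * T * (2 * ((x t)\<^sup>2 + (y t)\<^sup>2))"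
          unfolding s_def using D0 T0 by (intro mult_left_mono sum_abs_squares) auto
        moreover have "D * T * (s\<^sup>2 / 2) \<le> 2 * D * T * r + E" if "D * T * s\<^sup>2 \<le> D * T * (2 * r)" for r
          using that E' by simp
        ultimately have "D * T * (s\<^sup>2 / 2) \<le> 2 * D * T * ((x t)\<^sup>2 + (y t)\<^sup>2) + E" by blast
        moreover have "V0 / K1 \<le> s\<^sup>2" using V Vs K by (simp add: pos_divide_le_eq mult.commute)
        then have "D * T * (V0 / K1 / 2) \<le> D * T * (s\<^sup>2 / 2)" using D0 T0 by (intro mult_left_mono) auto
        ultimately have *: "D * T * (V0 / K1 / 2) \<le> 2 * D * T * ((x t)\<^sup>2 + (y t)\<^sup>2) + E" by linarith
        have "0 \<le> D * T * (V0 / K1 / 2)" using D0 T0 K by (simp add: V0_def)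
        then have "1 / t * (D * T * (V0 / K1 / 2)) \<le> A * (2 * D * T * ((x t)\<^sup>2 + (y t)\<^sup>2) + E)"
          using A * t1 by (intro mult_mono) auto
        then show ?thesis by (simp add: mult_ac)
      qed
      then show ?thesis using V' unfolding P_def by blast
    qed
    then obtain V' where PV: "\<And>t. a \<le> t \<Longrightarrow> P t (V' t)" by metis
    have V': "(V has_real_derivative V' t) (at t within {a..})"
      and grow: "V0 \<le> V t \<Longrightarrow> D * T * V0 / (2 * K1) / t \<le> V' t" if "a \<le> t" for t
      using PV[OF that] unfolding P_def by blast+
    have V0: "0 < V0" using D0 \<delta> by (simp add: V0_def)
    have c0: "0 < D * T * V0 / (2 * K1)" using D0 T0 V0 K by simp
    have stay: "V0 < V t" if t: "a \<le> t" for t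
    proof -
      have "3 / 4 * \<delta> \<le> x a"
        using init mult_right_mono[OF \<mu>1, of \<delta>] \<delta> by linarith
      then have "(3 / 4 * \<delta>)\<^sup>2 \<le> (x a)\<^sup>2" using \<delta> by (intro power_mono) auto
      also have "\<dots> \<le> (x a)\<^sup>2 + (y a)\<^sup>2" by simp
      finally have "D * (3 / 4 * \<delta>)\<^sup>2 \<le> V a" using V_ge[of a] D0 by (meson mult_left_mono less_imp_le order_trans)
      moreover have "V0 < D * (3 / 4 * \<delta>)\<^sup>2" using D0 \<delta> by (simp add: V0_def power2_eq_square)
      ultimately have init': "V0 - V a < 0" by simp
      have d: "((\<lambda>t. V0 - V t) has_real_derivative - V' r) (at r within {a..t})" if "r \<in> {a..t}" for r
        by (rule derivative_eq_intros DERIV_subset[OF V'] refl)+ (use that in auto)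
      have inw: "- V' r < 0" if "r \<in> {a..t}" "V0 - V r = 0" for r
      proof -
        have "0 < D * T * V0 / (2 * K1) / r" by (rule divide_pos_pos[OF c0]) (use that a in auto)
        then show ?thesis using grow[of r] that by simp
      qed
      have tt: "t \<in> {a..t}" using t by simp
      show ?thesis using two_barriers[OF d d init' init' inw inw tt] by simp
    qed
    have a0: "0 < a" using a by simp
    have grow': "D * T * V0 / (2 * K1) / t \<le> V' t" if "a \<le> t" for t
      by (rule grow[OF that less_imp_le[OF stay[OF that]]])
    obtain t where t: "a \<le> t" "K1 * B\<^sup>2 < V t"
      using unbounded_if_derivative_ge_inverse[OF a0 c0 V' grow', of "K1 * B\<^sup>2"] by blast
    then have "B\<^sup>2 < (\<bar>x t\<bar> + \<bar>y t\<bar>)\<^sup>2"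
      using V_le[of t] K(1) by (metis less_le_trans mult_less_cancel_left_pos)
    then have "B < \<bar>x t\<bar> + \<bar>y t\<bar>" by (rule power_less_imp_less_base) simp
    then show "\<exists>t\<ge>a. B < \<bar>x t\<bar> + \<bar>y t\<bar>" using t by blast
  qed
qed

text \<open>In the cone z >= z0, |y| <= z the fast variable grows at least at half of its linear
  rate, while \<open>y\<close> moves at a rate that is smaller by the factor \<open>\<mu>\<close>.
  So neither the tip nor the sides of the cone can be crossed, and \<open>z\<close> keeps
  growing.\<close>

lemma growth_distinct_rates:
  assumes q: "n < m" "m \<le> q" "0 < q" and l: "0 < l"
  shows "\<exists>\<mu>>0. grows_from_axis q n m l \<nu> \<eta> w \<mu>"
proof -
  define D where "D = l * w - \<nu> * \<eta>"
  define K where "K = (1 + \<bar>l\<bar> + \<bar>\<nu>\<bar>) * (1 + \<bar>\<eta>\<bar> + \<bar>w\<bar>)"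
  define K3 where "K3 = 1 + (1 + \<bar>\<nu>\<bar>) / \<bar>l\<bar>"
  \<comment> \<open>In the cone \<open>\<mu> * K4 * z\<close> bounds the error of the fast equation,
    and \<open>K5 * z\<close> from the next line bounds the slow right-hand side without its power
    of \<open>t\<close>.\<close>
  define K4 where "K4 = K * (4 * K3 + 2 / l)"
  define K5 where "K5 = \<bar>\<eta> / l\<bar> + \<bar>D / l\<bar> + 2 * K3 + 2 / l"
  \<comment> \<open>In this order: a bound for the slow error free of \<open>\<mu>\<close>; the
    start above \<open>z0\<close>; the start inside the sides of the cone; half of the fast rate
    left after the error; the slow motion below a quarter of \<open>l\<close>.\<close>
  define \<mu> where "\<mu> = min 1 (min (l / 2 / (l + \<bar>\<nu>\<bar> + 1)) (min (l / 2 / 2) (min (l / 2 / K4) (l / 4 / K5))))"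
  have l0: "l \<noteq> 0" using l by simp
  have "1 * 1 \<le> K" unfolding K_def by (intro mult_mono) auto
  then have K: "1 \<le> K" "1 \<le> K3" by (auto simp: K3_def)
  have K4: "0 < K4" using K l unfolding K4_def by (intro mult_pos_pos add_pos_pos) auto
  have K5: "0 < K5" using K l unfolding K5_def by (intro add_nonneg_pos add_pos_pos) auto
  have ln: "0 < l + \<bar>\<nu>\<bar> + 1" using l by (intro add_pos_nonneg) auto
  have l2: "0 < l / 2" "0 < l / 4" "0 < l / 2 / 2" using l by simp_all
  have \<mu>0: "0 < \<mu>"
    unfolding \<mu>_def min_less_iff_conj
    by (intro conjI zero_less_one l2 divide_pos_pos[OF l2(1) ln] divide_pos_pos[OF l2(1) K4] divide_pos_pos[OF l2(2) K5])
  have \<mu>_le: "\<mu> \<le> 1" "\<mu> \<le> l / 2 / (l + \<bar>\<nu>\<bar> + 1)" "\<mu> \<le> l / 2 / 2" "\<mu> \<le> l / 2 / K4" "\<mu> \<le> l / 4 / K5"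
    by (simp_all only: \<mu>_def min_le_iff_disj order_refl simp_thms)
  have \<mu>: "\<mu> * (l + \<bar>\<nu>\<bar> + 1) \<le> l / 2" "\<mu> * K4 \<le> l / 2" "\<mu> * K5 \<le> l / 4"
    using \<mu>_le(2,4,5) unfolding pos_le_divide_eq[OF ln] pos_le_divide_eq[OF K4] pos_le_divide_eq[OF K5] .
  show ?thesis
  proof (rule exI[of _ \<mu>], rule conjI[OF \<mu>0], intro allI impI)
    fix C \<delta> a B and x y :: "real \<Rightarrow> real"
    assume C: "0 \<le> C" and a: "1 \<le> a" and \<delta>: "0 < \<delta>"
      and al: "almost_linear q n m l \<nu> \<eta> w \<mu> C {a..} x y"
      and a\<mu>: "a powr (- 1 / real q) \<le> \<mu>" and small: "C * a powr (- 1 / real q) \<le> \<mu> * \<delta>"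
      and init: "\<bar>x a - \<delta>\<bar> + \<bar>y a\<bar> \<le> \<mu> * \<delta>"
    define z where "z = (\<lambda>t. l * x t + \<nu> * y t)"
    \<comment> \<open>Half of \<open>l * \<delta>\<close>, the value of \<open>z\<close> at the
      ideal initial point \<open>(\<delta>, 0)\<close>; above it the forcing is bounded by a
      multiple of \<open>z\<close>.\<close>
    define z0 where "z0 = l * \<delta> / 2"
    have z0: "0 < z0" using l \<delta> by (simp add: z0_def)
    define P where "P = (\<lambda>t z' y'. (z has_real_derivative z') (at t within {a..}) \<and>
        (y has_real_derivative y') (at t within {a..}) \<and>
        (z0 \<le> z t \<longrightarrow> (y t)\<^sup>2 \<le> (z t)\<^sup>2 \<longrightarrow> l * z0 / 2 / t \<le> z' \<and> 2 * y t * y' - 2 * z t * z' < 0))"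
    have "\<exists>z' y'. P t z' y'" if t: "a \<le> t" for t
    proof -
      define A where "A = t powr (- real n / real q)"
      define B where "B = t powr (- real m / real q)"
      define \<tau> where "\<tau> = t powr (- 1 / real q)"
      define s where "s = \<bar>x t\<bar> + \<bar>y t\<bar>"
      have t1: "1 \<le> t" using a t by auto
      have A: "1 / t \<le> A" "0 < A" and B: "0 < B"
        unfolding A_def B_def using inverse_le_powr[OF t1, of n q] q t1 by auto
      have "\<tau> \<le> a powr (- 1 / real q)" unfolding \<tau>_def using a t by (intro powr_rate_antimono) auto
      then have C\<tau>: "C * \<tau> \<le> \<mu> * \<delta>" and \<tau>: "\<tau> \<le> \<mu>" using small C a\<mu> by (meson mult_left_mono order_trans)+
      have \<tau>0: "0 \<le> \<tau>" by (simp add: \<tau>_def)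
      have "B \<le> A * \<tau>" unfolding A_def B_def \<tau>_def by (rule powr_gap[OF t1 q(1,3)])
      also have "\<dots> \<le> A * \<mu>" using A \<tau> by (intro mult_left_mono) auto
      finally have BA: "B \<le> A * \<mu>" .
      have tJ: "t \<in> {a..}" using t by simp
      obtain E e where zd: "(z has_real_derivative A * (l * z t + E)) (at t within {a..})"
        and yd: "(y has_real_derivative B * (\<eta> / l * z t + D / l * y t + e)) (at t within {a..})"
        and E: "\<bar>E\<bar> \<le> K * (\<mu> * s + C * \<tau> + \<tau> * s)" and e: "\<bar>e\<bar> \<le> \<mu> * s + C * \<tau>"
        using distinct_rates_change[OF al tJ t1 q(1,3) l0 C \<mu>0]
        unfolding A_def B_def z_def s_def \<tau>_def K_def D_def by blast
      have "l * z0 / 2 / t \<le> A * (l * z t + E) \<and>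
          2 * y t * (B * (\<eta> / l * z t + D / l * y t + e)) - 2 * z t * (A * (l * z t + E)) < 0"
        if h: "z0 \<le> z t" "(y t)\<^sup>2 \<le> (z t)\<^sup>2"
      proof -
        have zt: "0 < z t" using h(1) z0 by simp
        have y: "\<bar>y t\<bar> \<le> z t" using h(2) zt by (metis abs_le_square_iff abs_of_pos)
        have s0: "0 \<le> s" by (simp add: s_def)
        have "s \<le> K3 * (\<bar>z t\<bar> + \<bar>y t\<bar>)"
          unfolding s_def z_def K3_def by (rule distinct_rates_norm(1)[OF l0])
        also have "\<dots> \<le> K3 * (2 * z t)" using y zt K by (intro mult_left_mono) auto
        finally have s: "s \<le> K3 * (2 * z t)" .
        have \<delta>z: "\<delta> \<le> 2 / l * z t" using h(1) l by (simp add: z0_def field_simps)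
        have b: "\<mu> * s \<le> \<mu> * (K3 * (2 * z t))" "\<tau> * s \<le> \<mu> * (K3 * (2 * z t))" "C * \<tau> \<le> \<mu> * (2 / l * z t)"
          using mult_left_mono[OF s, of \<mu>] mult_mono[OF \<tau> s] \<mu>0 s0
            order_trans[OF C\<tau> mult_left_mono[OF \<delta>z, of \<mu>]] by simp_all
        have "\<mu> * s + C * \<tau> + \<tau> * s \<le> \<mu> * (K3 * (2 * z t)) + \<mu> * (2 / l * z t) + \<mu> * (K3 * (2 * z t))"
          by (intro add_mono b)
        also have "\<dots> = \<mu> * (4 * K3 + 2 / l) * z t" by (simp add: algebra_simps)
        finally have "K * (\<mu> * s + C * \<tau> + \<tau> * s) \<le> K * (\<mu> * (4 * K3 + 2 / l) * z t)"
          using K by (intro mult_left_mono) auto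
        also have "\<dots> = \<mu> * K4 * z t" by (simp add: K4_def)
        also have "\<dots> \<le> l / 2 * z t" using zt by (intro mult_right_mono \<mu>) auto
        finally have "\<bar>E\<bar> \<le> l / 2 * z t" using E by linarith
        then have F: "l / 2 * z t \<le> l * z t + E" by linarith
        have F0: "0 \<le> l * z0 / 2" "l * z0 / 2 \<le> l / 2 * z t" using l z0 h(1) by auto
        have "1 / t * (l * z0 / 2) \<le> A * (l * z t + E)"
          using A F F0 t1 by (intro mult_mono) auto
        then have z'_ge: "l * z0 / 2 / t \<le> A * (l * z t + E)" by (simp only: mult_1 times_divide_eq_left)
        have "\<bar>e\<bar> \<le> \<mu> * (K3 * (2 * z t)) + \<mu> * (2 / l * z t)" using e b by linarith
        also have "\<dots> \<le> 1 * (K3 * (2 * z t)) + 1 * (2 / l * z t)"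
        proof (intro add_mono mult_right_mono \<mu>_le(1))
          show "0 \<le> K3 * (2 * z t)" "0 \<le> 2 / l * z t" using K(2) zt l by simp_all
        qed
        also have "\<dots> = (2 * K3 + 2 / l) * z t" by (simp add: algebra_simps)
        finally have e': "\<bar>e\<bar> \<le> (2 * K3 + 2 / l) * z t" .
        have "\<bar>\<eta> / l * z t\<bar> = \<bar>\<eta> / l\<bar> * z t" using zt by (simp only: abs_mult abs_of_pos)
        moreover have "\<bar>D / l * y t\<bar> \<le> \<bar>D / l\<bar> * z t" unfolding abs_mult by (intro mult_left_mono y) auto
        moreover have "\<bar>p1 + p2 + p3\<bar> \<le> (k1 + k2 + k3) * r"
          if "\<bar>p1\<bar> = k1 * r" "\<bar>p2\<bar> \<le> k2 * r" "\<bar>p3\<bar> \<le> k3 * r" for p1 p2 p3 k1 k2 k3 r :: real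
          using that unfolding distrib_right by linarith
        ultimately have "\<bar>\<eta> / l * z t + D / l * y t + e\<bar> \<le> (\<bar>\<eta> / l\<bar> + \<bar>D / l\<bar> + (2 * K3 + 2 / l)) * z t"
          using e' by blast
        then have G: "\<bar>\<eta> / l * z t + D / l * y t + e\<bar> \<le> K5 * z t" by (simp add: K5_def add_ac)
        have "y t * (B * (\<eta> / l * z t + D / l * y t + e)) \<le> \<bar>y t\<bar> * (B * \<bar>\<eta> / l * z t + D / l * y t + e\<bar>)"
          using B by (metis abs_ge_self abs_mult abs_of_pos)
        also have "\<dots> \<le> z t * (A * \<mu> * (K5 * z t))"
          using y BA G B zt A \<mu>0 by (intro mult_mono) auto
        also have "\<dots> = A * (z t)\<^sup>2 * (\<mu> * K5)" by (simp add: power2_eq_square)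
        also have "\<dots> \<le> A * (z t)\<^sup>2 * (l / 4)" using A by (intro mult_left_mono \<mu>) auto
        finally have 1: "y t * (B * (\<eta> / l * z t + D / l * y t + e)) \<le> A * (z t)\<^sup>2 * (l / 4)" .
        have "z t * (A * (l / 2 * z t)) \<le> z t * (A * (l * z t + E))"
          using zt A F by (intro mult_left_mono) auto
        then have 2: "A * (z t)\<^sup>2 * (l / 2) \<le> z t * (A * (l * z t + E))" by (simp add: power2_eq_square mult_ac)
        have 3: "0 < A * (z t)\<^sup>2 * (l / 4)" using A zt l by simp
        have "2 * y t * (B * (\<eta> / l * z t + D / l * y t + e)) - 2 * z t * (A * (l * z t + E)) < 0"
        proof -
          have "2 * p - 2 * r < 0" if "p \<le> A * (z t)\<^sup>2 * (l / 4)" "A * (z t)\<^sup>2 * (l / 2) \<le> r" for p r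
            using that 3 by simp
          from this[OF 1 2] show ?thesis by (simp only: mult.assoc)
        qed
        with z'_ge show ?thesis by (rule conjI)
      qed
      then show ?thesis using zd yd unfolding P_def by blast
    qed
    then obtain z' y' where PV: "\<And>t. a \<le> t \<Longrightarrow> P t (z' t) (y' t)" by metis
    have z': "(z has_real_derivative z' t) (at t within {a..})"
      and y': "(y has_real_derivative y' t) (at t within {a..})"
      and grow: "z0 \<le> z t \<Longrightarrow> (y t)\<^sup>2 \<le> (z t)\<^sup>2 \<Longrightarrow> l * z0 / 2 / t \<le> z' t"
      and cone: "z0 \<le> z t \<Longrightarrow> (y t)\<^sup>2 \<le> (z t)\<^sup>2 \<Longrightarrow> 2 * y t * y' t - 2 * z t * z' t < 0" if "a \<le> t" for t
      using PV[OF that] unfolding P_def by blast+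
    have c0: "0 < l * z0 / 2" using l z0 by simp
    have init': "z0 - z a < 0" "(y a)\<^sup>2 - (z a)\<^sup>2 < 0"
    proof -
      have "\<bar>l * (x a - \<delta>) + \<nu> * y a\<bar> \<le> (l + \<bar>\<nu>\<bar>) * (\<bar>x a - \<delta>\<bar> + \<bar>y a\<bar>)"
        using l by (intro abs_lincomb_le) auto
      also have "\<dots> \<le> (l + \<bar>\<nu>\<bar>) * (\<mu> * \<delta>)" using l by (intro mult_left_mono init) auto
      also have "\<dots> < \<mu> * (l + \<bar>\<nu>\<bar> + 1) * \<delta>" using \<mu>0 \<delta> by (simp add: algebra_simps)
      also have "\<dots> \<le> l / 2 * \<delta>" using \<delta> by (intro mult_right_mono \<mu>) auto
      finally have "\<bar>z a - l * \<delta>\<bar> < l / 2 * \<delta>" by (simp add: z_def algebra_simps)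
      then show za: "z0 - z a < 0" unfolding z0_def by linarith
      have "\<bar>y a\<bar> \<le> \<mu> * \<delta>" using init by linarith
      also have "\<dots> \<le> l / 2 / 2 * \<delta>" using \<delta> by (intro mult_right_mono \<mu>_le) auto
      also have "\<dots> < z a" using za z0 by (simp add: z0_def)
      finally have "\<bar>y a\<bar>\<^sup>2 < (z a)\<^sup>2" by (intro power_strict_mono) auto
      then show "(y a)\<^sup>2 - (z a)\<^sup>2 < 0" by simp
    qed
    have stay: "z0 - z t < 0 \<and> (y t)\<^sup>2 - (z t)\<^sup>2 < 0" if t: "a \<le> t" for t
    proof -
      have d1: "((\<lambda>t. z0 - z t) has_real_derivative - z' r) (at r within {a..t})" if "r \<in> {a..t}" for r
        by (rule derivative_eq_intros DERIV_subset[OF z'] refl)+ (use that in auto)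
      have zr: "(z has_real_derivative z' r) (at r within {a..t})" and yr: "(y has_real_derivative y' r) (at r within {a..t})"
        if "r \<in> {a..t}" for r
        using that DERIV_subset[OF z', of r "{a..t}"] DERIV_subset[OF y', of r "{a..t}"] by auto
      have d2: "((\<lambda>t. (y t)\<^sup>2 - (z t)\<^sup>2) has_real_derivative 2 * y r * y' r - 2 * z r * z' r) (at r within {a..t})"
        if "r \<in> {a..t}" for r
        using zr[OF that] yr[OF that] by (auto intro!: derivative_eq_intros)
      have i1: "- z' r < 0" if "r \<in> {a..t}" "z0 - z r = 0" "(y r)\<^sup>2 - (z r)\<^sup>2 \<le> 0" for r
      proof -
        have "0 < l * z0 / 2 / r" by (rule divide_pos_pos[OF c0]) (use that a in auto)
        also have "\<dots> \<le> z' r" by (rule grow) (use that in auto)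
        finally show ?thesis by simp
      qed
      have i2: "2 * y r * y' r - 2 * z r * z' r < 0"
        if "r \<in> {a..t}" "(y r)\<^sup>2 - (z r)\<^sup>2 = 0" "z0 - z r \<le> 0" for r
        by (rule cone) (use that in auto)
      have tt: "t \<in> {a..t}" using t by simp
      show ?thesis by (rule two_barriers[OF d1 d2 init' i1 i2 tt])
    qed
    have grow': "l * z0 / 2 / t \<le> z' t" if "a \<le> t" for t
      by (rule grow) (use that stay[OF that] in auto)
    have a0: "0 < a" using a by simp
    obtain t where t: "a \<le> t" "(l + \<bar>\<nu>\<bar>) * \<bar>B\<bar> < z t"
      using unbounded_if_derivative_ge_inverse[OF a0 c0 z' grow', of "(l + \<bar>\<nu>\<bar>) * \<bar>B\<bar>"] by blast
    have "z t \<le> (l + \<bar>\<nu>\<bar>) * (\<bar>x t\<bar> + \<bar>y t\<bar>)"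
      using distinct_rates_norm(2)[OF l0, of "x t" \<nu> "y t"] l unfolding z_def by linarith
    with t(2) have "(l + \<bar>\<nu>\<bar>) * \<bar>B\<bar> < (l + \<bar>\<nu>\<bar>) * (\<bar>x t\<bar> + \<bar>y t\<bar>)" by linarith
    then have "\<bar>B\<bar> < \<bar>x t\<bar> + \<bar>y t\<bar>"
      by (rule mult_left_less_imp_less) (use l in auto)
    then have "B < \<bar>x t\<bar> + \<bar>y t\<bar>" by linarith
    then show "\<exists>t\<ge>a. B < \<bar>x t\<bar> + \<bar>y t\<bar>" using t by blast
  qed
qed

text \<open>The direction of escape is \<open>(0, 1)\<close> if the second variable is the fast one
  and \<open>(1, 0)\<close> otherwise; it is made existential to unify the cases.\<close>

lemma growth:
  assumes q: "n \<in> {1..q}" "m \<in> {1..q}" and D: "0 < l * w - \<nu> * \<eta>"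
    and unstable: "(n = m \<longrightarrow> 0 < l + w) \<and> (n < m \<longrightarrow> 0 < l) \<and> (m < n \<longrightarrow> 0 < w)"
  shows "\<exists>\<mu>>0. \<exists>x0 y0. \<bar>x0\<bar> + \<bar>y0\<bar> = 1 \<and>
    grows q n m l \<nu> \<eta> w x0 y0 \<mu>"
proof -
  have q0: "0 < q" using q by auto
  consider "n = m" | "n < m" | "m < n" by linarith
  then show ?thesis
  proof cases
    case 1
    have "n \<le> q" using q by simp
    from growth_equal_rates[OF this q0 D unstable[THEN conjunct1, THEN mp, OF 1]] have "\<exists>\<mu>>0. grows_from_axis q n m l \<nu> \<eta> w \<mu>" unfolding 1 .
    then obtain \<mu> where \<mu>: "0 < \<mu>"
      and *: "grows_from_axis q n m l \<nu> \<eta> w \<mu>" by (elim exE conjE) (rule that)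
    show ?thesis
      by (rule exI[of _ \<mu>], rule conjI[OF \<mu>], rule exI[of _ 1], rule exI[of _ 0], rule conjI, simp,
          intro allI impI, rule *[rule_format]) (assumption | simp)+
  next
    case 2
    have "m \<le> q" using q by simp
    from growth_distinct_rates[OF 2 this q0 unstable[THEN conjunct2, THEN conjunct1, THEN mp, OF 2], of \<nu> \<eta> w] obtain \<mu> where \<mu>: "0 < \<mu>"
      and *: "grows_from_axis q n m l \<nu> \<eta> w \<mu>" by (elim exE conjE) (rule that)
    show ?thesis
      by (rule exI[of _ \<mu>], rule conjI[OF \<mu>], rule exI[of _ 1], rule exI[of _ 0], rule conjI, simp,
          intro allI impI, rule *[rule_format]) (assumption | simp)+
  next
    case 3
    have "n \<le> q" using q by simp
    from growth_distinct_rates[OF 3 this q0 unstable[THEN conjunct2, THEN conjunct2, THEN mp, OF 3], of \<eta> \<nu> l] obtain \<mu> where \<mu>: "0 < \<mu>"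
      and *: "grows_from_axis q m n w \<eta> \<nu> l \<mu>" by (elim exE conjE) (rule that)
    show ?thesis
    proof (rule exI[of _ \<mu>], rule conjI[OF \<mu>], rule exI[of _ 0], rule exI[of _ 1], rule conjI, simp,
          intro allI impI)
      fix C \<delta> a B and x y :: "real \<Rightarrow> real"
      assume "0 \<le> C" "1 \<le> a" "0 < \<delta>" and al: "almost_linear q n m l \<nu> \<eta> w \<mu> C {a..} x y"
        and "a powr (- 1 / real q) \<le> \<mu>" "C * a powr (- 1 / real q) \<le> \<mu> * \<delta>"
        and init: "\<bar>x a - \<delta> * 0\<bar> + \<bar>y a - \<delta> * 1\<bar> \<le> \<mu> * \<delta>"
      then have init': "\<bar>y a - \<delta>\<bar> + \<bar>x a\<bar> \<le> \<mu> * \<delta>" by simp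
      have al': "almost_linear q m n w \<eta> \<nu> l \<mu> C {a..} y x"
        using al by (rule almost_linear_swap[THEN iffD1])
      have "\<exists>t\<ge>a. B < \<bar>y t\<bar> + \<bar>x t\<bar>"
        by (rule *[rule_format]) (fact al' init' | fact)+
      then show "\<exists>t\<ge>a. B < \<bar>x t\<bar> + \<bar>y t\<bar>" by (simp only: add.commute)
    qed
  qed
qed

section \<open>Stability and instability of a perturbed equilibrium\<close>

lemma rate_eventually_small:
  assumes "0 < p" "0 < e"
  shows "\<exists>T\<ge>1. \<forall>t\<ge>T. t powr (- p) \<le> (e :: real)"
proof -
  have "((\<lambda>t::real. t powr (- p)) \<longlongrightarrow> 0) at_top"
    by (rule tendsto_neg_powr[OF _ filterlim_ident]) (use assms in simp)
  then have "\<forall>\<^sub>F t in at_top. t powr (- p) < e"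
    using assms(2) by (rule order_tendstoD)
  then obtain T where "\<And>t. t \<ge> T \<Longrightarrow> t powr (- p) < e" by (auto simp: eventually_at_top_linorder)
  then show ?thesis by (intro exI[of _ "max 1 T"]) (auto intro: less_imp_le)
qed

text \<open>No range condition as in \<open>solves_on\<close>, because the cut-off field below lives
  on the whole plane. The range is recovered later from closeness to the equilibrium.\<close>

definition solves2 :: "(real \<Rightarrow> real \<times> real \<Rightarrow> real \<times> real) \<Rightarrow> real set \<Rightarrow> (real \<Rightarrow> real) \<Rightarrow> (real \<Rightarrow> real) \<Rightarrow> bool" where
  "solves2 H J R \<Psi> \<longleftrightarrow> (\<forall>t\<in>J.
     (R has_real_derivative fst (H t (R t, \<Psi> t))) (at t within J) \<and>
     (\<Psi> has_real_derivative snd (H t (R t, \<Psi> t))) (at t within J))"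

lemma solves2_subset: "solves2 H J R \<Psi> \<Longrightarrow> I \<subseteq> J \<Longrightarrow> solves2 H I R \<Psi>"
  unfolding solves2_def
proof
  fix t assume h: "\<forall>t\<in>J. (R has_real_derivative fst (H t (R t, \<Psi> t))) (at t within J) \<and>
     (\<Psi> has_real_derivative snd (H t (R t, \<Psi> t))) (at t within J)" and I: "I \<subseteq> J" and "t \<in> I"
  then have "t \<in> J" by blast
  from bspec[OF h this] show "(R has_real_derivative fst (H t (R t, \<Psi> t))) (at t within I) \<and>
     (\<Psi> has_real_derivative snd (H t (R t, \<Psi> t))) (at t within I)"
    by (elim conjE) (intro conjI DERIV_subset[OF _ I])
qed

lemma solves2_vector:
  "solves2 H J R \<Psi> \<longleftrightarrow> (\<forall>t\<in>J. ((\<lambda>t. (R t, \<Psi> t)) has_vector_derivative H t (R t, \<Psi> t)) (at t within J))"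
proof -
  have "((\<lambda>t. (R t, \<Psi> t)) has_vector_derivative v) (at t within J) \<longleftrightarrow>
    (R has_real_derivative fst v) (at t within J) \<and> (\<Psi> has_real_derivative snd v) (at t within J)" for v t
    using has_vector_derivative_Pair[of R "fst v" t J \<Psi> "snd v"]
      bounded_linear.has_vector_derivative[OF bounded_linear_fst, of "\<lambda>t. (R t, \<Psi> t)" v "at t within J"]
      bounded_linear.has_vector_derivative[OF bounded_linear_snd, of "\<lambda>t. (R t, \<Psi> t)" v "at t within J"]
    by (auto simp: has_real_derivative_iff_has_vector_derivative)
  then show ?thesis by (simp add: solves2_def)
qed

lemma solves2_continuous:
  assumes "solves2 H J R \<Psi>"
  shows "continuous_on J R" "continuous_on J \<Psi>"
  using assms unfolding solves2_def
  by (auto intro: DERIV_continuous_on[of J R "\<lambda>t. fst (H t (R t, \<Psi> t))"]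
      DERIV_continuous_on[of J \<Psi> "\<lambda>t. snd (H t (R t, \<Psi> t))"])

text \<open>The interface between averaging and stability. The almost linear variables are functions
  of time attached to one solution and close to its deviation, so the near-identity change of
  variables never has to be inverted.\<close>

abbreviation "reduces q n m l \<nu> \<eta> w \<rho>\<^sub>0 \<phi>\<^sub>0 H \<mu> r C T \<equiv> \<forall>J R \<Psi>. J \<subseteq> {T..} \<longrightarrow> solves2 H J R \<Psi> \<longrightarrow>
   (\<forall>t\<in>J. \<bar>R t - \<rho>\<^sub>0\<bar> \<le> r \<and> \<bar>\<Psi> t - \<phi>\<^sub>0\<bar> \<le> r) \<longrightarrow>
   (\<exists>x y. almost_linear q n m l \<nu> \<eta> w \<mu> C J x y \<and>
     (\<forall>t\<in>J. \<bar>x t - (R t - \<rho>\<^sub>0)\<bar> + \<bar>y t - (\<Psi> t - \<phi>\<^sub>0)\<bar> \<le> C * t powr (- 1 / real q)))"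

text \<open>Collects what the stability argument uses of a field, since it is applied to the full
  system in resonance variables and to the truncated system. Regularity is asked for on a box only,
  as the fields make sense only for amplitudes in (0, R].\<close>

locale perturbed_equilibrium =
  fixes q n m :: nat and l \<nu> \<eta> w \<rho>\<^sub>0 \<phi>\<^sub>0 b :: real
    and H :: "real \<Rightarrow> real \<times> real \<Rightarrow> real \<times> real"
  assumes orders: "n \<in> {1..q}" "m \<in> {1..q}"
    and b: "0 < b"
    and cont: "continuous_on ({0<..} \<times> ({\<rho>\<^sub>0 - b..\<rho>\<^sub>0 + b} \<times> {\<phi>\<^sub>0 - b..\<phi>\<^sub>0 + b})) (\<lambda>(t, y). H t y)"
    and lip: "\<And>a c. 0 < a \<Longrightarrow> \<exists>L. \<forall>t\<in>{a..c}. \<forall>y\<in>{\<rho>\<^sub>0 - b..\<rho>\<^sub>0 + b} \<times> {\<phi>\<^sub>0 - b..\<phi>\<^sub>0 + b}.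
        \<forall>z\<in>{\<rho>\<^sub>0 - b..\<rho>\<^sub>0 + b} \<times> {\<phi>\<^sub>0 - b..\<phi>\<^sub>0 + b}. norm (H t y - H t z) \<le> L * norm (y - z)"
    and reduction: "\<And>\<mu>. 0 < \<mu> \<Longrightarrow> \<exists>r>0. \<exists>C\<ge>0. \<exists>T\<ge>1. reduces q n m l \<nu> \<eta> w \<rho>\<^sub>0 \<phi>\<^sub>0 H \<mu> r C T"
begin

abbreviation "nbhd \<equiv> {\<rho>\<^sub>0 - b..\<rho>\<^sub>0 + b} \<times> {\<phi>\<^sub>0 - b..\<phi>\<^sub>0 + b}"

text \<open>The nearest-point projection onto a closed convex set is 1-Lipschitz, so this field is
  globally Lipschitz in the state on compact time intervals, and it agrees with \<open>H\<close> on
  the box.\<close>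

abbreviation "cutoff t y \<equiv> H t (closest_point nbhd y)"

lemma q_pos: "0 < q" using orders by auto

lemma nbhd: "closed nbhd" "convex nbhd" "nbhd \<noteq> {}"
proof -
  show "closed nbhd" by (intro closed_Times closed_atLeastAtMost)
  show "convex nbhd" by (intro convex_Times convex_real_interval)
  show "nbhd \<noteq> {}" using b by auto
qed

lemma cutoff_eq: "\<bar>R - \<rho>\<^sub>0\<bar> \<le> b \<Longrightarrow> \<bar>\<Psi> - \<phi>\<^sub>0\<bar> \<le> b \<Longrightarrow> cutoff t (R, \<Psi>) = H t (R, \<Psi>)"
proof -
  assume "\<bar>R - \<rho>\<^sub>0\<bar> \<le> b" "\<bar>\<Psi> - \<phi>\<^sub>0\<bar> \<le> b"
  then have "(R, \<Psi>) \<in> nbhd" by (auto simp: abs_le_iff)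
  then show ?thesis by (simp only: closest_point_self)
qed

lemma cutoff_lipschitz:
  assumes "0 < a"
  shows "\<exists>L. \<forall>t\<in>{a..c}. \<forall>y z. norm (cutoff t y - cutoff t z) \<le> L * norm (y - z)"
proof -
  obtain L where L: "\<And>t y z. t \<in> {a..c} \<Longrightarrow> y \<in> nbhd \<Longrightarrow> z \<in> nbhd \<Longrightarrow> norm (H t y - H t z) \<le> L * norm (y - z)"
    using lip[OF assms, of c] by blast
  have "norm (cutoff t y - cutoff t z) \<le> max L 0 * norm (y - z)" if t: "t \<in> {a..c}" for t y z
  proof -
    have "norm (cutoff t y - cutoff t z) \<le> L * norm (closest_point nbhd y - closest_point nbhd z)"
      by (intro L t closest_point_in_set nbhd)
    also have "\<dots> \<le> max L 0 * norm (closest_point nbhd y - closest_point nbhd z)"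
      by (intro mult_right_mono) auto
    also have "\<dots> \<le> max L 0 * norm (y - z)"
      using closest_point_lipschitz[OF nbhd(2,1,3), of y z] by (intro mult_left_mono) (auto simp: dist_norm)
    finally show ?thesis .
  qed
  then show ?thesis by blast
qed

lemma cutoff_solution:
  assumes a: "0 < a"
  shows "\<exists>R \<Psi>. R a = R0 \<and> \<Psi> a = \<Psi>0 \<and> solves2 cutoff {a..} R \<Psi>"
proof -
  have "continuous_on ({a..} \<times> UNIV) ((\<lambda>(t, y). H t y) \<circ> (\<lambda>(t, y). (t, closest_point nbhd y)))"
  proof (rule continuous_on_compose)
    show "continuous_on ({a..} \<times> UNIV) (\<lambda>(t, y). (t, closest_point nbhd y))"
      unfolding case_prod_beta
      by (intro continuous_intros continuous_on_compose2[OF continuous_on_closest_point[OF nbhd(2,1,3), of UNIV]]) auto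
    show "continuous_on ((\<lambda>(t, y). (t, closest_point nbhd y)) ` ({a..} \<times> UNIV)) (\<lambda>(t, y). H t y)"
      by (rule continuous_on_subset[OF cont]) (use a closest_point_in_set[OF nbhd(1,3)] in force)
  qed
  then have "continuous_on ({a..} \<times> UNIV) (\<lambda>(t, y). cutoff t y)"
    by (simp add: o_def case_prod_beta)
  from ode_global_existence[OF this cutoff_lipschitz[OF a], of "(R0, \<Psi>0)"]
  obtain y where y: "y a = (R0, \<Psi>0)" "\<forall>t\<in>{a..}. (y has_vector_derivative cutoff t (y t)) (at t within {a..})"
    by blast
  then show ?thesis
    by (intro exI[of _ "fst \<circ> y"] exI[of _ "snd \<circ> y"]) (simp add: solves2_vector o_def)
qed

text \<open>Serves to identify a solution given on an interval with the global solution of the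
  cut-off equation.\<close>

lemma cutoff_unique:
  assumes J: "is_interval J" "a \<in> J" "t \<in> J" "a \<le> t" and a: "0 < a"
    and 1: "solves2 cutoff J R \<Psi>" and 2: "solves2 cutoff J R' \<Psi>'" and init: "R a = R' a" "\<Psi> a = \<Psi>' a"
  shows "R t = R' t \<and> \<Psi> t = \<Psi>' t"
proof -
  have sub: "{a..t} \<subseteq> J"
  proof
    fix r assume "r \<in> {a..t}"
    then show "r \<in> J" using mem_is_interval_1_I[OF J(1-3), of r] by simp
  qed
  obtain L where L: "\<And>r y z. r \<in> {a..t} \<Longrightarrow> norm (cutoff r y - cutoff r z) \<le> L * norm (y - z)"
    using cutoff_lipschitz[OF a, of t] by blast
  have "(R t, \<Psi> t) = (R' t, \<Psi>' t)"
    by (rule ode_unique[OF J(4) L solves2_subset[OF 1 sub, unfolded solves2_vector, rule_format]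
          solves2_subset[OF 2 sub, unfolded solves2_vector, rule_format]])
      (use init in simp_all)
  then show ?thesis by simp
qed

end

section \<open>Stable case: confinement, continuation and a convergent solution\<close>

locale stable_equilibrium = perturbed_equilibrium +
  assumes det: "0 < l * w - \<nu> * \<eta>"
    and stable: "(n = m \<longrightarrow> l + w < 0) \<and> (n < m \<longrightarrow> l < 0) \<and> (m < n \<longrightarrow> w < 0)"
begin

abbreviation "confines N \<mu> r C T \<equiv> \<forall>a c R \<Psi> d d'. T \<le> a \<longrightarrow> solves2 H {a..c} R \<Psi> \<longrightarrow>
   (\<forall>t\<in>{a..c}. \<bar>R t - \<rho>\<^sub>0\<bar> \<le> r \<and> \<bar>\<Psi> t - \<phi>\<^sub>0\<bar> \<le> r) \<longrightarrow>
   slow_radius q \<mu> C {a..c} d d' \<longrightarrow> \<bar>R a - \<rho>\<^sub>0\<bar> + \<bar>\<Psi> a - \<phi>\<^sub>0\<bar> \<le> d a / N \<longrightarrow>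
   (\<forall>t\<in>{a..c}. \<bar>R t - \<rho>\<^sub>0\<bar> + \<bar>\<Psi> t - \<phi>\<^sub>0\<bar> \<le> N * d t)"

abbreviation "confines_on_intervals N \<mu> r C T \<equiv> \<forall>J a R \<Psi> d d'. T \<le> a \<longrightarrow>
   is_interval J \<longrightarrow> a \<in> J \<longrightarrow> J \<subseteq> {a..} \<longrightarrow>
   (solves2 H J R \<Psi> \<or> solves2 cutoff J R \<Psi>) \<longrightarrow>
   (\<forall>t\<in>J. 0 < d t \<and> (d has_real_derivative d' t) (at t within J) \<and> N * d t < r \<and>
     - \<mu> * d t / t \<le> d' t \<and> t powr (- 1 / real q) \<le> \<mu> \<and> C * t powr (- 1 / real q) \<le> \<mu> * d t) \<longrightarrow>
   \<bar>R a - \<rho>\<^sub>0\<bar> + \<bar>\<Psi> a - \<phi>\<^sub>0\<bar> \<le> d a / N \<longrightarrow>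
   solves2 H J R \<Psi> \<and> solves2 cutoff J R \<Psi> \<and>
   (\<forall>t\<in>J. \<bar>R t - \<rho>\<^sub>0\<bar> + \<bar>\<Psi> t - \<phi>\<^sub>0\<bar> \<le> N * d t)"

lemma confined:
  "\<exists>N\<ge>1. \<exists>\<mu>>0. \<exists>r>0. \<exists>C\<ge>0. \<exists>T\<ge>1. confines N \<mu> r C T"
proof -
  obtain M \<mu> where M: "1 \<le> M" "0 < \<mu>" and trap: "traps q n m l \<nu> \<eta> w M \<mu>"
    using trapping[OF orders det stable] by (elim exE conjE) (rule that)
  obtain r C T where r: "0 < r" "0 \<le> C" "1 \<le> T" and red: "reduces q n m l \<nu> \<eta> w \<rho>\<^sub>0 \<phi>\<^sub>0 H \<mu> r C T"
    using reduction[OF M(2)] by (elim exE conjE) (rule that)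
  \<comment> \<open>The bound \<open>1 / (2 * M)\<close> makes the gap between the almost linear
    variables and the deviation at most \<open>d / (2 * M)\<close>. This costs half of the
    admissible initial size and doubles \<open>M\<close> at the end.\<close>
  define \<mu>' where "\<mu>' = min \<mu> (1 / (2 * M))"
  have \<mu>': "0 < \<mu>'" "\<mu>' \<le> \<mu>" "\<mu>' \<le> 1 / (2 * M)"
    using M by (simp_all add: \<mu>'_def min.coboundedI1)
  have N: "1 \<le> 2 * M" using M by simp
  show ?thesis
  proof (rule exI[of _ "2 * M"], rule conjI[OF N], rule exI[of _ \<mu>'], rule conjI[OF \<mu>'(1)],
      rule exI[of _ r], rule conjI[OF r(1)], rule exI[of _ C], rule conjI[OF r(2)], rule exI[of _ T],
      rule conjI[OF r(3)], intro allI impI ballI)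
    fix a c t and R \<Psi> d d' :: "real \<Rightarrow> real"
    assume a: "T \<le> a" and s: "solves2 H {a..c} R \<Psi>"
      and near: "\<forall>t\<in>{a..c}. \<bar>R t - \<rho>\<^sub>0\<bar> \<le> r \<and> \<bar>\<Psi> t - \<phi>\<^sub>0\<bar> \<le> r"
      and d: "slow_radius q \<mu>' C {a..c} d d'"
      and init: "\<bar>R a - \<rho>\<^sub>0\<bar> + \<bar>\<Psi> a - \<phi>\<^sub>0\<bar> \<le> d a / (2 * M)"
      and t: "t \<in> {a..c}"
    have aT: "{a..c} \<subseteq> {T..}" using a by auto
    obtain x y where al: "almost_linear q n m l \<nu> \<eta> w \<mu> C {a..c} x y"
      and close: "\<And>t. t \<in> {a..c} \<Longrightarrow> \<bar>x t - (R t - \<rho>\<^sub>0)\<bar> + \<bar>y t - (\<Psi> t - \<phi>\<^sub>0)\<bar> \<le> C * t powr (- 1 / real q)"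
      using red[rule_format, OF aT s near[rule_format]] by blast
    have d': "0 < d t" "(d has_real_derivative d' t) (at t within {a..c})" "- \<mu> * d t / t \<le> d' t"
      "t powr (- 1 / real q) \<le> \<mu>" "C * t powr (- 1 / real q) \<le> \<mu> * d t" "C * t powr (- 1 / real q) \<le> d t / (2 * M)"
      if t: "t \<in> {a..c}" for t
    proof -
      note D = bspec[OF d t]
      show pos: "0 < d t" and "(d has_real_derivative d' t) (at t within {a..c})" using D by blast+
      have "\<mu>' * d t / t \<le> \<mu> * d t / t"
        using \<mu>'(2) pos t a r(3) by (intro divide_right_mono mult_right_mono) auto
      then show "- \<mu> * d t / t \<le> d' t" using D by simp
      show "t powr (- 1 / real q) \<le> \<mu>" using D \<mu>'(2) by linarith
      have "\<mu>' * d t \<le> \<mu> * d t" "\<mu>' * d t \<le> 1 / (2 * M) * d t"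
        using \<mu>' pos by (intro mult_right_mono; simp)+
      moreover have "C * t powr (- 1 / real q) \<le> \<mu>' * d t" using D by blast
      ultimately show "C * t powr (- 1 / real q) \<le> \<mu> * d t" "C * t powr (- 1 / real q) \<le> d t / (2 * M)"
        by simp_all
    qed
    have a': "a \<in> {a..c}" using t by auto
    have tri: "\<bar>p\<bar> + \<bar>p'\<bar> \<le> e + e'" if "\<bar>u\<bar> + \<bar>u'\<bar> \<le> e" "\<bar>p - u\<bar> + \<bar>p' - u'\<bar> \<le> e'" for p p' u u' e e' :: real
    proof -
      have "\<bar>p\<bar> \<le> \<bar>u\<bar> + \<bar>p - u\<bar>" "\<bar>p'\<bar> \<le> \<bar>u'\<bar> + \<bar>p' - u'\<bar>" by linarith+
      then show ?thesis using that by linarith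
    qed
    have "\<bar>x a\<bar> + \<bar>y a\<bar> \<le> d a / (2 * M) + d a / (2 * M)"
      by (rule tri[OF init order_trans[OF close[OF a'] d'(6)[OF a']]])
    also have "\<dots> = d a / M" by simp
    finally have "\<bar>x a\<bar> + \<bar>y a\<bar> \<le> d a / M" .
    moreover have "1 \<le> a" using a r by simp
    ultimately have "\<bar>x t\<bar> + \<bar>y t\<bar> \<le> M * d t"
      using trap[rule_format, OF r(2) _ al, of d d' t] d' t by blast
    moreover have "\<bar>(R t - \<rho>\<^sub>0) - x t\<bar> + \<bar>(\<Psi> t - \<phi>\<^sub>0) - y t\<bar> \<le> d t / (2 * M)"
      using order_trans[OF close[OF t] d'(6)[OF t]] by (simp only: abs_minus_commute)
    ultimately have "\<bar>R t - \<rho>\<^sub>0\<bar> + \<bar>\<Psi> t - \<phi>\<^sub>0\<bar> \<le> M * d t + d t / (2 * M)" by (rule tri)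
    also have "d t / (2 * M) \<le> d t / 1" using d'(1)[OF t] M by (intro divide_left_mono) auto
    also have "M * d t + d t / 1 \<le> M * d t + M * d t" using d'(1)[OF t] M by simp
    finally show "\<bar>R t - \<rho>\<^sub>0\<bar> + \<bar>\<Psi> t - \<phi>\<^sub>0\<bar> \<le> 2 * M * d t" by simp
  qed
qed

text \<open>Bootstrap: as long as the deviation is at most \<open>r\<close>, the projection is
  inactive, the two equations coincide, and trapping bounds the deviation by \<open>N * d\<close>,
  which is less than \<open>r\<close>. So \<open>r\<close> is never reached.\<close>

lemma confined_on_interval:
  "\<exists>N\<ge>1. \<exists>\<mu>>0. \<exists>r>0. \<exists>C\<ge>0. \<exists>T\<ge>1. r \<le> b \<and> confines_on_intervals N \<mu> r C T"
proof -
  obtain N \<mu> r0 C T where N: "1 \<le> N" "0 < \<mu>" "0 < r0" "0 \<le> C" "1 \<le> T" and conf: "confines N \<mu> r0 C T"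
    using confined by (elim exE conjE) (rule that)
  \<comment> \<open>At most \<open>b\<close>, so that deviations up to \<open>r\<close> stay in the
    box where the cut-off changes nothing.\<close>
  define r where "r = min r0 b"
  have r: "0 < r" "r \<le> r0" "r \<le> b" using N b by (simp_all add: r_def)
  show ?thesis
  proof (rule exI[of _ N], rule conjI[OF N(1)], rule exI[of _ \<mu>], rule conjI[OF N(2)],
      rule exI[of _ r], rule conjI[OF r(1)], rule exI[of _ C], rule conjI[OF N(4)], rule exI[of _ T],
      rule conjI[OF N(5)], rule conjI[OF r(3)], intro allI impI)
    fix J a and R \<Psi> d d' :: "real \<Rightarrow> real"
    assume a: "T \<le> a" and J: "is_interval J" "a \<in> J" "J \<subseteq> {a..}" and s: "solves2 H J R \<Psi> \<or> solves2 cutoff J R \<Psi>"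
      and d: "\<forall>t\<in>J. 0 < d t \<and> (d has_real_derivative d' t) (at t within J) \<and> N * d t < r \<and>
       - \<mu> * d t / t \<le> d' t \<and> t powr (- 1 / real q) \<le> \<mu> \<and> C * t powr (- 1 / real q) \<le> \<mu> * d t"
      and init: "\<bar>R a - \<rho>\<^sub>0\<bar> + \<bar>\<Psi> a - \<phi>\<^sub>0\<bar> \<le> d a / N"
    define p where "p = (\<lambda>t. \<bar>R t - \<rho>\<^sub>0\<bar> + \<bar>\<Psi> t - \<phi>\<^sub>0\<bar>)"
    have p_near: "\<bar>R t - \<rho>\<^sub>0\<bar> \<le> c" "\<bar>\<Psi> t - \<phi>\<^sub>0\<bar> \<le> c" if "p t \<le> c" for t c
      using that abs_ge_zero[of "R t - \<rho>\<^sub>0"] abs_ge_zero[of "\<Psi> t - \<phi>\<^sub>0"] unfolding p_def by linarith+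
    have sub: "{a..t} \<subseteq> J" if "t \<in> J" for t
    proof
      fix r assume "r \<in> {a..t}"
      then show "r \<in> J" using mem_is_interval_1_I[OF J(1,2) that, of r] by simp
    qed
    have both: "solves2 H I R \<Psi> \<and> solves2 cutoff I R \<Psi>" if I: "I \<subseteq> J" and p: "\<And>t. t \<in> I \<Longrightarrow> p t \<le> r" for I
    proof -
      have "cutoff t (R t, \<Psi> t) = H t (R t, \<Psi> t)" if "t \<in> I" for t
        by (rule cutoff_eq) (use p_near[OF p[OF that]] r in auto)
      then have "solves2 H I R \<Psi> \<longleftrightarrow> solves2 cutoff I R \<Psi>" by (simp add: solves2_def)
      moreover have "solves2 H I R \<Psi> \<or> solves2 cutoff I R \<Psi>" using s solves2_subset I by blast
      ultimately show ?thesis by blast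
    qed
    have step: "p t \<le> N * d t" if t: "t \<in> J" and p: "\<And>u. u \<in> {a..t} \<Longrightarrow> p u \<le> r" for t
    proof -
      have "a \<le> t" using t J by auto
      have s': "solves2 H {a..t} R \<Psi>" using both[OF sub[OF t] p] by blast
      have near: "\<forall>u\<in>{a..t}. \<bar>R u - \<rho>\<^sub>0\<bar> \<le> r0 \<and> \<bar>\<Psi> u - \<phi>\<^sub>0\<bar> \<le> r0"
        using p_near[OF order_trans[OF p r(2)]] by blast
      have d0: "\<forall>u\<in>{a..t}. 0 < d u \<and> (d has_real_derivative d' u) (at u within {a..t}) \<and>
       - \<mu> * d u / u \<le> d' u \<and> u powr (- 1 / real q) \<le> \<mu> \<and> C * u powr (- 1 / real q) \<le> \<mu> * d u"
        using d sub[OF t] DERIV_subset[of d _ _ J "{a..t}"] by blast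
      from conf[rule_format, OF a s' near[rule_format] d0[rule_format] init] \<open>a \<le> t\<close>
      show ?thesis unfolding p_def by simp
    qed
    have "p a \<le> d a / 1" unfolding p_def
      using init N(1) d J(2) divide_left_mono[of 1 N "d a"] by fastforce
    also have "\<dots> \<le> N * d a" using N(1) d J(2) by simp
    also have "\<dots> < r" using d J(2) by blast
    finally have pa: "p a < r" .
    have "continuous_on J R" "continuous_on J \<Psi>"
      using s solves2_continuous by blast+
    then have "continuous_on J p" unfolding p_def by (intro continuous_intros)
    moreover have "p u < r" if u: "u \<in> J" "a \<le> u" "\<And>v. v \<in> {a..u} \<Longrightarrow> p v \<le> r" for u
    proof -
      have "p u \<le> N * d u" by (rule step[OF u(1,3)])
      also have "\<dots> < r" using bspec[OF d u(1)] by (elim conjE)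
      finally show ?thesis .
    qed
    ultimately have lt: "p t < r" if "t \<in> J" for t
      using continuous_induction_below[where p = p and c = r and t = t, OF J(1,2) _ pa _ that] J(3) that by auto
    have "solves2 H J R \<Psi> \<and> solves2 cutoff J R \<Psi>"
      by (rule both) (use lt in \<open>auto intro: less_imp_le\<close>)
    moreover have "p t \<le> N * d t" if t: "t \<in> J" for t
    proof (rule step[OF t])
      show "p u \<le> r" if "u \<in> {a..t}" for u using lt[OF subsetD[OF sub[OF t] that]] by simp
    qed
    ultimately show "solves2 H J R \<Psi> \<and> solves2 cutoff J R \<Psi> \<and> (\<forall>t\<in>J. \<bar>R t - \<rho>\<^sub>0\<bar> + \<bar>\<Psi> t - \<phi>\<^sub>0\<bar> \<le> N * d t)"
      unfolding p_def by blast
  qed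
qed

text \<open>The cut-off solution with the same initial values exists for all time and is confined,
  hence solves the original equation, and by uniqueness it extends the given solution. The radius is
  constant here.\<close>

theorem stability:
  assumes \<epsilon>: "0 < \<epsilon>"
  shows "\<exists>\<delta>\<in>{0<..<\<epsilon>}. \<exists>T>0. \<forall>a\<ge>T. \<forall>J R \<Psi>. is_interval J \<and> a \<in> J \<and> J \<subseteq> {a..} \<and> solves2 H J R \<Psi> \<and>
      \<bar>R a - \<rho>\<^sub>0\<bar> + \<bar>\<Psi> a - \<phi>\<^sub>0\<bar> \<le> \<delta> \<longrightarrow>
      (\<exists>R' \<Psi>'. solves2 H {a..} R' \<Psi>' \<and> (\<forall>t\<in>J. R' t = R t \<and> \<Psi>' t = \<Psi> t) \<and>
         (\<forall>t\<ge>a. \<bar>R' t - \<rho>\<^sub>0\<bar> + \<bar>\<Psi>' t - \<phi>\<^sub>0\<bar> < \<epsilon>))"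
proof -
  obtain N \<mu> r C T where N: "1 \<le> N" "0 < \<mu>" "0 < r" "0 \<le> C" "1 \<le> T" "r \<le> b" and conf: "confines_on_intervals N \<mu> r C T"
    using confined_on_interval by (elim exE conjE) (rule that)
  \<comment> \<open>The factor \<open>2 * N\<close> makes \<open>N * \<Delta>\<close> strictly
    smaller than both \<open>r\<close> and \<open>\<epsilon>\<close>.\<close>
  define \<Delta> where "\<Delta> = min r \<epsilon> / (2 * N)"
  define \<delta> where "\<delta> = \<Delta> / N"
  have \<Delta>: "0 < \<Delta>" using N \<epsilon> by (simp add: \<Delta>_def)
  have N\<Delta>: "N * \<Delta> < r" "N * \<Delta> < \<epsilon>"
    using N \<epsilon> by (auto simp: \<Delta>_def min_def)
  have "\<delta> \<le> N * \<Delta>"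
  proof -
    have "\<delta> \<le> \<Delta> / 1" unfolding \<delta>_def using N \<Delta> by (intro divide_left_mono) auto
    also have "\<dots> \<le> N * \<Delta>" using N \<Delta> by simp
    finally show ?thesis .
  qed
  then have \<delta>: "0 < \<delta>" "\<delta> < \<epsilon>" using N\<Delta> N \<Delta> by (auto simp: \<delta>_def)
  have q1: "0 < 1 / real q" using q_pos by simp
  have "0 < min \<mu> (\<mu> * \<Delta> / (C + 1))" using N \<Delta> by simp
  from rate_eventually_small[OF q1 this] obtain T1 where T1: "1 \<le> T1"
    "\<And>t. T1 \<le> t \<Longrightarrow> t powr (- 1 / real q) \<le> min \<mu> (\<mu> * \<Delta> / (C + 1))" by auto
  have rate: "t powr (- 1 / real q) \<le> \<mu>" "C * t powr (- 1 / real q) \<le> \<mu> * \<Delta>" if "T1 \<le> t" for t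
  proof -
    show "t powr (- 1 / real q) \<le> \<mu>" using T1(2)[OF that] by simp
    have "C * t powr (- 1 / real q) \<le> (C + 1) * t powr (- 1 / real q)" by (intro mult_right_mono) auto
    also have "\<dots> \<le> (C + 1) * (\<mu> * \<Delta> / (C + 1))" using T1(2)[OF that] N by (intro mult_left_mono) auto
    also have "\<dots> = \<mu> * \<Delta>" using N by simp
    finally show "C * t powr (- 1 / real q) \<le> \<mu> * \<Delta>" .
  qed
  have const: "\<forall>t\<in>J. 0 < \<Delta> \<and> ((\<lambda>_. \<Delta>) has_real_derivative 0) (at t within J) \<and> N * \<Delta> < r \<and>
       - \<mu> * \<Delta> / t \<le> 0 \<and> t powr (- 1 / real q) \<le> \<mu> \<and> C * t powr (- 1 / real q) \<le> \<mu> * \<Delta>"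
    if "J \<subseteq> {a..}" "max T T1 \<le> a" for J a
  proof
    fix t assume "t \<in> J"
    with that have t: "T1 \<le> t" by auto
    have "0 < t" using t T1(1) by simp
    then have "0 \<le> \<mu> * \<Delta> / t" using N \<Delta> by simp
    then show "0 < \<Delta> \<and> ((\<lambda>_. \<Delta>) has_real_derivative 0) (at t within J) \<and> N * \<Delta> < r \<and>
       - \<mu> * \<Delta> / t \<le> 0 \<and> t powr (- 1 / real q) \<le> \<mu> \<and> C * t powr (- 1 / real q) \<le> \<mu> * \<Delta>"
      using \<Delta> N\<Delta> rate[OF t] by auto
  qed
  show ?thesis
  proof (rule bexI[of _ \<delta>], rule exI[of _ "max T T1"], intro conjI allI impI)
    show "\<delta> \<in> {0<..<\<epsilon>}" using \<delta> by simp
    show "0 < max T T1" using N by simp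
    fix a J R \<Psi> assume a: "max T T1 \<le> a"
      and h: "is_interval J \<and> a \<in> J \<and> J \<subseteq> {a..} \<and> solves2 H J R \<Psi> \<and> \<bar>R a - \<rho>\<^sub>0\<bar> + \<bar>\<Psi> a - \<phi>\<^sub>0\<bar> \<le> \<delta>"
    then have J: "is_interval J" "a \<in> J" "J \<subseteq> {a..}" and s: "solves2 H J R \<Psi>"
      and init: "\<bar>R a - \<rho>\<^sub>0\<bar> + \<bar>\<Psi> a - \<phi>\<^sub>0\<bar> \<le> \<Delta> / N" by (auto simp: \<delta>_def)
    have aT: "T \<le> a" "0 < a" using a N by auto
    obtain R' \<Psi>' where init': "R' a = R a" "\<Psi>' a = \<Psi> a" and s': "solves2 cutoff {a..} R' \<Psi>'"
      using cutoff_solution[OF aT(2), of "R a" "\<Psi> a"] by blast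
    have 1: "solves2 cutoff J R \<Psi>"
      using conf[rule_format, OF aT(1) J disjI1[OF s] const[OF J(3) a, rule_format] init] by blast
    have init'': "\<bar>R' a - \<rho>\<^sub>0\<bar> + \<bar>\<Psi>' a - \<phi>\<^sub>0\<bar> \<le> \<Delta> / N" using init init' by simp
    have ia: "is_interval {a..}" "a \<in> {a..}" by (auto simp: is_interval_ci)
    have 2: "solves2 H {a..} R' \<Psi>' \<and> (\<forall>t\<in>{a..}. \<bar>R' t - \<rho>\<^sub>0\<bar> + \<bar>\<Psi>' t - \<phi>\<^sub>0\<bar> \<le> N * \<Delta>)"
      using conf[rule_format, OF aT(1) ia subset_refl disjI2[OF s'] const[OF subset_refl a, rule_format] init''] by blast
    have "R' t = R t \<and> \<Psi>' t = \<Psi> t" if t: "t \<in> J" for t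
      by (rule cutoff_unique[OF J(1,2) t _ aT(2) solves2_subset[OF s' J(3)] 1 init']) (use t J in auto)
    moreover have "\<bar>R' t - \<rho>\<^sub>0\<bar> + \<bar>\<Psi>' t - \<phi>\<^sub>0\<bar> < \<epsilon>" if "a \<le> t" for t
    proof -
      have "\<bar>R' t - \<rho>\<^sub>0\<bar> + \<bar>\<Psi>' t - \<phi>\<^sub>0\<bar> \<le> N * \<Delta>" using 2 that by simp
      then show ?thesis using N\<Delta>(2) by (rule le_less_trans)
    qed
    ultimately show "\<exists>R' \<Psi>'. solves2 H {a..} R' \<Psi>' \<and> (\<forall>t\<in>J. R' t = R t \<and> \<Psi>' t = \<Psi> t) \<and>
         (\<forall>t\<ge>a. \<bar>R' t - \<rho>\<^sub>0\<bar> + \<bar>\<Psi>' t - \<phi>\<^sub>0\<bar> < \<epsilon>)"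
      using 2 by blast
  qed
qed

text \<open>With a radius that tends to zero, confinement is itself convergence. The solution starts
  at the equilibrium, which satisfies every initial condition of confinement.\<close>

theorem convergent_solution:
  assumes \<epsilon>: "0 < \<epsilon>"
  shows "\<exists>a>0. \<exists>R \<Psi>. solves2 H {a..} R \<Psi> \<and> (R \<longlongrightarrow> \<rho>\<^sub>0) at_top \<and> (\<Psi> \<longlongrightarrow> \<phi>\<^sub>0) at_top \<and>
      (\<forall>t\<ge>a. \<bar>R t - \<rho>\<^sub>0\<bar> + \<bar>\<Psi> t - \<phi>\<^sub>0\<bar> < \<epsilon>)"
proof -
  obtain N \<mu> r C T where N: "1 \<le> N" "0 < \<mu>" "0 < r" "0 \<le> C" "1 \<le> T" "r \<le> b" and conf: "confines_on_intervals N \<mu> r C T"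
    using confined_on_interval by (elim exE conjE) (rule that)
  \<comment> \<open>\<open>\<gamma> <= \<mu>\<close> is the admissible decay of a radius;
    \<open>\<gamma> <= 1 / (2 * q)\<close> makes the forcing smaller than the radius by the
    vanishing factor \<open>t powr (- (1 / (2 * q)))\<close>.\<close>
  define \<gamma> where "\<gamma> = min \<mu> (1 / (2 * real q))"
  define d where "d = (\<lambda>t::real. t powr (- \<gamma>))"
  have q1: "0 < 1 / real q" "0 < 1 / (2 * real q)" using q_pos by simp_all
  have \<gamma>: "0 < \<gamma>" "\<gamma> \<le> \<mu>" "\<gamma> \<le> 1 / (2 * real q)" using N q1 by (simp_all add: \<gamma>_def)
  obtain T1 where T1: "1 \<le> T1" "\<And>t. T1 \<le> t \<Longrightarrow> t powr (- 1 / real q) \<le> \<mu>"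
    using rate_eventually_small[OF q1(1) N(2)] by auto
  have "0 < \<mu> / (C + 1)" using N by simp
  then obtain T2 where T2: "1 \<le> T2" "\<And>t. T2 \<le> t \<Longrightarrow> t powr (- (1 / (2 * real q))) \<le> \<mu> / (C + 1)"
    using rate_eventually_small[OF q1(2)] by blast
  have "0 < min r \<epsilon> / (2 * N)" using N \<epsilon> by simp
  then obtain T3 where T3: "1 \<le> T3" "\<And>t. T3 \<le> t \<Longrightarrow> d t \<le> min r \<epsilon> / (2 * N)"
    using rate_eventually_small[OF \<gamma>(1)] unfolding d_def by blast
  define a where "a = max (max T T1) (max T2 T3)"
  have a: "T \<le> a" "T1 \<le> a" "T2 \<le> a" "T3 \<le> a" "1 \<le> a" using T1(1) by (auto simp: a_def)
  have Nd: "N * d t < min r \<epsilon>" if "a \<le> t" for t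
  proof -
    have "N * d t \<le> N * (min r \<epsilon> / (2 * N))" using T3(2)[of t] that a N by (intro mult_left_mono) auto
    also have "\<dots> = min r \<epsilon> / 2" using N by simp
    also have "\<dots> < min r \<epsilon>" using N \<epsilon> by (simp add: min_def)
    finally show ?thesis .
  qed
  have d: "0 < d t \<and> (d has_real_derivative - \<gamma> * d t / t) (at t within {a..}) \<and> N * d t < r \<and>
       - \<mu> * d t / t \<le> - \<gamma> * d t / t \<and> t powr (- 1 / real q) \<le> \<mu> \<and> C * t powr (- 1 / real q) \<le> \<mu> * d t"
    if t: "t \<in> {a..}" for t
  proof (intro conjI)
    have t0: "1 \<le> t" using t a by auto
    show pos: "0 < d t" using t0 by (simp add: d_def)
    have "(d has_real_derivative (- \<gamma>) * t powr (- \<gamma> - 1)) (at t within {a..})"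
      unfolding d_def using t0 by (auto intro!: derivative_eq_intros)
    then show "(d has_real_derivative - \<gamma> * d t / t) (at t within {a..})"
      using t0 by (simp add: d_def powr_diff)
    show "N * d t < r" using Nd[of t] t by auto
    have "\<gamma> * d t / t \<le> \<mu> * d t / t" using \<gamma> pos t0 by (intro divide_right_mono mult_right_mono) auto
    then show "- \<mu> * d t / t \<le> - \<gamma> * d t / t" by simp
    show "t powr (- 1 / real q) \<le> \<mu>" using T1(2)[of t] t a by auto
    have "t powr (- 1 / real q) \<le> t powr (- (1 / (2 * real q)) + - \<gamma>)"
      using t0 \<gamma>(3) q_pos by (intro powr_mono) (auto simp: field_simps)
    also have "\<dots> = t powr (- (1 / (2 * real q))) * d t" by (simp only: powr_add d_def)
    also have "\<dots> \<le> \<mu> / (C + 1) * d t" using T2(2)[of t] t a pos by (intro mult_right_mono) auto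
    finally have "(C + 1) * t powr (- 1 / real q) \<le> (C + 1) * (\<mu> / (C + 1) * d t)"
      using N by (intro mult_left_mono) auto
    also have "\<dots> = \<mu> * d t" using N by simp
    finally have "(C + 1) * t powr (- 1 / real q) \<le> \<mu> * d t" .
    moreover have "C * t powr (- 1 / real q) \<le> (C + 1) * t powr (- 1 / real q)" by (intro mult_right_mono) auto
    ultimately show "C * t powr (- 1 / real q) \<le> \<mu> * d t" by linarith
  qed
  have a0: "0 < a" using a by simp
  obtain R \<Psi> where init: "R a = \<rho>\<^sub>0" "\<Psi> a = \<phi>\<^sub>0" and s: "solves2 cutoff {a..} R \<Psi>"
    using cutoff_solution[OF a0] by blast
  have ia: "is_interval {a..}" "a \<in> {a..}" by (auto simp: is_interval_ci)
  have init': "\<bar>R a - \<rho>\<^sub>0\<bar> + \<bar>\<Psi> a - \<phi>\<^sub>0\<bar> \<le> d a / N" using init N d[OF ia(2)] by simp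
  have 1: "solves2 H {a..} R \<Psi>" and 2: "\<And>t. t \<in> {a..} \<Longrightarrow> \<bar>R t - \<rho>\<^sub>0\<bar> + \<bar>\<Psi> t - \<phi>\<^sub>0\<bar> \<le> N * d t"
    using conf[rule_format, OF a(1) ia subset_refl disjI2[OF s] d init'] by blast+
  have lim: "((\<lambda>t. N * d t) \<longlongrightarrow> 0) at_top"
    unfolding d_def by (rule tendsto_mult_right_zero, rule tendsto_neg_powr[OF _ filterlim_ident]) (use \<gamma> in simp)
  have ev: "\<forall>\<^sub>F t in at_top. \<bar>R t - \<rho>\<^sub>0\<bar> + \<bar>\<Psi> t - \<phi>\<^sub>0\<bar> \<le> N * d t"
    using 2 by (auto simp: eventually_at_top_linorder)
  have "((\<lambda>t. R t - \<rho>\<^sub>0) \<longlongrightarrow> 0) at_top" "((\<lambda>t. \<Psi> t - \<phi>\<^sub>0) \<longlongrightarrow> 0) at_top"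
    by (rule Lim_null_comparison[OF _ lim], rule eventually_mono[OF ev], simp)+
  then have "(R \<longlongrightarrow> \<rho>\<^sub>0) at_top" "(\<Psi> \<longlongrightarrow> \<phi>\<^sub>0) at_top" by (simp_all add: Lim_null[symmetric])
  moreover have "\<bar>R t - \<rho>\<^sub>0\<bar> + \<bar>\<Psi> t - \<phi>\<^sub>0\<bar> < \<epsilon>" if "a \<le> t" for t
    using 2[of t] Nd[OF that] that by simp
  ultimately show ?thesis using a0 1 by blast
qed

end

section \<open>Unstable case: escape from a neighbourhood\<close>

locale unstable_equilibrium = perturbed_equilibrium +
  assumes det: "0 < l * w - \<nu> * \<eta>"
    and unstable: "(n = m \<longrightarrow> 0 < l + w) \<and> (n < m \<longrightarrow> 0 < l) \<and> (m < n \<longrightarrow> 0 < w)"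
begin

text \<open>A cut-off solution that never reaches distance \<open>\<epsilon>\<close> would solve the
  original equation for all time within the range of linearization, and growth would contradict its
  boundedness. Stopping at the first exit gives a genuine solution, and
  \<open>\<epsilon> <= \<epsilon>0\<close> will keep it in the domain of amplitudes.\<close>

theorem instability:
  assumes \<epsilon>0: "0 < \<epsilon>0"
  shows "\<exists>\<epsilon>>0. \<epsilon> \<le> \<epsilon>0 \<and> (\<exists>T>0. \<forall>\<delta>\<in>{0<..<\<epsilon>}. \<exists>a\<ge>T. \<exists>c>a. \<exists>R \<Psi>. solves2 H {a..c} R \<Psi> \<and>
      \<bar>R a - \<rho>\<^sub>0\<bar> + \<bar>\<Psi> a - \<phi>\<^sub>0\<bar> \<le> \<delta> \<and> \<bar>R c - \<rho>\<^sub>0\<bar> + \<bar>\<Psi> c - \<phi>\<^sub>0\<bar> = \<epsilon> \<and>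
      (\<forall>t\<in>{a..c}. \<bar>R t - \<rho>\<^sub>0\<bar> + \<bar>\<Psi> t - \<phi>\<^sub>0\<bar> \<le> \<epsilon>))"
proof -
  obtain \<mu> x0 y0 where \<mu>: "0 < \<mu>" and xy0: "\<bar>x0\<bar> + \<bar>y0\<bar> = 1" and grow:
    "grows q n m l \<nu> \<eta> w x0 y0 \<mu>"
    using growth[OF orders det unstable] by (elim exE conjE) (rule that)
  obtain r C T where r: "0 < r" "0 \<le> C" "1 \<le> T" and red: "reduces q n m l \<nu> \<eta> w \<rho>\<^sub>0 \<phi>\<^sub>0 H \<mu> r C T"
    using reduction[OF \<mu>] by (elim exE conjE) (rule that)
  define \<epsilon> where "\<epsilon> = min \<epsilon>0 (min r b)"
  have \<epsilon>: "0 < \<epsilon>" "\<epsilon> \<le> \<epsilon>0" "\<epsilon> \<le> r" "\<epsilon> \<le> b" using \<epsilon>0 r b by (auto simp: \<epsilon>_def)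
  have T: "0 < T" using r by simp
  have q1: "0 < 1 / real q" using q_pos by simp
  have "\<exists>a\<ge>T. \<exists>c>a. \<exists>R \<Psi>. solves2 H {a..c} R \<Psi> \<and>
      \<bar>R a - \<rho>\<^sub>0\<bar> + \<bar>\<Psi> a - \<phi>\<^sub>0\<bar> \<le> \<delta> \<and> \<bar>R c - \<rho>\<^sub>0\<bar> + \<bar>\<Psi> c - \<phi>\<^sub>0\<bar> = \<epsilon> \<and>
      (\<forall>t\<in>{a..c}. \<bar>R t - \<rho>\<^sub>0\<bar> + \<bar>\<Psi> t - \<phi>\<^sub>0\<bar> \<le> \<epsilon>)" if \<delta>: "\<delta> \<in> {0<..<\<epsilon>}" for \<delta>
  proof -
    have "0 < min \<mu> (\<mu> * \<delta> / (C + 1))" using \<mu> r \<delta> by simp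
    from rate_eventually_small[OF q1 this] obtain T1 where T1: "1 \<le> T1"
      "\<And>t. T1 \<le> t \<Longrightarrow> t powr (- 1 / real q) \<le> min \<mu> (\<mu> * \<delta> / (C + 1))" by auto
    \<comment> \<open>The starting time depends on \<open>\<delta>\<close>, since the forcing must
      be small relative to the initial deviation.\<close>
    define a where "a = max T T1"
    have a: "T \<le> a" "T1 \<le> a" "1 \<le> a" using r by (auto simp: a_def)
    have a0: "0 < a" using a by simp
    have rate1: "a powr (- 1 / real q) \<le> \<mu>" using T1(2)[OF a(2)] by simp
    have "C * a powr (- 1 / real q) \<le> (C + 1) * a powr (- 1 / real q)" by (intro mult_right_mono) auto
    also have "\<dots> \<le> (C + 1) * (\<mu> * \<delta> / (C + 1))" using T1(2)[OF a(2)] r by (intro mult_left_mono) auto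
    also have "\<dots> = \<mu> * \<delta>" using r by simp
    finally have rate2: "C * a powr (- 1 / real q) \<le> \<mu> * \<delta>" .
    obtain R \<Psi> where init: "R a = \<rho>\<^sub>0 + \<delta> * x0" "\<Psi> a = \<phi>\<^sub>0 + \<delta> * y0" and s: "solves2 cutoff {a..} R \<Psi>"
      using cutoff_solution[OF a0] by blast
    define p where "p = (\<lambda>t. \<bar>R t - \<rho>\<^sub>0\<bar> + \<bar>\<Psi> t - \<phi>\<^sub>0\<bar>)"
    have "p a = \<delta> * (\<bar>x0\<bar> + \<bar>y0\<bar>)" using \<delta> by (simp add: p_def init abs_mult distrib_left)
    then have pa: "p a = \<delta>" using xy0 by simp
    have p_near: "\<bar>R t - \<rho>\<^sub>0\<bar> \<le> c" "\<bar>\<Psi> t - \<phi>\<^sub>0\<bar> \<le> c" if "p t \<le> c" for t c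
      using that abs_ge_zero[of "R t - \<rho>\<^sub>0"] abs_ge_zero[of "\<Psi> t - \<phi>\<^sub>0"] unfolding p_def by linarith+
    have sH: "solves2 H I R \<Psi>" if I: "I \<subseteq> {a..}" and p: "\<And>t. t \<in> I \<Longrightarrow> p t \<le> \<epsilon>" for I
    proof -
      have "cutoff t (R t, \<Psi> t) = H t (R t, \<Psi> t)" if "t \<in> I" for t
        by (rule cutoff_eq) (use p_near[OF p[OF that]] \<epsilon> in auto)
      moreover have "solves2 cutoff I R \<Psi>" by (rule solves2_subset[OF s I])
      ultimately show ?thesis by (simp add: solves2_def)
    qed
    have "\<exists>t\<ge>a. \<epsilon> \<le> p t"
    proof (rule ccontr)
      assume neg: "\<not> (\<exists>t\<ge>a. \<epsilon> \<le> p t)"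
      have lt: "p t \<le> \<epsilon>" if "t \<in> {a..}" for t
      proof -
        have "\<not> \<epsilon> \<le> p t" using neg that by simp
        then show ?thesis by simp
      qed
      have near: "\<forall>t\<in>{a..}. \<bar>R t - \<rho>\<^sub>0\<bar> \<le> r \<and> \<bar>\<Psi> t - \<phi>\<^sub>0\<bar> \<le> r"
        using p_near[OF order_trans[OF lt \<epsilon>(3)]] by blast
      have aT: "{a..} \<subseteq> {T..}" using a by auto
      obtain x y where al: "almost_linear q n m l \<nu> \<eta> w \<mu> C {a..} x y"
        and close: "\<And>t. t \<in> {a..} \<Longrightarrow> \<bar>x t - (R t - \<rho>\<^sub>0)\<bar> + \<bar>y t - (\<Psi> t - \<phi>\<^sub>0)\<bar> \<le> C * t powr (- 1 / real q)"
        using red[rule_format, OF aT sH[OF subset_refl lt] near[rule_format]] by blast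
      have "\<bar>x a - \<delta> * x0\<bar> + \<bar>y a - \<delta> * y0\<bar> \<le> \<mu> * \<delta>"
        using order_trans[OF close[of a] rate2] by (simp add: init)
      \<comment> \<open>Growth beyond \<open>\<epsilon> + \<mu> * \<delta>\<close> suffices, because
        the almost linear variables stay within \<open>\<mu> * \<delta>\<close> of the
        deviation.\<close>
      from grow[rule_format, OF r(2) a(3) _ al rate1 rate2 this, of "\<epsilon> + \<mu> * \<delta>"]
      obtain t where t: "a \<le> t" "\<epsilon> + \<mu> * \<delta> < \<bar>x t\<bar> + \<bar>y t\<bar>" using \<delta> by auto
      have "C * t powr (- 1 / real q) \<le> C * a powr (- 1 / real q)"
        using powr_rate_antimono[OF a0 t(1)] r by (intro mult_left_mono) auto
      then have "\<bar>x t - (R t - \<rho>\<^sub>0)\<bar> + \<bar>y t - (\<Psi> t - \<phi>\<^sub>0)\<bar> \<le> \<mu> * \<delta>"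
        using close[of t] t(1) rate2 by simp
      moreover have "\<bar>R t - \<rho>\<^sub>0\<bar> + \<bar>\<Psi> t - \<phi>\<^sub>0\<bar> \<le> \<epsilon>" using lt[of t] t(1) by (simp add: p_def)
      ultimately show False using t(2) by linarith
    qed
    then obtain c0 where c0: "a \<le> c0" "\<epsilon> \<le> p c0" by blast
    have "continuous_on {a..} p" unfolding p_def
      by (intro continuous_intros solves2_continuous[OF s])
    then have "continuous_on {a..c0} p" by (rule continuous_on_subset) auto
    moreover have "p a < \<epsilon>" using pa \<delta> by simp
    ultimately obtain c where c: "a < c" "p c = \<epsilon>" "\<And>t. a \<le> t \<Longrightarrow> t < c \<Longrightarrow> p t < \<epsilon>"
      using first_hitting_time[where p = p and c = \<epsilon>, OF c0(1) _ _ c0(2)] by blast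
    have le: "p t \<le> \<epsilon>" if "t \<in> {a..c}" for t
      using c(2) c(3)[of t] that by (cases "t = c") auto
    have "solves2 H {a..c} R \<Psi>" by (rule sH[OF _ le]) auto
    then show ?thesis using a(1) c(1,2) pa le unfolding p_def
      by (intro exI[of _ a] conjI exI[of _ c] exI[of _ R] exI[of _ \<Psi>]) auto
  qed
  then show ?thesis using \<epsilon> T by blast
qed

end

section \<open>Averaging\<close>

lemma smooth_on_pdiff: "smooth_on A h \<Longrightarrow> smooth_on A (pdiff A e h)"
  unfolding smooth_on_def by (metis Ck_on.simps(2))

lemma smooth_on_continuous: "smooth_on A h \<Longrightarrow> continuous_on A h"
  unfolding smooth_on_def by (metis Ck_on.simps(1))

lemma smooth_on_has_derivative:
  assumes "smooth_on A h" "x \<in> A"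
  shows "(h has_derivative (\<lambda>e. pdiff A e h x)) (at x within A)"
proof -
  have "h differentiable_on A" using assms(1) unfolding smooth_on_def by (metis Ck_on.simps(2))
  then have "h differentiable (at x within A)" using assms(2) by (auto simp: differentiable_on_def)
  then show ?thesis by (simp add: pdiff_def frechet_derivative_works)
qed

text \<open>Continuity of derivatives is available for one direction at a time, so each basis
  direction is bounded on \<open>K\<close> and linearity in the direction bounds the operator norm.
  Convexity of \<open>K\<close> is for the mean value inequality.\<close>

lemma smooth_on_lipschitz:
  fixes h :: "'a::euclidean_space \<Rightarrow> real"
  assumes h: "smooth_on A h" and K: "compact K" "convex K" "K \<subseteq> A"
  shows "\<exists>L\<ge>0. \<forall>x\<in>K. \<forall>y\<in>K. \<bar>h x - h y\<bar> \<le> L * norm (x - y)"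
proof -
  have "\<exists>M. \<forall>x\<in>K. \<bar>pdiff A e h x\<bar> \<le> M" for e
  proof -
    have "continuous_on K (pdiff A e h)"
      using smooth_on_continuous[OF smooth_on_pdiff[OF h]] K(3) continuous_on_subset by blast
    then have "bounded (pdiff A e h ` K)" using K(1) by (intro compact_imp_bounded compact_continuous_image)
    then show ?thesis by (auto simp: bounded_iff)
  qed
  then obtain M where M: "\<And>e x. x \<in> K \<Longrightarrow> \<bar>pdiff A e h x\<bar> \<le> M e" by metis
  define L where "L = (\<Sum>e\<in>Basis. \<bar>M e\<bar>)"
  have der: "(h has_derivative (\<lambda>e. pdiff A e h x)) (at x within K)" if "x \<in> K" for x
    using smooth_on_has_derivative[OF h] that K(3) has_derivative_subset by blast
  have bnd: "onorm (\<lambda>e. pdiff A e h x) \<le> L" if x: "x \<in> K" for x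
  proof (rule onorm_bound)
    show "0 \<le> L" by (simp add: L_def sum_nonneg)
    fix v :: 'a
    have lin: "linear (\<lambda>e. pdiff A e h x)"
      using der[OF x] by (rule has_derivative_linear)
    have "pdiff A v h x = pdiff A (\<Sum>e\<in>Basis. (v \<bullet> e) *\<^sub>R e) h x" by (simp add: euclidean_representation)
    also have "\<dots> = (\<Sum>e\<in>Basis. (v \<bullet> e) * pdiff A e h x)"
      by (subst linear_sum[OF lin]) (simp add: linear_scale[OF lin])
    finally have "norm (pdiff A v h x) \<le> (\<Sum>e\<in>Basis. \<bar>v \<bullet> e\<bar> * \<bar>pdiff A e h x\<bar>)"
      by (simp add: sum_abs abs_mult[symmetric] order_trans[OF sum_abs])
    also have "\<dots> \<le> (\<Sum>e\<in>Basis. norm v * \<bar>M e\<bar>)"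
      using M[OF x] by (intro sum_mono mult_mono) (auto simp: Basis_le_norm intro: order_trans[OF _ abs_ge_self])
    also have "\<dots> = L * norm v" by (simp add: L_def sum_distrib_left mult.commute)
    finally show "norm (pdiff A v h x) \<le> L * norm v" .
  qed
  have "norm (h x - h y) \<le> L * norm (x - y)" if "x \<in> K" "y \<in> K" for x y
    by (rule differentiable_bound[OF K(2) der bnd that])
  moreover have "0 \<le> L" by (simp add: L_def sum_nonneg)
  ultimately show ?thesis by (intro exI[of _ L]) auto
qed

lemma pdiff_eq_0:
  assumes X: "open X" "X \<subseteq> A" and h: "\<And>x. x \<in> X \<Longrightarrow> h x = 0" and x: "x \<in> X"
  shows "pdiff A e h x = 0"
proof -
  have at: "at x within A = at x"
    using X x by (intro at_within_interior) (meson interiorI)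
  have "(h has_derivative (\<lambda>_. 0)) (at x)"
    by (rule has_derivative_transform_within_open[OF has_derivative_const[of 0] X(1) x]) (simp add: h)
  then have "frechet_derivative h (at x) = (\<lambda>_. 0)" by (rule frechet_derivative_at[symmetric])
  then show ?thesis by (simp add: pdiff_def at)
qed

text \<open>The Taylor coefficients of a vanishing averaged coefficient vanish too. An open subset
  is used because there the derivative within \<open>A\<close> is the ordinary one and the vanishing
  persists under iteration.\<close>

lemma pdiff_iterate_eq_0:
  assumes X: "open X" "X \<subseteq> A" and h: "\<And>x. x \<in> X \<Longrightarrow> h x = 0" and x: "x \<in> X"
  shows "(pdiff A e ^^ i) ((pdiff A e' ^^ j) h) x = 0"
proof -
  have "(pdiff A e' ^^ j) h x = 0" if "x \<in> X" for x
    using that by (induction j arbitrary: x) (auto simp: h intro: pdiff_eq_0[OF X])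
  then show ?thesis
    using x by (induction i arbitrary: x) (auto intro: pdiff_eq_0[OF X])
qed

lemma periodic_int:
  fixes h :: "real \<Rightarrow> 'a"
  assumes "\<And>x. h (x + p) = h x"
  shows "h (x + of_int j * p) = h x"
proof (induction j arbitrary: x rule: int_induct[where k = 0])
  case (step1 i)
  then show ?case using assms[of "x + of_int i * p"] by (simp add: algebra_simps)
next
  case (step2 i)
  then show ?case using assms[of "x + of_int (i - 1) * p"] by (simp add: algebra_simps)
qed simp

text \<open>Two errors arise: the remainder of \<open>a\<close> times the bounded polynomial, and
  the at most \<open>(Suc n)^2\<close> products \<open>A i * B k\<close> with
  \<open>i + k > n\<close>, each of which carries a power of at least \<open>Suc n\<close>.\<close>

lemma truncated_product:
  fixes \<tau> a M E :: real and A B :: "nat \<Rightarrow> real"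
  assumes \<tau>: "0 \<le> \<tau>" "\<tau> \<le> 1" and M: "\<And>j. j \<le> n \<Longrightarrow> \<bar>A j\<bar> \<le> M" "\<And>j. j \<le> n \<Longrightarrow> \<bar>B j\<bar> \<le> M"
    and a: "\<bar>a - (\<Sum>j\<le>n. \<tau> ^ j * A j)\<bar> \<le> E * \<tau> ^ Suc n"
  shows "\<bar>a * (\<Sum>k\<le>n. \<tau> ^ k * B k) - (\<Sum>k\<le>n. \<tau> ^ k * (\<Sum>i\<le>k. A i * B (k - i)))\<bar>
    \<le> (E * (real (Suc n) * M) + (real (Suc n))\<^sup>2 * M\<^sup>2) * \<tau> ^ Suc n"
proof -
  define b where "b = (\<Sum>k\<le>n. \<tau> ^ k * B k)"
  define p where "p = (\<Sum>j\<le>n. \<tau> ^ j * A j)"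
  have M0: "0 \<le> M" using M(1)[of 0] by simp
  have \<tau>k: "0 \<le> \<tau> ^ k" "\<tau> ^ k \<le> 1" for k using \<tau> by (auto intro: power_le_one)
  have "\<bar>b\<bar> \<le> (\<Sum>k\<le>n. \<bar>\<tau> ^ k * B k\<bar>)" unfolding b_def by (rule sum_abs)
  also have "\<dots> \<le> (\<Sum>k\<le>n. M)"
  proof (rule sum_mono)
    fix k assume "k \<in> {..n}"
    then have "\<bar>\<tau> ^ k\<bar> * \<bar>B k\<bar> \<le> 1 * M" using M(2)[of k] \<tau>k[of k] by (intro mult_mono) auto
    then show "\<bar>\<tau> ^ k * B k\<bar> \<le> M" by (simp add: abs_mult)
  qed
  finally have b: "\<bar>b\<bar> \<le> real (Suc n) * M" by simp
  have 1: "\<bar>(a - p) * b\<bar> \<le> E * \<tau> ^ Suc n * (real (Suc n) * M)"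
    unfolding abs_mult using a b abs_ge_zero[of "a - p"] unfolding p_def by (intro mult_mono) (auto intro: order_trans)
  define g where "g = (\<lambda>(i, k). \<tau> ^ (i + k) * (A i * B k))"
  have tri: "(\<Sum>k\<le>n. \<tau> ^ k * (\<Sum>i\<le>k. A i * B (k - i))) = sum g {(i, k). i + k \<le> n}"
  proof -
    have "sum g {(i, k). i + k \<le> n} = (\<Sum>(i, k)\<in>{(i, k). i + k \<le> n}. \<tau> ^ (i + k) * (A i * B k))"
      by (simp add: g_def)
    also have "\<dots> = (\<Sum>k\<le>n. \<Sum>i\<le>k. \<tau> ^ (i + (k - i)) * (A i * B (k - i)))"
      by (rule sum.triangle_reindex_eq)
    also have "\<dots> = (\<Sum>k\<le>n. \<tau> ^ k * (\<Sum>i\<le>k. A i * B (k - i)))"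
      unfolding sum_distrib_left by (intro sum.cong refl) auto
    finally show ?thesis by simp
  qed
  have sq: "p * b = sum g ({..n} \<times> {..n})"
    unfolding p_def b_def g_def sum_product sum.cartesian_product
    by (intro sum.cong refl) (auto simp: power_add)
  have sub: "{(i, k). i + k \<le> n} \<subseteq> {..n} \<times> {..n}" by auto
  have "\<bar>p * b - sum g {(i, k). i + k \<le> n}\<bar> = \<bar>sum g ({..n} \<times> {..n} - {(i, k). i + k \<le> n})\<bar>"
    unfolding sq by (subst sum_diff[OF _ sub]) auto
  also have "\<dots> \<le> (\<Sum>x\<in>{..n} \<times> {..n} - {(i, k). i + k \<le> n}. \<bar>g x\<bar>)" by (rule sum_abs)
  also have "\<dots> \<le> (\<Sum>x\<in>{..n} \<times> {..n} - {(i, k). i + k \<le> n}. \<tau> ^ Suc n * (M * M))"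
  proof (rule sum_mono, clarsimp)
    fix i k assume ik: "i \<le> n" "k \<le> n" "\<not> i + k \<le> n"
    have "\<tau> ^ (i + k) \<le> \<tau> ^ Suc n" using \<tau> ik by (intro power_decreasing) auto
    then have "\<tau> ^ (i + k) * (\<bar>A i\<bar> * \<bar>B k\<bar>) \<le> \<tau> ^ Suc n * (M * M)"
      using M(1)[OF ik(1)] M(2)[OF ik(2)] M0 \<tau>k[of "Suc n"] by (intro mult_mono) auto
    then show "\<bar>g (i, k)\<bar> \<le> \<tau> * \<tau> ^ n * (M * M)"
      unfolding g_def using \<tau>k(1)[of "i + k"] by (simp add: abs_mult)
  qed
  also have "\<dots> \<le> (\<Sum>x\<in>{..n} \<times> {..n}. \<tau> ^ Suc n * (M * M))"
    using \<tau> by (intro sum_mono2) auto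
  also have "\<dots> = (real (Suc n))\<^sup>2 * M\<^sup>2 * \<tau> ^ Suc n"
    by (simp add: power2_eq_square card_cartesian_product algebra_simps)
  finally have 2: "\<bar>p * b - sum g {(i, k). i + k \<le> n}\<bar> \<le> (real (Suc n))\<^sup>2 * M\<^sup>2 * \<tau> ^ Suc n" .
  have "a * b - sum g {(i, k). i + k \<le> n} = (a - p) * b + (p * b - sum g {(i, k). i + k \<le> n})"
    by (simp add: algebra_simps)
  then have "\<bar>a * b - sum g {(i, k). i + k \<le> n}\<bar> \<le> \<bar>(a - p) * b\<bar> + \<bar>p * b - sum g {(i, k). i + k \<le> n}\<bar>"
    by (metis abs_triangle_ineq)
  also have "\<dots> \<le> E * \<tau> ^ Suc n * (real (Suc n) * M) + (real (Suc n))\<^sup>2 * M\<^sup>2 * \<tau> ^ Suc n"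
    by (rule add_mono[OF 1 2])
  also have "E * T * X + Y * T = (E * X + Y) * T" for T X Y :: real
    by (simp add: algebra_simps)
  finally show ?thesis unfolding tri b_def .
qed

lemma uniform_bound:
  fixes h :: "nat \<Rightarrow> 'a::topological_space \<Rightarrow> real"
  assumes "compact K" "\<And>j. j \<le> n \<Longrightarrow> continuous_on K (h j)"
  shows "\<exists>M\<ge>0. \<forall>j\<le>n. \<forall>x\<in>K. \<bar>h j x\<bar> \<le> M"
proof -
  have "\<exists>M. \<forall>x\<in>K. \<bar>h j x\<bar> \<le> M" if "j \<le> n" for j
  proof -
    have "bounded (h j ` K)" using assms that by (intro compact_imp_bounded compact_continuous_image) auto
    then show ?thesis by (auto simp: bounded_iff)
  qed
  then obtain M where M: "\<And>j x. j \<le> n \<Longrightarrow> x \<in> K \<Longrightarrow> \<bar>h j x\<bar> \<le> M j" by metis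
  have "\<bar>h j x\<bar> \<le> (\<Sum>j\<le>n. \<bar>M j\<bar>)" if "j \<le> n" "x \<in> K" for j x
  proof -
    have "\<bar>h j x\<bar> \<le> \<bar>M j\<bar>" using M[OF that] by linarith
    also have "\<dots> \<le> (\<Sum>j\<le>n. \<bar>M j\<bar>)" using that by (intro member_le_sum) auto
    finally show ?thesis .
  qed
  then show ?thesis by (intro exI[of _ "\<Sum>j\<le>n. \<bar>M j\<bar>"]) (auto intro: sum_nonneg)
qed

text \<open>Up to order \<open>n\<close> a single term survives: the coefficients with
  \<open>k < n\<close> vanish with all derivatives, and \<open>k = n\<close> leaves no power of the
  formal variable for a Taylor correction.\<close>

lemma formal_rhs_leading:
  assumes y: "y \<in> {0<..<\<R>} \<times> UNIV" and n: "1 \<le> n" and N: "N \<le> n"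
    and below: "\<forall>k\<in>{1..<n}. \<forall>y\<in>strip \<R>. L k y = 0"
  shows "fps_nth (formal_rhs \<R> L y a b) N = (if N = n then L n y else 0)"
proof -
  have X: "open ({0<..<\<R>} \<times> (UNIV :: real set))" "{0<..<\<R>} \<times> UNIV \<subseteq> strip \<R>"
    by (auto intro: open_Times)
  have lower: "fps_nth (formal_taylor \<R> (L k) y a b) i = 0" if "k \<in> {1..<n}" for k i
  proof -
    have "L k x = 0" if "x \<in> {0<..<\<R>} \<times> UNIV" for x
      using below \<open>k \<in> {1..<n}\<close> that X(2) by blast
    then show ?thesis
      by (simp add: formal_taylor_def pdiff_iterate_eq_0[OF X _ y])
  qed
  have "fps_nth (formal_rhs \<R> L y a b) N = (\<Sum>k=1..N. fps_nth (formal_taylor \<R> (L k) y a b) (N - k))"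
    unfolding formal_rhs_def fps_nth_Abs_fps
    by (intro sum.cong refl) (auto simp: fps_X_power_mult_nth)
  also have "\<dots> = (\<Sum>k=1..N. if k = n then L n y else 0)"
  proof (intro sum.cong refl)
    fix k assume k: "k \<in> {1..N}"
    show "fps_nth (formal_taylor \<R> (L k) y a b) (N - k) = (if k = n then L n y else 0)"
    proof (cases "k = n")
      case True
      \<comment> \<open>At order zero the double sum of \<open>formal_taylor\<close> has only the
        term \<open>i = j = 0\<close>, the value itself.\<close>
      then have "N - k = 0" using k N by simp
      then show ?thesis using True by (simp add: formal_taylor_def)
    next
      case False
      then show ?thesis using lower[of k] k N by auto
    qed
  qed
  also have "\<dots> = (if N = n then L n y else 0)" using n N by (auto simp: sum.delta)
  finally show ?thesis .
qed

text \<open>The time derivative carries the factor \<open>fps_X ^ (q + 1)\<close> and is invisible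
  up to order \<open>q\<close>.\<close>

lemma formal_transport_low_order:
  assumes "N \<le> q"
  shows "fps_nth (formal_transport \<R> q F G s W x) N =
    (\<Sum>i\<le>N. (if i = 0 then 0 else F i x) * pdiff (strip \<R>) (1, 0, 0) (W (N - i)) x)
    + (\<Sum>i\<le>N. (if i = 0 then 0 else G i x) * pdiff (strip \<R>) (0, 1, 0) (W (N - i)) x)
    + (\<Sum>i\<le>N. s i * pdiff (strip \<R>) (0, 0, 1) (W (N - i)) x)"
proof -
  have "fps_nth (fps_const (1 / real q) * fps_X ^ (q + 1) * fps_deriv (Abs_fps (\<lambda>k. W k x))) N = 0"
    using assms by (simp add: mult.assoc fps_X_power_mult_nth del: power_Suc)
  then show ?thesis
    by (simp add: formal_transport_def series_from_1_def fps_mult_nth atLeast0AtMost)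
qed

lemma powr_rate_power:
  assumes "0 < t"
  shows "t powr (- real k / real q) = (t powr (- 1 / real q)) ^ k"
  using assms by (simp add: powr_power)

section \<open>The system in resonance variables and its expansions\<close>

locale averaged_system =
  fixes \<omega> \<R> :: real and q :: nat and \<kappa> \<kappa>' :: int
    and S :: "real \<Rightarrow> real" and s :: "nat \<Rightarrow> real"
    and f g :: "real \<times> real \<times> real \<Rightarrow> real \<Rightarrow> real"
    and fc gc u v :: "nat \<Rightarrow> real \<times> real \<times> real \<Rightarrow> real"
    and \<Lambda> \<Omega> :: "nat \<Rightarrow> real \<times> real \<Rightarrow> real"
  assumes standing: "standing_assumptions \<omega> \<R> q \<kappa> \<kappa>' S s f g fc gc"
    and averaged: "averaged_coefficients \<R> q \<kappa> \<kappa>' s fc gc u v \<Lambda> \<Omega>"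
begin

abbreviation "c \<equiv> (of_int \<kappa> / of_int \<kappa>' :: real)"
abbreviation "P \<equiv> (2 * pi * of_int \<kappa>' :: real)"

text \<open>The right-hand side for the variables \<open>R = \<rho>\<close> and
  \<open>\<Psi> = \<phi> - c * S t\<close>.\<close>

definition "field t y = (f (fst y, c * S t + snd y, S t) t, \<omega> + g (fst y, c * S t + snd y, S t) t - c * deriv S t)"

text \<open>The value 0 at index 0 matches \<open>series_from_1\<close>, so that all sums start at
  index 0 like those over \<open>s\<close>.\<close>

definition "F i x = (if i = 0 then 0 else coeffs_F \<kappa> \<kappa>' fc i x)"
definition "G i x = (if i = 0 then 0 else coeffs_G \<kappa> \<kappa>' s gc i x)"

lemma q_pos: "0 < q" and s0_pos: "0 < s 0" and resonance: "of_int \<kappa> * s 0 = of_int \<kappa>' * \<omega>"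
  and coprime: "coprime \<kappa> \<kappa>'"
  using standing unfolding standing_assumptions_def by blast+

lemma kappa'_nonzero: "\<kappa>' \<noteq> 0"
proof
  assume "\<kappa>' = 0"
  then have "\<kappa> = 0" using resonance s0_pos by simp
  then show False using coprime \<open>\<kappa>' = 0\<close> by simp
qed

text \<open>Resonance in the form in which it acts: \<open>\<omega>\<close> cancels the leading term
  of \<open>c * deriv S\<close>, so that \<open>\<Psi>\<close> drifts slowly.\<close>

lemma frequency: "\<omega> = c * s 0"
  using resonance kappa'_nonzero by (simp add: field_simps)

lemma smooth:
  "smooth_on (strip \<R> \<times> {0<..}) (\<lambda>(x, t). f x t)" "smooth_on (strip \<R> \<times> {0<..}) (\<lambda>(x, t). g x t)"
  "1 \<le> k \<Longrightarrow> smooth_on (strip \<R>) (fc k)" "1 \<le> k \<Longrightarrow> smooth_on (strip \<R>) (gc k)" "smooth_on {0<..} S"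
  using standing unfolding standing_assumptions_def by blast+

lemma smooth_averaged:
  assumes "1 \<le> k"
  shows "smooth_on (strip \<R>) (u k)" "smooth_on (strip \<R>) (v k)" "smooth_on (strip \<R>) (\<Lambda> k)" "smooth_on (strip \<R>) (\<Omega> k)"
  using averaged assms unfolding averaged_coefficients_def by blast+

lemma periodic:
  assumes "\<rho> \<in> {0<..\<R>}" "0 < t"
  shows "f (\<rho>, \<phi> + 2 * pi, \<sigma>) t = f (\<rho>, \<phi>, \<sigma>) t" "f (\<rho>, \<phi>, \<sigma> + 2 * pi) t = f (\<rho>, \<phi>, \<sigma>) t"
    "g (\<rho>, \<phi> + 2 * pi, \<sigma>) t = g (\<rho>, \<phi>, \<sigma>) t" "g (\<rho>, \<phi>, \<sigma> + 2 * pi) t = g (\<rho>, \<phi>, \<sigma>) t"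
  using standing assms unfolding standing_assumptions_def by blast+

lemma periodic_averaged:
  assumes "1 \<le> k" "\<rho> \<in> {0<..\<R>}"
  shows "u k (\<rho>, \<Psi>, \<sigma> + P) = u k (\<rho>, \<Psi>, \<sigma>)" "v k (\<rho>, \<Psi>, \<sigma> + P) = v k (\<rho>, \<Psi>, \<sigma>)"
  using averaged assms unfolding averaged_coefficients_def by blast+

text \<open>As \<open>c * P\<close> equals \<open>2 * pi * \<kappa>\<close>, a shift of the phase by
  \<open>P\<close> moves both angular arguments by integer multiples of
  \<open>2 * pi\<close>.\<close>

lemma resonant_shift:
  assumes h: "\<And>\<phi> \<sigma>. h (\<phi> + 2 * pi) \<sigma> = h \<phi> \<sigma>" "\<And>\<phi> \<sigma>. h \<phi> (\<sigma> + 2 * pi) = h \<phi> (\<sigma> :: real)"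
  shows "h (c * (\<sigma> + of_int j * P) + \<Psi>) (\<sigma> + of_int j * P) = h (c * \<sigma> + \<Psi>) \<sigma>"
proof -
  have "c * (\<sigma> + of_int j * P) + \<Psi> = (c * \<sigma> + \<Psi>) + of_int (j * \<kappa>) * (2 * pi)"
    using kappa'_nonzero by (simp add: field_simps)
  moreover have "\<sigma> + of_int j * P = \<sigma> + of_int (j * \<kappa>') * (2 * pi)" by simp
  ultimately show ?thesis
    using periodic_int[where h="\<lambda>\<phi>. h \<phi> (\<sigma> + of_int j * P)", OF h(1)] periodic_int[where h="h (c * \<sigma> + \<Psi>)", OF h(2)]
    by metis
qed

text \<open>The absolute value on the right is there because \<open>\<kappa>'\<close>, and with it
  \<open>P\<close>, may be negative.\<close>

lemma reduced_phase: "\<bar>\<sigma> - of_int \<lfloor>\<sigma> / P\<rfloor> * P\<bar> \<le> \<bar>P\<bar>"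
proof -
  have P: "P \<noteq> 0" using kappa'_nonzero by simp
  have "\<sigma> - of_int \<lfloor>\<sigma> / P\<rfloor> * P = frac (\<sigma> / P) * P" using P by (simp add: frac_def left_diff_distrib)
  also have "\<bar>\<dots>\<bar> \<le> 1 * \<bar>P\<bar>"
    unfolding abs_mult using frac_lt_1[of "\<sigma> / P"] frac_ge_0[of "\<sigma> / P"] by (intro mult_right_mono) auto
  finally show ?thesis by simp
qed

lemma S_derivative: "0 < t \<Longrightarrow> (S has_real_derivative deriv S t) (at t)"
proof -
  assume t: "0 < t"
  have "at t within {0<..} = at t" using t by (intro at_within_open) auto
  then have "S differentiable (at t)"
    using smooth_on_has_derivative[OF smooth(5), of t] t unfolding differentiable_def by auto
  then show ?thesis by (simp add: DERIV_deriv_iff_real_differentiable)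
qed

lemma deriv_S_continuous: "continuous_on {0<..} (deriv S)"
proof -
  have "continuous_on {0<..} (pdiff {0<..} 1 S)"
    by (rule smooth_on_continuous[OF smooth_on_pdiff[OF smooth(5)]])
  moreover have "pdiff {0<..} 1 S t = deriv S t" if t: "t \<in> {0<..}" for t
  proof -
    have "at t within {0<..} = at t" using t by (intro at_within_open) auto
    moreover have "frechet_derivative S (at t) = (\<lambda>h. deriv S t * h)"
      using S_derivative t by (intro frechet_derivative_at[symmetric]) (simp add: has_field_derivative_def)
    ultimately show ?thesis by (simp add: pdiff_def)
  qed
  ultimately show ?thesis by (rule continuous_on_eq)
qed

lemma S_expansion:
  "\<exists>E\<ge>0. \<exists>T\<ge>1. \<forall>t\<ge>T. \<bar>deriv S t - (\<Sum>k\<le>N. (t powr (- 1 / real q)) ^ k * s k)\<bar> \<le> E * (t powr (- 1 / real q)) ^ Suc N"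
proof -
  have "(\<lambda>t. deriv S t - (\<Sum>k\<le>N. t powr (- real k / real q) * s k))
            \<in> O[at_top](\<lambda>t. t powr (- real (Suc N) / real q))"
    using standing unfolding standing_assumptions_def by blast
  then obtain E where E: "0 < E" "\<forall>\<^sub>F t in at_top. norm (deriv S t - (\<Sum>k\<le>N. t powr (- real k / real q) * s k))
            \<le> E * norm (t powr (- real (Suc N) / real q))"
    by (elim landau_o.bigE)
  then obtain T where T: "\<And>t. T \<le> t \<Longrightarrow> norm (deriv S t - (\<Sum>k\<le>N. t powr (- real k / real q) * s k))
            \<le> E * norm (t powr (- real (Suc N) / real q))" by (auto simp: eventually_at_top_linorder)
  have "\<bar>deriv S t - (\<Sum>k\<le>N. (t powr (- 1 / real q)) ^ k * s k)\<bar> \<le> E * (t powr (- 1 / real q)) ^ Suc N"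
    if t: "max 1 T \<le> t" for t
  proof -
    have t0: "0 < t" using t by simp
    show ?thesis
      using T[of t] t unfolding powr_rate_power[OF t0] by (simp del: of_nat_Suc power_Suc)
  qed
  then show ?thesis using E(1) by (intro exI[of _ E] conjI exI[of _ "max 1 T"]) auto
qed

text \<open>\<open>coeffs_F\<close> is the plain substitution of the resonant phase, so the
  statement also serves \<open>g\<close>, whose frequency terms are added separately.\<close>

lemma coefficient_expansion:
  assumes h: "has_expansion_on q (strip \<R>) h hc" and K: "compact K" "K \<subseteq> strip \<R>"
  shows "\<exists>E\<ge>0. \<exists>T\<ge>1. \<forall>t\<ge>T. \<forall>x\<in>K. \<bar>h (fst x, c * snd (snd x) + fst (snd x), snd (snd x)) t -
    (\<Sum>k\<le>N. (t powr (- 1 / real q)) ^ k * (if k = 0 then 0 else coeffs_F \<kappa> \<kappa>' hc k x))\<bar> \<le> E * (t powr (- 1 / real q)) ^ Suc N"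
proof -
  define A where "A = (\<lambda>x::real \<times> real \<times> real. (fst x, c * snd (snd x) + fst (snd x), snd (snd x)))"
  have "compact (A ` K)" unfolding A_def by (intro compact_continuous_image continuous_intros K)
  \<comment> \<open>The substitution \<open>A\<close> maps \<open>K\<close> to a compact subset of
    the strip, where the given expansion is uniform.\<close>
  moreover have "A ` K \<subseteq> strip \<R>" using K by (auto simp: A_def)
  ultimately obtain E where "\<forall>\<^sub>F t in at_top. \<forall>x\<in>A ` K.
           \<bar>h x t - (\<Sum>k=1..N. t powr (- real k / real q) * hc k x)\<bar> \<le> E * t powr (- real (Suc N) / real q)"
    using h unfolding has_expansion_on_def by blast
  then obtain T where T: "\<And>t x. T \<le> t \<Longrightarrow> x \<in> K \<Longrightarrow>
           \<bar>h (A x) t - (\<Sum>k=1..N. t powr (- real k / real q) * hc k (A x))\<bar> \<le> E * t powr (- real (Suc N) / real q)"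
    by (auto simp: eventually_at_top_linorder)
  have "\<bar>h (A x) t - (\<Sum>k\<le>N. (t powr (- 1 / real q)) ^ k * (if k = 0 then 0 else coeffs_F \<kappa> \<kappa>' hc k x))\<bar>
      \<le> max E 0 * (t powr (- 1 / real q)) ^ Suc N" if t: "max 1 T \<le> t" and x: "x \<in> K" for t x
  proof -
    have t0: "0 < t" using t by simp
    have "(\<Sum>k=1..N. t powr (- real k / real q) * hc k (A x)) =
      (\<Sum>k\<le>N. (t powr (- 1 / real q)) ^ k * (if k = 0 then 0 else coeffs_F \<kappa> \<kappa>' hc k x))"
      unfolding powr_rate_power[OF t0]
      by (intro sum.mono_neutral_cong_left) (auto simp: coeffs_F_def A_def case_prod_beta)
    then have "\<bar>h (A x) t - (\<Sum>k\<le>N. (t powr (- 1 / real q)) ^ k * (if k = 0 then 0 else coeffs_F \<kappa> \<kappa>' hc k x))\<bar>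
        \<le> E * t powr (- real (Suc N) / real q)" using T[of t x] t x by simp
    also have "\<dots> \<le> max E 0 * t powr (- real (Suc N) / real q)" by (intro mult_right_mono) auto
    finally show ?thesis by (simp only: powr_rate_power[OF t0])
  qed
  then show ?thesis unfolding A_def by (intro exI[of _ "max E 0"] conjI exI[of _ "max 1 T"]) auto
qed

lemma F_expansion:
  assumes K: "compact K" "K \<subseteq> strip \<R>"
  shows "\<exists>E\<ge>0. \<exists>T\<ge>1. \<forall>t\<ge>T. \<forall>x\<in>K. \<bar>f (fst x, c * snd (snd x) + fst (snd x), snd (snd x)) t -
    (\<Sum>k\<le>N. (t powr (- 1 / real q)) ^ k * F k x)\<bar> \<le> E * (t powr (- 1 / real q)) ^ Suc N"
proof -
  have "has_expansion_on q (strip \<R>) f fc" using standing unfolding standing_assumptions_def by blast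
  from coefficient_expansion[OF this K, of N] show ?thesis unfolding F_def .
qed

lemma G_expansion:
  assumes K: "compact K" "K \<subseteq> strip \<R>"
  shows "\<exists>E\<ge>0. \<exists>T\<ge>1. \<forall>t\<ge>T. \<forall>x\<in>K.
    \<bar>\<omega> + g (fst x, c * snd (snd x) + fst (snd x), snd (snd x)) t - c * deriv S t -
      (\<Sum>k\<le>N. (t powr (- 1 / real q)) ^ k * G k x)\<bar> \<le> E * (t powr (- 1 / real q)) ^ Suc N"
proof -
  have "has_expansion_on q (strip \<R>) g gc" using standing unfolding standing_assumptions_def by blast
  from coefficient_expansion[OF this K, of N] obtain E1 T1 where 1: "0 \<le> E1" "1 \<le> T1"
    "\<And>t x. T1 \<le> t \<Longrightarrow> x \<in> K \<Longrightarrow> \<bar>g (fst x, c * snd (snd x) + fst (snd x), snd (snd x)) t -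
    (\<Sum>k\<le>N. (t powr (- 1 / real q)) ^ k * (if k = 0 then 0 else coeffs_F \<kappa> \<kappa>' gc k x))\<bar> \<le> E1 * (t powr (- 1 / real q)) ^ Suc N"
    by blast
  from S_expansion[of N] obtain E2 T2 where 2: "0 \<le> E2" "1 \<le> T2"
    "\<And>t. T2 \<le> t \<Longrightarrow> \<bar>deriv S t - (\<Sum>k\<le>N. (t powr (- 1 / real q)) ^ k * s k)\<bar> \<le> E2 * (t powr (- 1 / real q)) ^ Suc N"
    by blast
  have "\<bar>\<omega> + g (fst x, c * snd (snd x) + fst (snd x), snd (snd x)) t - c * deriv S t -
      (\<Sum>k\<le>N. (t powr (- 1 / real q)) ^ k * G k x)\<bar> \<le> (E1 + \<bar>c\<bar> * E2) * (t powr (- 1 / real q)) ^ Suc N"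
    if t: "max T1 T2 \<le> t" and x: "x \<in> K" for t x
  proof -
    define \<tau> where "\<tau> = t powr (- 1 / real q)"
    define p where "p = (\<Sum>k\<le>N. \<tau> ^ k * (if k = 0 then 0 else coeffs_F \<kappa> \<kappa>' gc k x))"
    define r where "r = (\<Sum>k\<le>N. \<tau> ^ k * s k)"
    \<comment> \<open>\<open>G\<close> vanishes at index 0 while the expansion of
      \<open>c * deriv S\<close> begins with \<open>c * s 0\<close>; the last summand compensates
      for this and turns out to be \<open>\<omega>\<close>.\<close>
    have "(\<Sum>k\<le>N. \<tau> ^ k * G k x) = (\<Sum>k\<le>N. \<tau> ^ k * (if k = 0 then 0 else coeffs_F \<kappa> \<kappa>' gc k x)
        - c * (\<tau> ^ k * s k) + (if k = 0 then c * s 0 else 0))"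
      by (intro sum.cong refl) (auto simp: G_def coeffs_G_def coeffs_F_def case_prod_beta algebra_simps)
    also have "\<dots> = p - c * r + c * s 0"
      by (simp only: sum.distrib sum_subtractf p_def r_def sum_distrib_left) (simp add: sum.delta)
    finally have sumG: "(\<Sum>k\<le>N. \<tau> ^ k * G k x) = p - c * r + \<omega>" by (simp add: frequency)
    have "\<bar>g (fst x, c * snd (snd x) + fst (snd x), snd (snd x)) t - p\<bar> \<le> E1 * \<tau> ^ Suc N"
      using 1(3)[of t x] t x by (simp add: p_def \<tau>_def del: power_Suc)
    moreover have "\<bar>c * (deriv S t - r)\<bar> \<le> \<bar>c\<bar> * (E2 * \<tau> ^ Suc N)"
      unfolding abs_mult using 2(3)[of t] t by (intro mult_left_mono) (auto simp: r_def \<tau>_def simp del: power_Suc)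
    ultimately have "\<bar>(g (fst x, c * snd (snd x) + fst (snd x), snd (snd x)) t - p) - c * (deriv S t - r)\<bar>
        \<le> E1 * \<tau> ^ Suc N + \<bar>c\<bar> * (E2 * \<tau> ^ Suc N)" by (rule order_trans[OF abs_triangle_ineq4 add_mono])
    also have "\<dots> = (E1 + \<bar>c\<bar> * E2) * \<tau> ^ Suc N" by (simp only: distrib_right mult.assoc)
    also have "(g (fst x, c * snd (snd x) + fst (snd x), snd (snd x)) t - p) - c * (deriv S t - r) =
      \<omega> + g (fst x, c * snd (snd x) + fst (snd x), snd (snd x)) t - c * deriv S t - (\<Sum>k\<le>N. \<tau> ^ k * G k x)"
      unfolding sumG by (simp add: right_diff_distrib)
    finally show ?thesis unfolding \<tau>_def .
  qed
  then show ?thesis using 1(1,2) 2(1,2)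
    by (intro exI[of _ "E1 + \<bar>c\<bar> * E2"] conjI exI[of _ "max T1 T2"]) auto
qed

lemma coeffs_continuous:
  "continuous_on (strip \<R>) (F k)" "continuous_on (strip \<R>) (G k)"
proof -
  have *: "continuous_on (strip \<R>) (coeffs_F \<kappa> \<kappa>' hc k)" if "smooth_on (strip \<R>) (hc k)" for hc :: "nat \<Rightarrow> real \<times> real \<times> real \<Rightarrow> real"
  proof -
    have "continuous_on (strip \<R>) (hc k \<circ> (\<lambda>x. (fst x, c * snd (snd x) + fst (snd x), snd (snd x))))"
      by (intro continuous_on_compose continuous_on_subset[OF smooth_on_continuous[OF that]] continuous_intros) auto
    then show ?thesis by (simp add: coeffs_F_def o_def case_prod_beta)
  qed
  show "continuous_on (strip \<R>) (F k)"
    using *[of fc] smooth(3)[of k] by (cases "k = 0") (auto simp: F_def[abs_def])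
  have "coeffs_G \<kappa> \<kappa>' s gc k = (\<lambda>x. coeffs_F \<kappa> \<kappa>' gc k x - c * s k)"
    by (auto simp: coeffs_G_def coeffs_F_def)
  then show "continuous_on (strip \<R>) (G k)"
    using *[of gc] smooth(4)[of k] by (cases "k = 0") (auto simp: G_def[abs_def] intro!: continuous_intros)
qed

text \<open>
  Every value of \<open>S\<close> is first reduced modulo the period \<open>P\<close>, since only there are the expansions and
  the coefficients uniformly bounded.
\<close>

lemma near_identity_derivative:
  fixes W :: "nat \<Rightarrow> real \<times> real \<times> real \<Rightarrow> real" and L :: "real \<times> real \<Rightarrow> real"
  assumes r: "0 < \<rho>\<^sub>0 - r" "\<rho>\<^sub>0 + r < \<R>" and N: "N \<le> q"
    and W: "\<And>k x. k \<le> N \<Longrightarrow> x \<in> {0<..<\<R>} \<times> UNIV \<Longrightarrow> (W k has_derivative (\<lambda>e. pdiff (strip \<R>) e (W k) x)) (at x within strip \<R>)"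
      "\<And>k e. k \<le> N \<Longrightarrow> continuous_on ({0<..<\<R>} \<times> UNIV) (pdiff (strip \<R>) e (W k))"
      "\<And>k. k \<le> N \<Longrightarrow> continuous_on ({0<..<\<R>} \<times> UNIV) (W k)"
    and per: "\<And>k \<rho> \<Psi> \<sigma>. k \<le> N \<Longrightarrow> \<rho> \<in> {0<..\<R>} \<Longrightarrow> W k (\<rho>, \<Psi>, \<sigma> + P) = W k (\<rho>, \<Psi>, \<sigma>)"
    and ident: "\<And>k R \<Psi> \<sigma>. k \<le> N \<Longrightarrow> R \<in> {0<..<\<R>} \<Longrightarrow>
      fps_nth (formal_transport \<R> q (coeffs_F \<kappa> \<kappa>' fc) (coeffs_G \<kappa> \<kappa>' s gc) s W (R, \<Psi>, \<sigma>)) k = (if k = N then L (R, \<Psi>) else 0)"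
  shows "\<exists>C\<ge>0. \<exists>T\<ge>1. \<forall>J R \<Psi>. J \<subseteq> {T..} \<longrightarrow> solves2 field J R \<Psi> \<longrightarrow>
    (\<forall>t\<in>J. \<bar>R t - \<rho>\<^sub>0\<bar> \<le> r \<and> \<bar>\<Psi> t - \<phi>\<^sub>0\<bar> \<le> r) \<longrightarrow>
    (\<forall>t\<in>J. (\<exists>D. ((\<lambda>t. \<Sum>k\<le>N. t powr (- real k / real q) * W k (R t, \<Psi> t, S t)) has_real_derivative D) (at t within J) \<and>
        \<bar>D - t powr (- real N / real q) * L (R t, \<Psi> t)\<bar> \<le> C * t powr (- real (Suc N) / real q)) \<and>
      \<bar>(\<Sum>k\<le>N. t powr (- real k / real q) * W k (R t, \<Psi> t, S t)) - W 0 (R t, \<Psi> t, S t)\<bar> \<le> C * t powr (- 1 / real q))"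
proof -
  \<comment> \<open>The box around the equilibrium times at least one period of the phase: the
    compact set on which all constants are taken.\<close>
  define Q where "Q = {\<rho>\<^sub>0 - r..\<rho>\<^sub>0 + r} \<times> {\<phi>\<^sub>0 - r..\<phi>\<^sub>0 + r} \<times> {- \<bar>P\<bar>..\<bar>P\<bar>}"
  define B1 where "B1 = (\<lambda>k. pdiff (strip \<R>) (1, 0, 0) (W k))"
  define B2 where "B2 = (\<lambda>k. pdiff (strip \<R>) (0, 1, 0) (W k))"
  define B3 where "B3 = (\<lambda>k. pdiff (strip \<R>) (0, 0, 1) (W k))"
  have Q: "compact Q" unfolding Q_def by (intro compact_Times compact_Icc)
  have Qin: "Q \<subseteq> {0<..<\<R>} \<times> UNIV" and Qs: "Q \<subseteq> strip \<R>" using r by (auto simp: Q_def)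
  have bound: "\<exists>M\<ge>0. \<forall>j\<le>N. \<forall>x\<in>Q. \<bar>h j x\<bar> \<le> M"
    if "\<And>j. j \<le> N \<Longrightarrow> continuous_on X (h j)" "Q \<subseteq> X" for h :: "nat \<Rightarrow> real \<times> real \<times> real \<Rightarrow> real" and X
    by (rule uniform_bound[OF Q continuous_on_subset[OF that]])
  have "\<exists>M\<ge>0. \<forall>j\<le>N. \<forall>x\<in>Q. \<bar>B1 j x\<bar> \<le> M"
    unfolding B1_def by (rule bound[OF _ Qin]) (rule W(2))
  then obtain M1 where M1: "0 \<le> M1" "\<forall>j\<le>N. \<forall>x\<in>Q. \<bar>B1 j x\<bar> \<le> M1"
    by (elim exE conjE) (rule that)
  have "\<exists>M\<ge>0. \<forall>j\<le>N. \<forall>x\<in>Q. \<bar>B2 j x\<bar> \<le> M"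
    unfolding B2_def by (rule bound[OF _ Qin]) (rule W(2))
  then obtain M2 where M2: "0 \<le> M2" "\<forall>j\<le>N. \<forall>x\<in>Q. \<bar>B2 j x\<bar> \<le> M2"
    by (elim exE conjE) (rule that)
  have "\<exists>M\<ge>0. \<forall>j\<le>N. \<forall>x\<in>Q. \<bar>B3 j x\<bar> \<le> M"
    unfolding B3_def by (rule bound[OF _ Qin]) (rule W(2))
  then obtain M3 where M3: "0 \<le> M3" "\<forall>j\<le>N. \<forall>x\<in>Q. \<bar>B3 j x\<bar> \<le> M3"
    by (elim exE conjE) (rule that)
  have "\<exists>M\<ge>0. \<forall>j\<le>N. \<forall>x\<in>Q. \<bar>W j x\<bar> \<le> M"
    by (rule bound[OF _ Qin]) (rule W(3))
  then obtain M4 where M4: "0 \<le> M4" "\<forall>j\<le>N. \<forall>x\<in>Q. \<bar>W j x\<bar> \<le> M4"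
    by (elim exE conjE) (rule that)
  have "\<exists>M\<ge>0. \<forall>j\<le>N. \<forall>x\<in>Q. \<bar>F j x\<bar> \<le> M"
    by (rule bound[OF _ Qs]) (rule coeffs_continuous(1))
  then obtain M5 where M5: "0 \<le> M5" "\<forall>j\<le>N. \<forall>x\<in>Q. \<bar>F j x\<bar> \<le> M5"
    by (elim exE conjE) (rule that)
  have "\<exists>M\<ge>0. \<forall>j\<le>N. \<forall>x\<in>Q. \<bar>G j x\<bar> \<le> M"
    by (rule bound[OF _ Qs]) (rule coeffs_continuous(2))
  then obtain M6 where M6: "0 \<le> M6" "\<forall>j\<le>N. \<forall>x\<in>Q. \<bar>G j x\<bar> \<le> M6"
    by (elim exE conjE) (rule that)
  have "\<exists>M\<ge>0. \<forall>j\<le>N. \<forall>x\<in>Q. \<bar>s j\<bar> \<le> M"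
    by (rule bound[OF _ subset_UNIV]) (rule continuous_on_const)
  then obtain M7 where M7: "0 \<le> M7" "\<forall>j\<le>N. \<forall>x\<in>Q. \<bar>s j\<bar> \<le> M7"
    by (elim exE conjE) (rule that)
  define M where "M = M1 + M2 + M3 + M4 + M5 + M6 + M7"
  have M0: "0 \<le> M" using M1 M2 M3 M4 M5 M6 M7 by (simp add: M_def)
  have M: "\<bar>B1 j x\<bar> \<le> M" "\<bar>B2 j x\<bar> \<le> M" "\<bar>B3 j x\<bar> \<le> M" "\<bar>W j x\<bar> \<le> M" "\<bar>F j x\<bar> \<le> M" "\<bar>G j x\<bar> \<le> M" "\<bar>s j\<bar> \<le> M"
    if "j \<le> N" "x \<in> Q" for j x
  proof -
    have "M1 \<le> M" "M2 \<le> M" "M3 \<le> M" "M4 \<le> M" "M5 \<le> M" "M6 \<le> M" "M7 \<le> M"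
      unfolding M_def using M1(1) M2(1) M3(1) M4(1) M5(1) M6(1) M7(1) by linarith+
    note le = this
    show "\<bar>B1 j x\<bar> \<le> M" by (rule order_trans[OF M1(2)[rule_format, OF that] le(1)])
    show "\<bar>B2 j x\<bar> \<le> M" by (rule order_trans[OF M2(2)[rule_format, OF that] le(2)])
    show "\<bar>B3 j x\<bar> \<le> M" by (rule order_trans[OF M3(2)[rule_format, OF that] le(3)])
    show "\<bar>W j x\<bar> \<le> M" by (rule order_trans[OF M4(2)[rule_format, OF that] le(4)])
    show "\<bar>F j x\<bar> \<le> M" by (rule order_trans[OF M5(2)[rule_format, OF that] le(5)])
    show "\<bar>G j x\<bar> \<le> M" by (rule order_trans[OF M6(2)[rule_format, OF that] le(6)])
    show "\<bar>s j\<bar> \<le> M" by (rule order_trans[OF M7(2)[rule_format, OF that] le(7)])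
  qed
  obtain E1 T1 where E1: "0 \<le> E1" "1 \<le> T1" "\<And>t x. T1 \<le> t \<Longrightarrow> x \<in> Q \<Longrightarrow>
      \<bar>f (fst x, c * snd (snd x) + fst (snd x), snd (snd x)) t - (\<Sum>k\<le>N. (t powr (- 1 / real q)) ^ k * F k x)\<bar> \<le> E1 * (t powr (- 1 / real q)) ^ Suc N"
    using F_expansion[OF Q Qs, of N] by blast
  obtain E2 T2 where E2: "0 \<le> E2" "1 \<le> T2" "\<And>t x. T2 \<le> t \<Longrightarrow> x \<in> Q \<Longrightarrow>
      \<bar>\<omega> + g (fst x, c * snd (snd x) + fst (snd x), snd (snd x)) t - c * deriv S t - (\<Sum>k\<le>N. (t powr (- 1 / real q)) ^ k * G k x)\<bar> \<le> E2 * (t powr (- 1 / real q)) ^ Suc N"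
    using G_expansion[OF Q Qs, of N] by blast
  obtain E3 T3 where E3: "0 \<le> E3" "1 \<le> T3" "\<And>t. T3 \<le> t \<Longrightarrow>
      \<bar>deriv S t - (\<Sum>k\<le>N. (t powr (- 1 / real q)) ^ k * s k)\<bar> \<le> E3 * (t powr (- 1 / real q)) ^ Suc N"
    using S_expansion[of N] by blast
  define n1 where "n1 = real (Suc N)"
  define K where "K = (\<lambda>E. E * (n1 * M) + n1\<^sup>2 * M\<^sup>2)"
  \<comment> \<open>The three product errors, the derivatives of the powers of \<open>t\<close>, and
    the distance of the transformation from the identity.\<close>
  define C where "C = K E1 + K E2 + K E3 + n1 * (real N / real q * M) + n1 * M"
  define T where "T = max T1 (max T2 T3)"
  have n1: "0 \<le> n1" by (simp add: n1_def)
  have K0: "0 \<le> K E" if "0 \<le> E" for E using that M0 n1 by (simp add: K_def)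
  have C0: "0 \<le> C" using K0[OF E1(1)] K0[OF E2(1)] K0[OF E3(1)] M0 n1 by (simp add: C_def)
  have T: "1 \<le> T" using E1(2) by (simp add: T_def)
  show ?thesis
  proof (rule exI[of _ C], rule conjI[OF C0], rule exI[of _ T], rule conjI[OF T], intro allI impI ballI)
    fix J t and R \<Psi> :: "real \<Rightarrow> real"
    assume J: "J \<subseteq> {T..}" and sol: "solves2 field J R \<Psi>"
      and near: "\<forall>t\<in>J. \<bar>R t - \<rho>\<^sub>0\<bar> \<le> r \<and> \<bar>\<Psi> t - \<phi>\<^sub>0\<bar> \<le> r" and t: "t \<in> J"
    have "T \<le> t" using J t by auto
    then have tT: "1 \<le> t" "T1 \<le> t" "T2 \<le> t" "T3 \<le> t"
      using order_trans[OF T] by (simp_all add: T_def)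
    then have t0: "0 < t" by simp
    define \<tau> where "\<tau> = t powr (- 1 / real q)"
    have \<tau>: "0 \<le> \<tau>" "\<tau> \<le> 1" using powr_mono[of "- 1 / real q" 0 t] tT(1) by (auto simp: \<tau>_def)
    have \<tau>k: "t powr (- real k / real q) = \<tau> ^ k" for k
      unfolding \<tau>_def by (rule powr_rate_power[OF t0])
    have RJ: "R t' \<in> {0<..<\<R>}" if "t' \<in> J" for t'
      using near[rule_format, OF that] r by (auto simp: abs_le_iff)
    \<comment> \<open>The number of periods is frozen at the instant considered, so subtracting
      \<open>of_int j * P\<close> from \<open>S\<close> does not affect derivatives.\<close>
    define j where "j = \<lfloor>S t / P\<rfloor>"
    define \<sigma> where "\<sigma> = S t - of_int j * P"
    define x where "x = (R t, \<Psi> t, \<sigma>)"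
    have "\<bar>\<sigma>\<bar> \<le> \<bar>P\<bar>" unfolding \<sigma>_def j_def by (rule reduced_phase)
    then have x: "x \<in> Q" using near[rule_format, OF t] by (auto simp: x_def Q_def abs_le_iff)
    have xin: "x \<in> {0<..<\<R>} \<times> UNIV" using x Qin by blast
    have Sj: "S t = \<sigma> + of_int j * P" by (simp add: \<sigma>_def)
    have Rt: "R t \<in> {0<..\<R>}" using RJ[OF t] by auto
    define a1 where "a1 = f (R t, c * \<sigma> + \<Psi> t, \<sigma>) t"
    define a2 where "a2 = \<omega> + g (R t, c * \<sigma> + \<Psi> t, \<sigma>) t - c * deriv S t"
    define a3 where "a3 = deriv S t"
    have "f (R t, c * S t + \<Psi> t, S t) t = a1" "\<omega> + g (R t, c * S t + \<Psi> t, S t) t - c * deriv S t = a2"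
      unfolding Sj a1_def a2_def
      using resonant_shift[of "\<lambda>\<phi> \<sigma>. f (R t, \<phi>, \<sigma>) t", OF periodic(1,2)[OF Rt t0]]
        resonant_shift[of "\<lambda>\<phi> \<sigma>. g (R t, \<phi>, \<sigma>) t", OF periodic(3,4)[OF Rt t0]] by simp_all
    then have R': "(R has_real_derivative a1) (at t within J)" and \<Psi>': "(\<Psi> has_real_derivative a2) (at t within J)"
      using sol t by (auto simp: solves2_def field_def)
    have S': "((\<lambda>t. S t - of_int j * P) has_real_derivative a3) (at t within J)"
      using DERIV_subset[OF S_derivative[OF t0]] unfolding a3_def by (auto intro!: derivative_eq_intros)
    define \<gamma> where "\<gamma> = (\<lambda>t. (R t, \<Psi> t, S t - of_int j * P))"
    have \<gamma>': "(\<gamma> has_vector_derivative (a1, a2, a3)) (at t within J)"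
      unfolding \<gamma>_def using R' \<Psi>' S' by (intro has_vector_derivative_Pair) (auto simp: has_real_derivative_iff_has_vector_derivative)
    have \<gamma>t: "\<gamma> t = x" by (simp add: \<gamma>_def x_def \<sigma>_def)
    have "R t' \<in> {0<..\<R>}" if "t' \<in> J" for t' using RJ[OF that] by simp
    then have \<gamma>J: "\<gamma> ` J \<subseteq> strip \<R>" unfolding \<gamma>_def by blast
    have W': "((\<lambda>t. W k (\<gamma> t)) has_real_derivative a1 * B1 k x + a2 * B2 k x + a3 * B3 k x) (at t within J)" if k: "k \<le> N" for k
    proof -
      have d: "(W k has_derivative (\<lambda>e. pdiff (strip \<R>) e (W k) x)) (at (\<gamma> t) within \<gamma> ` J)"
        unfolding \<gamma>t by (rule has_derivative_subset[OF W(1)[OF k xin] \<gamma>J])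
      have "((W k \<circ> \<gamma>) has_vector_derivative pdiff (strip \<R>) (a1, a2, a3) (W k) x) (at t within J)"
        by (rule vector_derivative_diff_chain_within[OF \<gamma>' d])
      moreover have "pdiff (strip \<R>) (a1, a2, a3) (W k) x = a1 * B1 k x + a2 * B2 k x + a3 * B3 k x"
      proof -
        have lin: "linear (\<lambda>e. pdiff (strip \<R>) e (W k) x)" by (rule has_derivative_linear[OF d])
        have "(a1, a2, a3) = a1 *\<^sub>R (1, 0, 0) + (a2 *\<^sub>R (0, 1, 0) + a3 *\<^sub>R (0, 0, 1))" by simp
        then have "pdiff (strip \<R>) (a1, a2, a3) (W k) x =
          pdiff (strip \<R>) (a1 *\<^sub>R (1, 0, 0) + (a2 *\<^sub>R (0, 1, 0) + a3 *\<^sub>R (0, 0, 1))) (W k) x" by (rule arg_cong)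
        also have "\<dots> = a1 * B1 k x + (a2 * B2 k x + a3 * B3 k x)"
          unfolding linear_add[OF lin] linear_scale[OF lin] by (simp add: B1_def B2_def B3_def)
        finally show ?thesis by simp
      qed
      ultimately show ?thesis by (simp add: o_def has_real_derivative_iff_has_vector_derivative)
    qed
    \<comment> \<open>Periodicity undoes the reduction with the same \<open>j\<close> at all times
      in \<open>J\<close>, so the two curves give the same function of time.\<close>
    have WS: "W k (R t', \<Psi> t', S t') = W k (\<gamma> t')" if "k \<le> N" "t' \<in> J" for k t'
    proof -
      have "R t' \<in> {0<..\<R>}" using RJ[OF that(2)] by auto
      from periodic_int[where h = "\<lambda>\<sigma>. W k (R t', \<Psi> t', \<sigma>)", OF per[OF that(1) this], of "S t' - of_int j * P" j]
      show ?thesis by (simp add: \<gamma>_def)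
    qed
    \<comment> \<open>The part of the derivative that comes from the powers of
      \<open>t\<close>.\<close>
    define X where "X = (\<Sum>k\<le>N. - real k / real q * t powr (- real k / real q - 1) * W k x)"
    define D where "D = a1 * (\<Sum>k\<le>N. \<tau> ^ k * B1 k x) + a2 * (\<Sum>k\<le>N. \<tau> ^ k * B2 k x) + a3 * (\<Sum>k\<le>N. \<tau> ^ k * B3 k x) + X"
    have "((\<lambda>t. \<Sum>k\<le>N. t powr (- real k / real q) * W k (\<gamma> t)) has_real_derivative
        (\<Sum>k\<le>N. - real k / real q * t powr (- real k / real q - 1) * W k x
          + (a1 * B1 k x + a2 * B2 k x + a3 * B3 k x) * t powr (- real k / real q))) (at t within J)"
    proof (rule DERIV_sum)
      fix k assume "k \<in> {..N}"
      then have k: "k \<le> N" by simp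
      have "((\<lambda>t. t powr (- real k / real q)) has_real_derivative - real k / real q * t powr (- real k / real q - 1)) (at t within J)"
        by (rule has_field_derivative_at_within[OF has_real_derivative_powr[OF t0]])
      from DERIV_mult[OF this W'[OF k]]
      show "((\<lambda>t. t powr (- real k / real q) * W k (\<gamma> t)) has_real_derivative
          - real k / real q * t powr (- real k / real q - 1) * W k x
          + (a1 * B1 k x + a2 * B2 k x + a3 * B3 k x) * t powr (- real k / real q)) (at t within J)"
        by (simp only: \<gamma>t)
    qed
    also have "(\<Sum>k\<le>N. - real k / real q * t powr (- real k / real q - 1) * W k x
          + (a1 * B1 k x + a2 * B2 k x + a3 * B3 k x) * t powr (- real k / real q)) = D"
      unfolding D_def X_def \<tau>k sum_distrib_left sum.distrib[symmetric]
      by (intro sum.cong refl) (simp add: algebra_simps)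
    finally have "((\<lambda>t. \<Sum>k\<le>N. t powr (- real k / real q) * W k (\<gamma> t)) has_real_derivative D) (at t within J)" .
    then have deriv: "((\<lambda>t. \<Sum>k\<le>N. t powr (- real k / real q) * W k (R t, \<Psi> t, S t)) has_real_derivative D) (at t within J)"
      by (rule has_field_derivative_transform_within[OF _ zero_less_one t]) (simp add: WS)
    have e1: "\<bar>a1 - (\<Sum>k\<le>N. \<tau> ^ k * F k x)\<bar> \<le> E1 * \<tau> ^ Suc N"
      using E1(3)[OF tT(2) x] unfolding a1_def \<tau>_def by (simp add: x_def del: power_Suc)
    have e2: "\<bar>a2 - (\<Sum>k\<le>N. \<tau> ^ k * G k x)\<bar> \<le> E2 * \<tau> ^ Suc N"
      using E2(3)[OF tT(3) x] unfolding a2_def \<tau>_def by (simp add: x_def del: power_Suc)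
    have e3: "\<bar>a3 - (\<Sum>k\<le>N. \<tau> ^ k * s k)\<bar> \<le> E3 * \<tau> ^ Suc N"
      using E3(3)[OF tT(4)] unfolding a3_def \<tau>_def .
    define Z1 where "Z1 = (\<Sum>k\<le>N. \<tau> ^ k * (\<Sum>i\<le>k. F i x * B1 (k - i) x))"
    define Z2 where "Z2 = (\<Sum>k\<le>N. \<tau> ^ k * (\<Sum>i\<le>k. G i x * B2 (k - i) x))"
    define Z3 where "Z3 = (\<Sum>k\<le>N. \<tau> ^ k * (\<Sum>i\<le>k. s i * B3 (k - i) x))"
    have p1: "\<bar>a1 * (\<Sum>k\<le>N. \<tau> ^ k * B1 k x) - Z1\<bar> \<le> K E1 * \<tau> ^ Suc N"
      unfolding Z1_def K_def n1_def
      by (rule truncated_product[where A = "\<lambda>k. F k x" and B = "\<lambda>k. B1 k x", OF \<tau> M(5)[OF _ x] M(1)[OF _ x] e1])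
    have p2: "\<bar>a2 * (\<Sum>k\<le>N. \<tau> ^ k * B2 k x) - Z2\<bar> \<le> K E2 * \<tau> ^ Suc N"
      unfolding Z2_def K_def n1_def
      by (rule truncated_product[where A = "\<lambda>k. G k x" and B = "\<lambda>k. B2 k x", OF \<tau> M(6)[OF _ x] M(2)[OF _ x] e2])
    have p3: "\<bar>a3 * (\<Sum>k\<le>N. \<tau> ^ k * B3 k x) - Z3\<bar> \<le> K E3 * \<tau> ^ Suc N"
      unfolding Z3_def K_def n1_def
      by (rule truncated_product[where A = s and B = "\<lambda>k. B3 k x", OF \<tau> M(7)[OF _ x] M(3)[OF _ x] e3])
    \<comment> \<open>The Cauchy coefficients are those of the formal transport, so the formal
      identities leave only order \<open>N\<close>.\<close>
    have Z: "Z1 + Z2 + Z3 = \<tau> ^ N * L (R t, \<Psi> t)"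
    proof -
      have "Z1 + Z2 + Z3 = (\<Sum>k\<le>N. \<tau> ^ k * ((\<Sum>i\<le>k. F i x * B1 (k - i) x) + (\<Sum>i\<le>k. G i x * B2 (k - i) x) + (\<Sum>i\<le>k. s i * B3 (k - i) x)))"
        unfolding Z1_def Z2_def Z3_def by (simp only: sum.distrib distrib_left)
      also have "\<dots> = (\<Sum>k\<le>N. \<tau> ^ k * (if k = N then L (R t, \<Psi> t) else 0))"
      proof (intro sum.cong refl arg_cong[where f = "\<lambda>y. \<tau> ^ _ * y"])
        fix k assume "k \<in> {..N}"
        then have k: "k \<le> N" by simp
        have "(\<Sum>i\<le>k. F i x * B1 (k - i) x) + (\<Sum>i\<le>k. G i x * B2 (k - i) x) + (\<Sum>i\<le>k. s i * B3 (k - i) x) =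
          fps_nth (formal_transport \<R> q (coeffs_F \<kappa> \<kappa>' fc) (coeffs_G \<kappa> \<kappa>' s gc) s W x) k"
          unfolding formal_transport_low_order[OF order_trans[OF k N]] F_def G_def B1_def B2_def B3_def ..
        also have "\<dots> = (if k = N then L (R t, \<Psi> t) else 0)"
          unfolding x_def by (rule ident[OF k RJ[OF t]])
        finally show "(\<Sum>i\<le>k. F i x * B1 (k - i) x) + (\<Sum>i\<le>k. G i x * B2 (k - i) x) + (\<Sum>i\<le>k. s i * B3 (k - i) x)
          = (if k = N then L (R t, \<Psi> t) else 0)" .
      qed
      also have "\<dots> = \<tau> ^ N * L (R t, \<Psi> t)" by (simp add: if_distrib[of "\<lambda>y. _ * y"] sum.delta cong: if_cong)
      finally show ?thesis .
    qed
    have X: "\<bar>X\<bar> \<le> n1 * (real N / real q * M) * \<tau> ^ Suc N"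
    proof -
      have "\<bar>X\<bar> \<le> (\<Sum>k\<le>N. \<bar>- real k / real q * t powr (- real k / real q - 1) * W k x\<bar>)"
        unfolding X_def by (rule sum_abs)
      also have "\<dots> \<le> (\<Sum>k\<le>N. real N / real q * \<tau> ^ Suc N * M)"
      proof (rule sum_mono)
        fix k assume "k \<in> {..N}"
        then have k: "k \<le> N" by simp
        show "\<bar>- real k / real q * t powr (- real k / real q - 1) * W k x\<bar> \<le> real N / real q * \<tau> ^ Suc N * M"
        proof (cases "k = 0")
          case True
          then show ?thesis using M0 \<tau> by simp
        next
          case False
          \<comment> \<open>Differentiating \<open>t powr (- k / q)\<close> gains a factor
            \<open>1 / t\<close>, that is \<open>q\<close> further orders; for \<open>k >= 1\<close>
            and \<open>N <= q\<close> this reaches order \<open>N + 1\<close>, and for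
            \<open>k = 0\<close> the term is zero.\<close>
          have "real (Suc N) \<le> real k + real q" using False N by linarith
          then have "real (Suc N) / real q \<le> (real k + real q) / real q" by (rule divide_right_mono) simp
          then have "real (Suc N) / real q \<le> real k / real q + 1"
            using q_pos by (simp add: add_divide_distrib del: of_nat_Suc)
          then have "- real k / real q - 1 \<le> - real (Suc N) / real q" by (simp del: of_nat_Suc)
          then have "t powr (- real k / real q - 1) \<le> \<tau> ^ Suc N"
            unfolding \<tau>k[symmetric] using tT(1) by (intro powr_mono)
          moreover have "\<bar>- real k / real q\<bar> \<le> real N / real q" using k q_pos by (simp add: divide_right_mono)
          ultimately have "\<bar>- real k / real q\<bar> * t powr (- real k / real q - 1) * \<bar>W k x\<bar> \<le> real N / real q * \<tau> ^ Suc N * M"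
            using M(4)[OF k x] \<tau> by (intro mult_mono) auto
          then show ?thesis by (simp add: abs_mult)
        qed
      qed
      also have "\<dots> = n1 * (real N / real q * M) * \<tau> ^ Suc N" by (simp add: n1_def)
      finally show ?thesis .
    qed
    have "\<bar>D - \<tau> ^ N * L (R t, \<Psi> t)\<bar> \<le> K E1 * \<tau> ^ Suc N + K E2 * \<tau> ^ Suc N + K E3 * \<tau> ^ Suc N + n1 * (real N / real q * M) * \<tau> ^ Suc N"
    proof -
      have tri: "\<bar>(q1 + q2 + q3 + q4) - (z1 + z2 + z3)\<bar> \<le> w1 + w2 + w3 + w4"
        if "\<bar>q1 - z1\<bar> \<le> w1" "\<bar>q2 - z2\<bar> \<le> w2" "\<bar>q3 - z3\<bar> \<le> w3" "\<bar>q4\<bar> \<le> w4" for q1 q2 q3 q4 z1 z2 z3 w1 w2 w3 w4 :: real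
        using that by linarith
      show ?thesis unfolding D_def Z[symmetric] by (rule tri[OF p1 p2 p3 X])
    qed
    also have "\<dots> = (K E1 + K E2 + K E3 + n1 * (real N / real q * M)) * \<tau> ^ Suc N" by (simp only: distrib_right)
    also have "\<dots> \<le> C * \<tau> ^ Suc N"
      unfolding C_def using M0 n1 \<tau> by (intro mult_right_mono) auto
    finally have lead: "\<bar>D - t powr (- real N / real q) * L (R t, \<Psi> t)\<bar> \<le> C * t powr (- real (Suc N) / real q)"
      by (simp only: \<tau>k)
    have "(\<Sum>k\<le>N. t powr (- real k / real q) * W k (R t, \<Psi> t, S t)) - W 0 (R t, \<Psi> t, S t) = (\<Sum>k\<in>{..N} - {0}. \<tau> ^ k * W k x)"
    proof -
      have "(\<Sum>k\<le>N. t powr (- real k / real q) * W k (R t, \<Psi> t, S t)) = (\<Sum>k\<le>N. \<tau> ^ k * W k x)"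
        unfolding \<tau>k by (intro sum.cong refl) (simp add: WS[OF _ t] \<gamma>t)
      also have "\<dots> = W 0 x + (\<Sum>k\<in>{..N} - {0}. \<tau> ^ k * W k x)" by (subst sum.remove[of _ 0]) auto
      finally show ?thesis using WS[OF _ t, of 0] \<gamma>t by simp
    qed
    also have "\<bar>\<dots>\<bar> \<le> (\<Sum>k\<in>{..N} - {0}. \<bar>\<tau> ^ k * W k x\<bar>)" by (rule sum_abs)
    also have "\<dots> \<le> (\<Sum>k\<in>{..N} - {0}. \<tau> * M)"
    proof (rule sum_mono)
      fix k assume k: "k \<in> {..N} - {0}"
      have "\<tau> ^ k \<le> \<tau> ^ 1" using \<tau> k by (intro power_decreasing) auto
      then have "\<bar>\<tau> ^ k\<bar> * \<bar>W k x\<bar> \<le> \<tau> * M" using M(4)[OF _ x, of k] k \<tau> by (intro mult_mono) auto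
      then show "\<bar>\<tau> ^ k * W k x\<bar> \<le> \<tau> * M" by (simp add: abs_mult)
    qed
    also have "\<dots> \<le> (\<Sum>k\<le>N. \<tau> * M)" using \<tau> M0 by (intro sum_mono2) auto
    also have "\<dots> = n1 * M * \<tau>" by (simp add: n1_def)
    also have "\<dots> \<le> C * \<tau>"
      unfolding C_def using K0[OF E1(1)] K0[OF E2(1)] K0[OF E3(1)] M0 n1 \<tau> by (intro mult_right_mono) auto
    finally have "\<bar>(\<Sum>k\<le>N. t powr (- real k / real q) * W k (R t, \<Psi> t, S t)) - W 0 (R t, \<Psi> t, S t)\<bar> \<le> C * t powr (- 1 / real q)"
      unfolding \<tau>_def .
    then show "(\<exists>D. ((\<lambda>t. \<Sum>k\<le>N. t powr (- real k / real q) * W k (R t, \<Psi> t, S t)) has_real_derivative D) (at t within J) \<and>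
        \<bar>D - t powr (- real N / real q) * L (R t, \<Psi> t)\<bar> \<le> C * t powr (- real (Suc N) / real q)) \<and>
      \<bar>(\<Sum>k\<le>N. t powr (- real k / real q) * W k (R t, \<Psi> t, S t)) - W 0 (R t, \<Psi> t, S t)\<bar> \<le> C * t powr (- 1 / real q)"
      using deriv lead by blast
  qed
qed

end

section \<open>The averaged equilibrium\<close>

text \<open>For the coordinate functions that occupy index 0 of the transformation.\<close>

lemma pdiff_linear:
  fixes h :: "'a::real_normed_vector \<Rightarrow> real"
  assumes X: "open X" "X \<subseteq> A" "x \<in> X" and h: "bounded_linear h"
  shows "pdiff A e h x = h e"
proof -
  have "at x within A = at x" using X by (intro at_within_interior) (meson interiorI)
  moreover have "frechet_derivative h (at x) = h"
    by (rule frechet_derivative_at[symmetric]) (rule bounded_linear_imp_has_derivative[OF h])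
  ultimately show ?thesis by (simp add: pdiff_def)
qed

text \<open>\<open>e\<close> collects the remainder of averaging divided by the rate, the
  linearization error, and the effect of replacing the deviation \<open>(X, Y)\<close> by
  \<open>(x, y)\<close>. Expressing the linearization error through \<open>(x, y)\<close> gives the
  term \<open>2 * \<mu>\<close>.\<close>

lemma leading_error:
  fixes a D Z X Y x y \<mu> C \<tau> l \<nu> :: real
  assumes a: "0 < a" and D: "\<bar>D - a * Z\<bar> \<le> C * (a * \<tau>)"
    and Z: "\<bar>Z - (l * X + \<nu> * Y)\<bar> \<le> \<mu> * (\<bar>X\<bar> + \<bar>Y\<bar>)"
    and x: "\<bar>x - X\<bar> \<le> C * \<tau>" and y: "\<bar>y - Y\<bar> \<le> C * \<tau>" and \<mu>: "0 \<le> \<mu>"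
  shows "\<exists>e. D = a * (l * x + \<nu> * y + e) \<and> \<bar>e\<bar> \<le> \<mu> * (\<bar>x\<bar> + \<bar>y\<bar>) + C * \<tau> * (1 + 2 * \<mu> + \<bar>l\<bar> + \<bar>\<nu>\<bar>)"
proof (intro exI conjI)
  define e1 where "e1 = D / a - Z"
  define e2 where "e2 = Z - (l * X + \<nu> * Y)"
  let ?e = "e1 + e2 + l * (X - x) + \<nu> * (Y - y)"
  show "D = a * (l * x + \<nu> * y + ?e)" using a by (simp add: e1_def e2_def field_simps)
  have "e1 = (D - a * Z) / a" using a by (simp add: e1_def diff_divide_distrib)
  then have "\<bar>e1\<bar> = \<bar>D - a * Z\<bar> / a" using a by (simp add: abs_divide)
  also have "\<dots> \<le> C * (a * \<tau>) / a" using a by (intro divide_right_mono D) auto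
  finally have e1: "\<bar>e1\<bar> \<le> C * \<tau>" using a by simp
  have "\<bar>X\<bar> \<le> \<bar>x\<bar> + C * \<tau>" "\<bar>Y\<bar> \<le> \<bar>y\<bar> + C * \<tau>" using x y by linarith+
  then have "\<mu> * (\<bar>X\<bar> + \<bar>Y\<bar>) \<le> \<mu> * ((\<bar>x\<bar> + \<bar>y\<bar>) + 2 * (C * \<tau>))" by (intro mult_left_mono \<mu>) linarith
  then have e2: "\<bar>e2\<bar> \<le> \<mu> * (\<bar>x\<bar> + \<bar>y\<bar>) + \<mu> * (2 * (C * \<tau>))"
    using Z unfolding e2_def by (simp only: distrib_left)
  have e3: "\<bar>l * (X - x)\<bar> \<le> \<bar>l\<bar> * (C * \<tau>)" and e4: "\<bar>\<nu> * (Y - y)\<bar> \<le> \<bar>\<nu>\<bar> * (C * \<tau>)"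
    unfolding abs_mult using x y by (intro mult_left_mono; simp add: abs_minus_commute)+
  have "\<bar>?e\<bar> \<le> \<bar>e1\<bar> + \<bar>e2\<bar> + \<bar>l * (X - x)\<bar> + \<bar>\<nu> * (Y - y)\<bar>" by linarith
  also have "\<dots> \<le> C * \<tau> + (\<mu> * (\<bar>x\<bar> + \<bar>y\<bar>) + \<mu> * (2 * (C * \<tau>))) + \<bar>l\<bar> * (C * \<tau>) + \<bar>\<nu>\<bar> * (C * \<tau>)"
    by (intro add_mono e1 e2 e3 e4)
  also have "\<dots> = \<mu> * (\<bar>x\<bar> + \<bar>y\<bar>) + C * \<tau> * (1 + 2 * \<mu> + \<bar>l\<bar> + \<bar>\<nu>\<bar>)" by (simp add: algebra_simps)
  finally show "\<bar>?e\<bar> \<le> \<mu> * (\<bar>x\<bar> + \<bar>y\<bar>) + C * \<tau> * (1 + 2 * \<mu> + \<bar>l\<bar> + \<bar>\<nu>\<bar>)" .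
qed

lemma linearization:
  assumes h: "(h has_derivative (\<lambda>e. pdiff A e h (a, b))) (at (a, b) within A)" and h0: "h (a, b) = (0::real)"
    and r0: "0 < r0" and A: "\<And>x y. \<bar>x - a\<bar> \<le> r0 \<Longrightarrow> \<bar>y - b\<bar> \<le> r0 \<Longrightarrow> (x, y) \<in> A" and \<mu>: "0 < \<mu>"
  shows "\<exists>r>0. r \<le> r0 \<and> (\<forall>x y. \<bar>x - a\<bar> \<le> r \<longrightarrow> \<bar>y - b\<bar> \<le> r \<longrightarrow>
    \<bar>h (x, y) - (pdiff A (1, 0) h (a, b) * (x - a) + pdiff A (0, 1) h (a, b) * (y - (b::real)))\<bar> \<le> \<mu> * (\<bar>x - (a::real)\<bar> + \<bar>y - b\<bar>))"
proof -
  obtain d where d: "0 < d" "\<And>z. z \<in> A \<Longrightarrow> norm (z - (a, b)) < d \<Longrightarrow>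
      norm (h z - h (a, b) - pdiff A (z - (a, b)) h (a, b)) \<le> \<mu> * norm (z - (a, b))"
    using h[unfolded has_derivative_within_alt] \<mu> by blast
  have lin: "linear (\<lambda>e. pdiff A e h (a, b))" by (rule has_derivative_linear[OF h])
  \<comment> \<open>On the box the norm is at most \<open>2 * r\<close>, which is less than
    \<open>d\<close>.\<close>
  define r where "r = min r0 (d / 3)"
  have r: "0 < r" "r \<le> r0" "r \<le> d / 3" using d(1) r0 by (simp_all add: r_def)
  have "\<bar>h (x, y) - (pdiff A (1, 0) h (a, b) * (x - a) + pdiff A (0, 1) h (a, b) * (y - b))\<bar> \<le> \<mu> * (\<bar>x - a\<bar> + \<bar>y - b\<bar>)"
    if xy: "\<bar>x - a\<bar> \<le> r" "\<bar>y - b\<bar> \<le> r" for x y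
  proof -
    have n: "norm ((x, y) - (a, b)) \<le> \<bar>x - a\<bar> + \<bar>y - b\<bar>"
      using sqrt_sum_squares_le_sum_abs[of "x - a" "y - b"] by (simp add: norm_Pair)
    have "norm ((x, y) - (a, b)) < d" using n xy r d(1) by linarith
    then have "norm (h (x, y) - h (a, b) - pdiff A ((x, y) - (a, b)) h (a, b)) \<le> \<mu> * norm ((x, y) - (a, b))"
      using xy r by (intro d(2) A) auto
    also have "\<dots> \<le> \<mu> * (\<bar>x - a\<bar> + \<bar>y - b\<bar>)" using n \<mu> by (intro mult_left_mono) auto
    also have "(x, y) - (a, b) = (x - a) *\<^sub>R (1, 0) + (y - b) *\<^sub>R (0, 1)" by simp
    finally show ?thesis
      unfolding linear_add[OF lin] linear_scale[OF lin] by (simp add: h0 mult.commute)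
  qed
  then show ?thesis using r by blast
qed

lemma almost_linear_if_leading:
  assumes lin1: "\<And>R \<Psi>. \<bar>R - \<rho>\<^sub>0\<bar> \<le> r \<Longrightarrow> \<bar>\<Psi> - \<phi>\<^sub>0\<bar> \<le> r \<Longrightarrow>
      \<bar>\<Lambda> (R, \<Psi>) - (l * (R - \<rho>\<^sub>0) + \<nu> * (\<Psi> - \<phi>\<^sub>0))\<bar> \<le> \<mu> * (\<bar>R - \<rho>\<^sub>0\<bar> + \<bar>\<Psi> - \<phi>\<^sub>0\<bar>)"
    and lin2: "\<And>R \<Psi>. \<bar>R - \<rho>\<^sub>0\<bar> \<le> r \<Longrightarrow> \<bar>\<Psi> - \<phi>\<^sub>0\<bar> \<le> r \<Longrightarrow>
      \<bar>\<Omega> (R, \<Psi>) - (\<eta> * (R - \<rho>\<^sub>0) + w * (\<Psi> - \<phi>\<^sub>0))\<bar> \<le> \<mu> * (\<bar>R - \<rho>\<^sub>0\<bar> + \<bar>\<Psi> - \<phi>\<^sub>0\<bar>)"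
    and C: "0 \<le> C" and \<mu>: "0 \<le> \<mu>" and J: "J \<subseteq> {1..}"
    and near: "\<And>t. t \<in> J \<Longrightarrow> \<bar>R t - \<rho>\<^sub>0\<bar> \<le> r \<and> \<bar>\<Psi> t - \<phi>\<^sub>0\<bar> \<le> r"
    and x: "\<And>t. t \<in> J \<Longrightarrow> \<exists>D. (x has_real_derivative D) (at t within J) \<and>
      \<bar>D - t powr (- real n / real q) * \<Lambda> (R t, \<Psi> t)\<bar> \<le> C * t powr (- real (Suc n) / real q)"
    and y: "\<And>t. t \<in> J \<Longrightarrow> \<exists>D. (y has_real_derivative D) (at t within J) \<and>
      \<bar>D - t powr (- real m / real q) * \<Omega> (R t, \<Psi> t)\<bar> \<le> C * t powr (- real (Suc m) / real q)"
    and close: "\<And>t. t \<in> J \<Longrightarrow> \<bar>x t - (R t - \<rho>\<^sub>0)\<bar> \<le> C * t powr (- 1 / real q)"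
      "\<And>t. t \<in> J \<Longrightarrow> \<bar>y t - (\<Psi> t - \<phi>\<^sub>0)\<bar> \<le> C * t powr (- 1 / real q)"
  shows "almost_linear q n m l \<nu> \<eta> w \<mu> (C * (1 + 2 * \<mu> + (\<bar>l\<bar> + \<bar>\<nu>\<bar> + \<bar>\<eta>\<bar> + \<bar>w\<bar>))) J x y"
  unfolding almost_linear_def
proof
  fix t assume t: "t \<in> J"
  then have t0: "0 < t" using J by auto
  define \<tau> where "\<tau> = t powr (- 1 / real q)"
  have \<tau>: "0 \<le> C * \<tau>" using C by (simp add: \<tau>_def)
  have Suc: "t powr (- real (Suc k) / real q) = t powr (- real k / real q) * \<tau>" for k
    unfolding \<tau>_def powr_rate_power[OF t0] by simp
  obtain D1 where D1: "(x has_real_derivative D1) (at t within J)"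
    and D1': "\<bar>D1 - t powr (- real n / real q) * \<Lambda> (R t, \<Psi> t)\<bar> \<le> C * (t powr (- real n / real q) * \<tau>)"
    using x[OF t] unfolding Suc by blast
  obtain D2 where D2: "(y has_real_derivative D2) (at t within J)"
    and D2': "\<bar>D2 - t powr (- real m / real q) * \<Omega> (R t, \<Psi> t)\<bar> \<le> C * (t powr (- real m / real q) * \<tau>)"
    using y[OF t] unfolding Suc by blast
  have pos: "0 < t powr (- real k / real q)" for k using t0 by simp
  note nr = near[OF t, THEN conjunct1] near[OF t, THEN conjunct2]
  obtain e1 where e1: "D1 = t powr (- real n / real q) * (l * x t + \<nu> * y t + e1)"
    "\<bar>e1\<bar> \<le> \<mu> * (\<bar>x t\<bar> + \<bar>y t\<bar>) + C * \<tau> * (1 + 2 * \<mu> + \<bar>l\<bar> + \<bar>\<nu>\<bar>)"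
    using leading_error[OF pos D1' lin1[OF nr] close(1)[OF t, folded \<tau>_def] close(2)[OF t, folded \<tau>_def] \<mu>] by blast
  obtain e2 where e2: "D2 = t powr (- real m / real q) * (\<eta> * x t + w * y t + e2)"
    "\<bar>e2\<bar> \<le> \<mu> * (\<bar>x t\<bar> + \<bar>y t\<bar>) + C * \<tau> * (1 + 2 * \<mu> + \<bar>\<eta>\<bar> + \<bar>w\<bar>)"
    using leading_error[OF pos D2' lin2[OF nr] close(1)[OF t, folded \<tau>_def] close(2)[OF t, folded \<tau>_def] \<mu>] by blast
  let ?C = "C * (1 + 2 * \<mu> + (\<bar>l\<bar> + \<bar>\<nu>\<bar> + \<bar>\<eta>\<bar> + \<bar>w\<bar>))"
  have "C * \<tau> * (1 + 2 * \<mu> + \<bar>l\<bar> + \<bar>\<nu>\<bar>) \<le> C * \<tau> * (1 + 2 * \<mu> + (\<bar>l\<bar> + \<bar>\<nu>\<bar> + \<bar>\<eta>\<bar> + \<bar>w\<bar>))"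
    "C * \<tau> * (1 + 2 * \<mu> + \<bar>\<eta>\<bar> + \<bar>w\<bar>) \<le> C * \<tau> * (1 + 2 * \<mu> + (\<bar>l\<bar> + \<bar>\<nu>\<bar> + \<bar>\<eta>\<bar> + \<bar>w\<bar>))"
    by (intro mult_left_mono \<tau>; simp)+
  then have "\<bar>e1\<bar> \<le> \<mu> * (\<bar>x t\<bar> + \<bar>y t\<bar>) + ?C * \<tau>" "\<bar>e2\<bar> \<le> \<mu> * (\<bar>x t\<bar> + \<bar>y t\<bar>) + ?C * \<tau>"
    using e1(2) e2(2) by (simp_all add: mult_ac)
  then show "\<exists>e1 e2. (x has_real_derivative t powr (- real n / real q) * (l * x t + \<nu> * y t + e1)) (at t within J) \<and>
        (y has_real_derivative t powr (- real m / real q) * (\<eta> * x t + w * y t + e2)) (at t within J) \<and>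
        \<bar>e1\<bar> \<le> \<mu> * (\<bar>x t\<bar> + \<bar>y t\<bar>) + ?C * t powr (- 1 / real q) \<and>
        \<bar>e2\<bar> \<le> \<mu> * (\<bar>x t\<bar> + \<bar>y t\<bar>) + ?C * t powr (- 1 / real q)"
    using D1 D2 unfolding e1(1) e2(1) \<tau>_def by blast
qed

locale averaged_equilibrium = averaged_system +
  fixes n m :: nat and \<rho>\<^sub>0 \<phi>\<^sub>0 l \<nu> \<eta> w :: real
  assumes n: "n \<in> {1..q}" and m: "m \<in> {1..q}"
    and \<Lambda>_below: "\<forall>k\<in>{1..<n}. \<forall>y\<in>strip \<R>. \<Lambda> k y = 0"
    and \<Omega>_below: "\<forall>k\<in>{1..<m}. \<forall>y\<in>strip \<R>. \<Omega> k y = 0"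
    and \<rho>\<^sub>0: "\<rho>\<^sub>0 \<in> {0<..<\<R>}"
    and equilibrium: "\<Lambda> n (\<rho>\<^sub>0, \<phi>\<^sub>0) = 0" "\<Omega> m (\<rho>\<^sub>0, \<phi>\<^sub>0) = 0"
    and l: "l = pdiff (strip \<R>) (1, 0) (\<Lambda> n) (\<rho>\<^sub>0, \<phi>\<^sub>0)"
    and \<nu>: "\<nu> = pdiff (strip \<R>) (0, 1) (\<Lambda> n) (\<rho>\<^sub>0, \<phi>\<^sub>0)"
    and \<eta>: "\<eta> = pdiff (strip \<R>) (1, 0) (\<Omega> m) (\<rho>\<^sub>0, \<phi>\<^sub>0)"
    and w: "w = pdiff (strip \<R>) (0, 1) (\<Omega> m) (\<rho>\<^sub>0, \<phi>\<^sub>0)"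
begin

text \<open>Half of the distance to the ends of the amplitude range, so that the closed box lies in
  the open strip.\<close>

definition "b = min \<rho>\<^sub>0 (\<R> - \<rho>\<^sub>0) / 2"

abbreviation "nbhd \<equiv> {\<rho>\<^sub>0 - b..\<rho>\<^sub>0 + b} \<times> {\<phi>\<^sub>0 - b..\<phi>\<^sub>0 + b}"

lemma b: "0 < b" "0 < \<rho>\<^sub>0 - b" "\<rho>\<^sub>0 + b < \<R>"
  using \<rho>\<^sub>0 by (auto simp: b_def min_def field_simps)

lemma nbhd: "compact nbhd" "convex nbhd" "nbhd \<subseteq> strip \<R>"
  using b by (auto intro!: compact_Times convex_Times convex_real_interval)

lemma n1: "1 \<le> n" "n \<le> q" and m1: "1 \<le> m" "m \<le> q" using n m by auto

definition "trunc N t y = ((\<Sum>k=1..N. t powr (- real k / real q) * \<Lambda> k y), (\<Sum>k=1..N. t powr (- real k / real q) * \<Omega> k y))"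

lemma both_linearizations:
  assumes \<mu>: "0 < \<mu>"
  shows "\<exists>r>0. r \<le> b \<and>
    (\<forall>R \<Psi>. \<bar>R - \<rho>\<^sub>0\<bar> \<le> r \<longrightarrow> \<bar>\<Psi> - \<phi>\<^sub>0\<bar> \<le> r \<longrightarrow>
      \<bar>\<Lambda> n (R, \<Psi>) - (l * (R - \<rho>\<^sub>0) + \<nu> * (\<Psi> - \<phi>\<^sub>0))\<bar> \<le> \<mu> * (\<bar>R - \<rho>\<^sub>0\<bar> + \<bar>\<Psi> - \<phi>\<^sub>0\<bar>) \<and>
      \<bar>\<Omega> m (R, \<Psi>) - (\<eta> * (R - \<rho>\<^sub>0) + w * (\<Psi> - \<phi>\<^sub>0))\<bar> \<le> \<mu> * (\<bar>R - \<rho>\<^sub>0\<bar> + \<bar>\<Psi> - \<phi>\<^sub>0\<bar>))"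
proof -
  have A: "(x, y) \<in> strip \<R>" if "\<bar>x - \<rho>\<^sub>0\<bar> \<le> b" for x y :: real
    using that b by (auto simp: abs_le_iff)
  have in0: "(\<rho>\<^sub>0, \<phi>\<^sub>0) \<in> strip \<R>" using \<rho>\<^sub>0 by auto
  obtain r1 where r1: "0 < r1" "r1 \<le> b" "\<forall>x y. \<bar>x - \<rho>\<^sub>0\<bar> \<le> r1 \<longrightarrow> \<bar>y - \<phi>\<^sub>0\<bar> \<le> r1 \<longrightarrow>
      \<bar>\<Lambda> n (x, y) - (l * (x - \<rho>\<^sub>0) + \<nu> * (y - \<phi>\<^sub>0))\<bar> \<le> \<mu> * (\<bar>x - \<rho>\<^sub>0\<bar> + \<bar>y - \<phi>\<^sub>0\<bar>)"
    using linearization[OF smooth_on_has_derivative[OF smooth_averaged(3)[OF n1(1)] in0] equilibrium(1) b(1) A \<mu>]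
    unfolding l[symmetric] \<nu>[symmetric] by blast
  obtain r2 where r2: "0 < r2" "r2 \<le> b" "\<forall>x y. \<bar>x - \<rho>\<^sub>0\<bar> \<le> r2 \<longrightarrow> \<bar>y - \<phi>\<^sub>0\<bar> \<le> r2 \<longrightarrow>
      \<bar>\<Omega> m (x, y) - (\<eta> * (x - \<rho>\<^sub>0) + w * (y - \<phi>\<^sub>0))\<bar> \<le> \<mu> * (\<bar>x - \<rho>\<^sub>0\<bar> + \<bar>y - \<phi>\<^sub>0\<bar>)"
    using linearization[OF smooth_on_has_derivative[OF smooth_averaged(4)[OF m1(1)] in0] equilibrium(2) b(1) A \<mu>]
    unfolding \<eta>[symmetric] w[symmetric] by blast
  show ?thesis
    by (rule exI[of _ "min r1 r2"]) (use r1 r2 in \<open>simp add: min.coboundedI1\<close>)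
qed

text \<open>The common form of what averaging gives for the full field and a tail estimate for the
  truncated one: each equation has a remainder one step \<open>1 / q\<close> beyond its own leading
  order.\<close>

abbreviation "leading C J R \<Psi> x y t \<equiv>
   (\<exists>D. (x has_real_derivative D) (at t within J) \<and>
     \<bar>D - t powr (- real n / real q) * \<Lambda> n (R t, \<Psi> t)\<bar> \<le> C * t powr (- real (Suc n) / real q)) \<and>
   (\<exists>D. (y has_real_derivative D) (at t within J) \<and>
     \<bar>D - t powr (- real m / real q) * \<Omega> m (R t, \<Psi> t)\<bar> \<le> C * t powr (- real (Suc m) / real q)) \<and>
   \<bar>x t - (R t - \<rho>\<^sub>0)\<bar> \<le> C * t powr (- 1 / real q) \<and>
   \<bar>y t - (\<Psi> t - \<phi>\<^sub>0)\<bar> \<le> C * t powr (- 1 / real q)"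

abbreviation "leading_on H C T \<equiv> \<forall>J R \<Psi>. J \<subseteq> {T..} \<longrightarrow> solves2 H J R \<Psi> \<longrightarrow>
   (\<forall>t\<in>J. \<bar>R t - \<rho>\<^sub>0\<bar> \<le> b \<and> \<bar>\<Psi> t - \<phi>\<^sub>0\<bar> \<le> b) \<longrightarrow> (\<exists>x y. \<forall>t\<in>J. leading C J R \<Psi> x y t)"

text \<open>The tolerance \<open>\<mu>\<close> fixes the radius of linearization; the leading form
  holds on the larger box and does not depend on it. \<open>\<mu>\<close> enters the forcing
  constant only through \<open>k\<close>.\<close>

lemma reduction_if_leading:
  assumes leading: "\<exists>C\<ge>0. \<exists>T\<ge>1. leading_on H C T"
    and \<mu>: "0 < \<mu>"
  shows "\<exists>r>0. \<exists>C\<ge>0. \<exists>T\<ge>1. reduces q n m l \<nu> \<eta> w \<rho>\<^sub>0 \<phi>\<^sub>0 H \<mu> r C T"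
proof -
  obtain r where r: "0 < r" "r \<le> b" and lin:
    "\<And>R \<Psi>. \<bar>R - \<rho>\<^sub>0\<bar> \<le> r \<Longrightarrow> \<bar>\<Psi> - \<phi>\<^sub>0\<bar> \<le> r \<Longrightarrow> \<bar>\<Lambda> n (R, \<Psi>) - (l * (R - \<rho>\<^sub>0) + \<nu> * (\<Psi> - \<phi>\<^sub>0))\<bar> \<le> \<mu> * (\<bar>R - \<rho>\<^sub>0\<bar> + \<bar>\<Psi> - \<phi>\<^sub>0\<bar>)"
    "\<And>R \<Psi>. \<bar>R - \<rho>\<^sub>0\<bar> \<le> r \<Longrightarrow> \<bar>\<Psi> - \<phi>\<^sub>0\<bar> \<le> r \<Longrightarrow> \<bar>\<Omega> m (R, \<Psi>) - (\<eta> * (R - \<rho>\<^sub>0) + w * (\<Psi> - \<phi>\<^sub>0))\<bar> \<le> \<mu> * (\<bar>R - \<rho>\<^sub>0\<bar> + \<bar>\<Psi> - \<phi>\<^sub>0\<bar>)"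
    using both_linearizations[OF \<mu>] by blast
  obtain C T where C: "0 \<le> C" and T: "1 \<le> T" and lead: "leading_on H C T"
    using leading by (elim exE conjE) (rule that)
  define k where "k = 1 + 2 * \<mu> + (\<bar>l\<bar> + \<bar>\<nu>\<bar> + \<bar>\<eta>\<bar> + \<bar>w\<bar>)"
  have k: "1 \<le> k" using \<mu> by (simp add: k_def)
  \<comment> \<open>\<open>C * k\<close> serves the forcing and \<open>2 * C\<close> the sum of the
    two distances; the definition covers both since \<open>k >= 1\<close>.\<close>
  define C' where "C' = 2 * (C * k)"
  have C': "0 \<le> C'" "C * k \<le> C'" "2 * C \<le> C'" using C k by (auto simp: C'_def mult_le_cancel_left1)
  show ?thesis
  proof (rule exI[of _ r], rule conjI[OF r(1)], rule exI[of _ C'], rule conjI[OF C'(1)], rule exI[of _ T],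
      rule conjI[OF T], intro allI impI)
    fix J and R \<Psi> :: "real \<Rightarrow> real"
    assume J: "J \<subseteq> {T..}" and s: "solves2 H J R \<Psi>" and near: "\<forall>t\<in>J. \<bar>R t - \<rho>\<^sub>0\<bar> \<le> r \<and> \<bar>\<Psi> t - \<phi>\<^sub>0\<bar> \<le> r"
    have nearb: "\<forall>t\<in>J. \<bar>R t - \<rho>\<^sub>0\<bar> \<le> b \<and> \<bar>\<Psi> t - \<phi>\<^sub>0\<bar> \<le> b" using near r(2) order_trans by blast
    obtain x y where xy: "\<forall>t\<in>J. leading C J R \<Psi> x y t"
      using lead[THEN spec, THEN spec, THEN spec, THEN mp, OF J, THEN mp, OF s, THEN mp, OF nearb] by (elim exE)
    have J1: "J \<subseteq> {1..}" using J T by auto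
    have al: "almost_linear q n m l \<nu> \<eta> w \<mu> (C * k) J x y"
      unfolding k_def
      by (rule almost_linear_if_leading[where \<Lambda> = "\<Lambda> n" and \<Omega> = "\<Omega> m" and R = R and \<Psi> = \<Psi>, OF lin C less_imp_le[OF \<mu>] J1])
        (use near xy in blast)+
    have "almost_linear q n m l \<nu> \<eta> w \<mu> C' J x y"
      unfolding almost_linear_def
    proof
      fix t assume "t \<in> J"
      have mono: "C * k * t powr (- 1 / real q) \<le> C' * t powr (- 1 / real q)" by (intro mult_right_mono C') auto
      obtain e1 e2 where "(x has_real_derivative t powr (- real n / real q) * (l * x t + \<nu> * y t + e1)) (at t within J)"
        "(y has_real_derivative t powr (- real m / real q) * (\<eta> * x t + w * y t + e2)) (at t within J)"
        "\<bar>e1\<bar> \<le> \<mu> * (\<bar>x t\<bar> + \<bar>y t\<bar>) + C * k * t powr (- 1 / real q)"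
        "\<bar>e2\<bar> \<le> \<mu> * (\<bar>x t\<bar> + \<bar>y t\<bar>) + C * k * t powr (- 1 / real q)"
        using al \<open>t \<in> J\<close> unfolding almost_linear_def by blast
      moreover from this(3,4) mono have "\<bar>e1\<bar> \<le> \<mu> * (\<bar>x t\<bar> + \<bar>y t\<bar>) + C' * t powr (- 1 / real q)"
        "\<bar>e2\<bar> \<le> \<mu> * (\<bar>x t\<bar> + \<bar>y t\<bar>) + C' * t powr (- 1 / real q)" by linarith+
      ultimately show "\<exists>e1 e2. (x has_real_derivative t powr (- real n / real q) * (l * x t + \<nu> * y t + e1)) (at t within J) \<and>
        (y has_real_derivative t powr (- real m / real q) * (\<eta> * x t + w * y t + e2)) (at t within J) \<and>
        \<bar>e1\<bar> \<le> \<mu> * (\<bar>x t\<bar> + \<bar>y t\<bar>) + C' * t powr (- 1 / real q) \<and>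
        \<bar>e2\<bar> \<le> \<mu> * (\<bar>x t\<bar> + \<bar>y t\<bar>) + C' * t powr (- 1 / real q)" by blast
    qed
    moreover have "\<bar>x t - (R t - \<rho>\<^sub>0)\<bar> + \<bar>y t - (\<Psi> t - \<phi>\<^sub>0)\<bar> \<le> C' * t powr (- 1 / real q)" if t: "t \<in> J" for t
    proof -
      have "\<bar>x t - (R t - \<rho>\<^sub>0)\<bar> + \<bar>y t - (\<Psi> t - \<phi>\<^sub>0)\<bar> \<le> C * t powr (- 1 / real q) + C * t powr (- 1 / real q)"
        using bspec[OF xy t] by (intro add_mono) blast+
      also have "\<dots> = 2 * C * t powr (- 1 / real q)" by simp
      also have "\<dots> \<le> C' * t powr (- 1 / real q)" by (intro mult_right_mono C') auto
      finally show ?thesis .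
    qed
    ultimately show "\<exists>x y. almost_linear q n m l \<nu> \<eta> w \<mu> C' J x y \<and>
          (\<forall>t\<in>J. \<bar>x t - (R t - \<rho>\<^sub>0)\<bar> + \<bar>y t - (\<Psi> t - \<phi>\<^sub>0)\<bar> \<le> C' * t powr (- 1 / real q))" by blast
  qed
qed

text \<open>The amplitude stays below \<open>\<R>\<close> because the vanishing of derivatives of
  vanishing coefficients was obtained in the open strip.\<close>

lemma formal_identities:
  assumes "R \<in> {0<..<\<R>}"
  shows "k \<le> n \<Longrightarrow> fps_nth (formal_transport \<R> q (coeffs_F \<kappa> \<kappa>' fc) (coeffs_G \<kappa> \<kappa>' s gc) s (u(0 := \<lambda>(R, \<Psi>, \<sigma>). R)) (R, \<Psi>, \<sigma>)) k
      = (if k = n then \<Lambda> n (R, \<Psi>) else 0)"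
    and "k \<le> m \<Longrightarrow> fps_nth (formal_transport \<R> q (coeffs_F \<kappa> \<kappa>' fc) (coeffs_G \<kappa> \<kappa>' s gc) s (v(0 := \<lambda>(R, \<Psi>, \<sigma>). \<Psi>)) (R, \<Psi>, \<sigma>)) k
      = (if k = m then \<Omega> m (R, \<Psi>) else 0)"
proof -
  have R: "R \<in> {0<..\<R>}" and in0: "(R, \<Psi>) \<in> {0<..<\<R>} \<times> UNIV" using assms by auto
  have "\<forall>R\<in>{0<..\<R>}. \<forall>\<Psi> \<sigma>.
        let F = coeffs_F \<kappa> \<kappa>' fc; G = coeffs_G \<kappa> \<kappa>' s gc;
            U = u(0 := \<lambda>(R, \<Psi>, \<sigma>). R); V = v(0 := \<lambda>(R, \<Psi>, \<sigma>). \<Psi>);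
            a = series_from_1 u (R, \<Psi>, \<sigma>); b = series_from_1 v (R, \<Psi>, \<sigma>)
        in formal_transport \<R> q F G s U (R, \<Psi>, \<sigma>) = formal_rhs \<R> \<Lambda> (R, \<Psi>) a b \<and>
           formal_transport \<R> q F G s V (R, \<Psi>, \<sigma>) = formal_rhs \<R> \<Omega> (R, \<Psi>) a b"
    using averaged unfolding averaged_coefficients_def by (elim conjE)
  from this[rule_format, OF R, of \<Psi> \<sigma>, unfolded Let_def]
  have U: "formal_transport \<R> q (coeffs_F \<kappa> \<kappa>' fc) (coeffs_G \<kappa> \<kappa>' s gc) s (u(0 := \<lambda>(R, \<Psi>, \<sigma>). R)) (R, \<Psi>, \<sigma>) =
      formal_rhs \<R> \<Lambda> (R, \<Psi>) (series_from_1 u (R, \<Psi>, \<sigma>)) (series_from_1 v (R, \<Psi>, \<sigma>))"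
    and V: "formal_transport \<R> q (coeffs_F \<kappa> \<kappa>' fc) (coeffs_G \<kappa> \<kappa>' s gc) s (v(0 := \<lambda>(R, \<Psi>, \<sigma>). \<Psi>)) (R, \<Psi>, \<sigma>) =
      formal_rhs \<R> \<Omega> (R, \<Psi>) (series_from_1 u (R, \<Psi>, \<sigma>)) (series_from_1 v (R, \<Psi>, \<sigma>))" by blast+
  show "k \<le> n \<Longrightarrow> fps_nth (formal_transport \<R> q (coeffs_F \<kappa> \<kappa>' fc) (coeffs_G \<kappa> \<kappa>' s gc) s (u(0 := \<lambda>(R, \<Psi>, \<sigma>). R)) (R, \<Psi>, \<sigma>)) k
      = (if k = n then \<Lambda> n (R, \<Psi>) else 0)"
    unfolding U by (rule formal_rhs_leading[OF in0 n1(1) _ \<Lambda>_below])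
  show "k \<le> m \<Longrightarrow> fps_nth (formal_transport \<R> q (coeffs_F \<kappa> \<kappa>' fc) (coeffs_G \<kappa> \<kappa>' s gc) s (v(0 := \<lambda>(R, \<Psi>, \<sigma>). \<Psi>)) (R, \<Psi>, \<sigma>)) k
      = (if k = m then \<Omega> m (R, \<Psi>) else 0)"
    unfolding V by (rule formal_rhs_leading[OF in0 m1(1) _ \<Omega>_below])
qed

text \<open>Index 0 is a coordinate function and is handled by linearity, all other indices by the
  assumed smoothness.\<close>

lemma near_identity_regular:
  fixes W :: "nat \<Rightarrow> real \<times> real \<times> real \<Rightarrow> real"
  assumes W0: "bounded_linear (W 0)" and W: "\<And>k. 1 \<le> k \<Longrightarrow> smooth_on (strip \<R>) (W k)"
  shows "x \<in> {0<..<\<R>} \<times> UNIV \<Longrightarrow> (W k has_derivative (\<lambda>e. pdiff (strip \<R>) e (W k) x)) (at x within strip \<R>)"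
    and "continuous_on ({0<..<\<R>} \<times> UNIV) (pdiff (strip \<R>) e (W k))"
    and "continuous_on ({0<..<\<R>} \<times> UNIV) (W k)"
proof -
  have X: "open ({0<..<\<R>} \<times> (UNIV :: (real \<times> real) set))" "{0<..<\<R>} \<times> UNIV \<subseteq> strip \<R>"
    by (auto intro: open_Times)
  show "x \<in> {0<..<\<R>} \<times> UNIV \<Longrightarrow> (W k has_derivative (\<lambda>e. pdiff (strip \<R>) e (W k) x)) (at x within strip \<R>)"
  proof (cases "k = 0")
    case True
    assume x: "x \<in> {0<..<\<R>} \<times> UNIV"
    show ?thesis unfolding True pdiff_linear[OF X x W0] by (rule bounded_linear_imp_has_derivative[OF W0])
  next
    case False
    assume "x \<in> {0<..<\<R>} \<times> UNIV"
    then show ?thesis using False X(2) by (intro smooth_on_has_derivative W) auto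
  qed
  show "continuous_on ({0<..<\<R>} \<times> UNIV) (pdiff (strip \<R>) e (W k))"
  proof (cases "k = 0")
    case True
    have "continuous_on ({0<..<\<R>} \<times> UNIV) (\<lambda>_. W 0 e)" by (rule continuous_on_const)
    then show ?thesis unfolding True
      by (rule continuous_on_eq) (simp add: pdiff_linear[OF X _ W0])
  next
    case False
    then show ?thesis
      by (intro continuous_on_subset[OF smooth_on_continuous X(2)] smooth_on_pdiff W) simp
  qed
  show "continuous_on ({0<..<\<R>} \<times> UNIV) (W k)"
  proof (cases "k = 0")
    case True
    show ?thesis unfolding True by (rule linear_continuous_on[OF W0])
  next
    case False
    then show ?thesis
      by (intro continuous_on_subset[OF smooth_on_continuous X(2)] W) simp
  qed
qed

text \<open>The amplitude is transformed up to order \<open>n\<close> and the phase up to order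
  \<open>m\<close>, each just far enough to expose its own leading term.\<close>

lemma field_leading:
  "\<exists>C\<ge>0. \<exists>T\<ge>1. leading_on field C T"
proof -
  define U where "U = u(0 := \<lambda>(R, \<Psi>, \<sigma>). R)"
  define V where "V = v(0 := \<lambda>(R, \<Psi>, \<sigma>). \<Psi>)"
  have "U 0 = fst" "V 0 = (\<lambda>x. fst (snd x))" by (auto simp: U_def V_def)
  then have U0: "bounded_linear (U 0)" and V0: "bounded_linear (V 0)"
    using bounded_linear_fst bounded_linear_compose[OF bounded_linear_fst bounded_linear_snd] by (simp_all add: o_def)
  have Us: "smooth_on (strip \<R>) (U k)" and Vs: "smooth_on (strip \<R>) (V k)" if "1 \<le> k" for k
    using smooth_averaged(1,2)[OF that] that by (auto simp: U_def V_def)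
  have Up: "U k (\<rho>, \<Psi>, \<sigma> + P) = U k (\<rho>, \<Psi>, \<sigma>)" and Vp: "V k (\<rho>, \<Psi>, \<sigma> + P) = V k (\<rho>, \<Psi>, \<sigma>)"
    if "\<rho> \<in> {0<..\<R>}" for k \<rho> \<Psi> \<sigma>
    using periodic_averaged[OF _ that, of k] by (cases "k = 0"; simp add: U_def V_def)+
  \<comment> \<open>Names the conclusion of \<open>near_identity_derivative\<close> on the box of
    radius \<open>b\<close>, which is used once for each component.\<close>
  define good where "good N W L C T \<longleftrightarrow> (\<forall>J R \<Psi>. J \<subseteq> {T..} \<longrightarrow> solves2 field J R \<Psi> \<longrightarrow>
    (\<forall>t\<in>J. \<bar>R t - \<rho>\<^sub>0\<bar> \<le> b \<and> \<bar>\<Psi> t - \<phi>\<^sub>0\<bar> \<le> b) \<longrightarrow>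
    (\<forall>t\<in>J. (\<exists>D. ((\<lambda>t. \<Sum>k\<le>N. t powr (- real k / real q) * W k (R t, \<Psi> t, S t)) has_real_derivative D) (at t within J) \<and>
        \<bar>D - t powr (- real N / real q) * L (R t, \<Psi> t)\<bar> \<le> C * t powr (- real (Suc N) / real q)) \<and>
      \<bar>(\<Sum>k\<le>N. t powr (- real k / real q) * W k (R t, \<Psi> t, S t)) - W 0 (R t, \<Psi> t, S t)\<bar> \<le> C * t powr (- 1 / real q)))"
    for N C T and W :: "nat \<Rightarrow> real \<times> real \<times> real \<Rightarrow> real" and L :: "real \<times> real \<Rightarrow> real"
  have "\<exists>C\<ge>0. \<exists>T\<ge>1. good n U (\<Lambda> n) C T"
    unfolding good_def
  proof (rule near_identity_derivative[where W = U and N = n and L = "\<Lambda> n", OF b(2,3) n1(2)])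
    show "(U k has_derivative (\<lambda>e. pdiff (strip \<R>) e (U k) x)) (at x within strip \<R>)"
      if "x \<in> {0<..<\<R>} \<times> UNIV" for k x
      by (rule near_identity_regular(1)[where W = U, OF U0 Us that])
    show "continuous_on ({0<..<\<R>} \<times> UNIV) (pdiff (strip \<R>) e (U k))" for k e
      by (rule near_identity_regular(2)[where W = U, OF U0 Us])
    show "continuous_on ({0<..<\<R>} \<times> UNIV) (U k)" for k
      by (rule near_identity_regular(3)[where W = U, OF U0 Us])
  qed (simp_all only: Up formal_identities(1)[folded U_def])
  then obtain C1 T1 where 1: "0 \<le> C1" "1 \<le> T1" "good n U (\<Lambda> n) C1 T1" by blast
  have "\<exists>C\<ge>0. \<exists>T\<ge>1. good m V (\<Omega> m) C T"
    unfolding good_def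
  proof (rule near_identity_derivative[where W = V and N = m and L = "\<Omega> m", OF b(2,3) m1(2)])
    show "(V k has_derivative (\<lambda>e. pdiff (strip \<R>) e (V k) x)) (at x within strip \<R>)"
      if "x \<in> {0<..<\<R>} \<times> UNIV" for k x
      by (rule near_identity_regular(1)[where W = V, OF V0 Vs that])
    show "continuous_on ({0<..<\<R>} \<times> UNIV) (pdiff (strip \<R>) e (V k))" for k e
      by (rule near_identity_regular(2)[where W = V, OF V0 Vs])
    show "continuous_on ({0<..<\<R>} \<times> UNIV) (V k)" for k
      by (rule near_identity_regular(3)[where W = V, OF V0 Vs])
  qed (simp_all only: Vp formal_identities(2)[folded V_def])
  then obtain C2 T2 where 2: "0 \<le> C2" "1 \<le> T2" "good m V (\<Omega> m) C2 T2" by blast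
  define C where "C = max C1 C2"
  define T where "T = max T1 T2"
  have C: "0 \<le> C" and T: "1 \<le> T" using 1 2 by (auto simp: C_def T_def)
  have mono: "z \<le> C * t powr p" if "z \<le> C1 * t powr p \<or> z \<le> C2 * t powr p" for z t p
    using that mult_right_mono[of C1 C "t powr p"] mult_right_mono[of C2 C "t powr p"]
    by (auto simp: C_def)
  show ?thesis
  proof (rule exI[of _ C], rule conjI[OF C], rule exI[of _ T], rule conjI[OF T], intro allI impI)
    fix J and R \<Psi> :: "real \<Rightarrow> real"
    assume J: "J \<subseteq> {T..}" and sol: "solves2 field J R \<Psi>" and near: "\<forall>t\<in>J. \<bar>R t - \<rho>\<^sub>0\<bar> \<le> b \<and> \<bar>\<Psi> t - \<phi>\<^sub>0\<bar> \<le> b"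
    have J12: "J \<subseteq> {T1..}" "J \<subseteq> {T2..}" using J by (auto simp: T_def)
    define x where "x = (\<lambda>t. (\<Sum>k\<le>n. t powr (- real k / real q) * U k (R t, \<Psi> t, S t)) - \<rho>\<^sub>0)"
    define y where "y = (\<lambda>t. (\<Sum>k\<le>m. t powr (- real k / real q) * V k (R t, \<Psi> t, S t)) - \<phi>\<^sub>0)"
    note A1 = 1(3)[unfolded good_def, THEN spec, THEN spec, THEN spec, THEN mp, OF J12(1), THEN mp, OF sol, THEN mp, OF near]
    note A2 = 2(3)[unfolded good_def, THEN spec, THEN spec, THEN spec, THEN mp, OF J12(2), THEN mp, OF sol, THEN mp, OF near]
    show "\<exists>x y. \<forall>t\<in>J. leading C J R \<Psi> x y t"
    proof (rule exI[of _ x], rule exI[of _ y], rule ballI)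
      fix t assume t: "t \<in> J"
      obtain D1 where D1: "((\<lambda>t. \<Sum>k\<le>n. t powr (- real k / real q) * U k (R t, \<Psi> t, S t)) has_real_derivative D1) (at t within J)"
        "\<bar>D1 - t powr (- real n / real q) * \<Lambda> n (R t, \<Psi> t)\<bar> \<le> C1 * t powr (- real (Suc n) / real q)"
        using bspec[OF A1 t] by blast
      obtain D2 where D2: "((\<lambda>t. \<Sum>k\<le>m. t powr (- real k / real q) * V k (R t, \<Psi> t, S t)) has_real_derivative D2) (at t within J)"
        "\<bar>D2 - t powr (- real m / real q) * \<Omega> m (R t, \<Psi> t)\<bar> \<le> C2 * t powr (- real (Suc m) / real q)"
        using bspec[OF A2 t] by blast
      have "(x has_real_derivative D1 - 0) (at t within J)" "(y has_real_derivative D2 - 0) (at t within J)"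
        unfolding x_def y_def by (intro DERIV_diff D1(1) D2(1) DERIV_const)+
      moreover have "x t - (R t - \<rho>\<^sub>0) = (\<Sum>k\<le>n. t powr (- real k / real q) * U k (R t, \<Psi> t, S t)) - U 0 (R t, \<Psi> t, S t)"
        "y t - (\<Psi> t - \<phi>\<^sub>0) = (\<Sum>k\<le>m. t powr (- real k / real q) * V k (R t, \<Psi> t, S t)) - V 0 (R t, \<Psi> t, S t)"
        by (simp_all add: x_def y_def U_def V_def)
      ultimately show "leading C J R \<Psi> x y t"
        using mono[OF disjI1[OF D1(2)]] mono[OF disjI2[OF D2(2)]]
          mono[OF disjI1[OF bspec[OF A1 t, THEN conjunct2]]] mono[OF disjI2[OF bspec[OF A2 t, THEN conjunct2]]]
        by auto
    qed
  qed
qed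

text \<open>Terms below \<open>k0\<close> vanish on the strip; those above are at least one step
  \<open>1 / q\<close> smaller and have bounded coefficients on the compact box.\<close>

lemma tail_bound:
  assumes below: "\<forall>k\<in>{1..<k0}. \<forall>y\<in>strip \<R>. L k y = 0" and k0: "1 \<le> k0" "k0 \<le> N"
    and L: "\<And>k. 1 \<le> k \<Longrightarrow> smooth_on (strip \<R>) (L k)"
  shows "\<exists>C\<ge>0. \<forall>t\<ge>1. \<forall>y\<in>nbhd.
    \<bar>(\<Sum>k=1..N. t powr (- real k / real q) * L k y) - t powr (- real k0 / real q) * L k0 y\<bar> \<le> C * t powr (- real (Suc k0) / real q)"
proof -
  \<comment> \<open>The shift by \<open>Suc\<close> keeps index 0, about which nothing is assumed,
    out of the bound.\<close>
  have "continuous_on nbhd (L (Suc k))" for k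
    by (rule continuous_on_subset[OF smooth_on_continuous[OF L] nbhd(3)]) simp
  then obtain M where M: "0 \<le> M" "\<forall>k\<le>N. \<forall>y\<in>nbhd. \<bar>L (Suc k) y\<bar> \<le> M"
    using uniform_bound[OF nbhd(1), of N "\<lambda>k. L (Suc k)"] by blast
  have "\<bar>(\<Sum>k=1..N. t powr (- real k / real q) * L k y) - t powr (- real k0 / real q) * L k0 y\<bar> \<le> real N * M * t powr (- real (Suc k0) / real q)"
    if t: "1 \<le> t" and y: "y \<in> nbhd" for t y
  proof -
    have "(\<Sum>k=1..N. t powr (- real k / real q) * L k y) = t powr (- real k0 / real q) * L k0 y
        + (\<Sum>k\<in>{1..N} - {k0}. t powr (- real k / real q) * L k y)"
      using k0 by (subst sum.remove[of _ k0]) auto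
    then have "\<bar>(\<Sum>k=1..N. t powr (- real k / real q) * L k y) - t powr (- real k0 / real q) * L k0 y\<bar>
      = \<bar>\<Sum>k\<in>{1..N} - {k0}. t powr (- real k / real q) * L k y\<bar>" by simp
    also have "\<dots> \<le> (\<Sum>k\<in>{1..N} - {k0}. \<bar>t powr (- real k / real q) * L k y\<bar>)" by (rule sum_abs)
    also have "\<dots> \<le> (\<Sum>k\<in>{1..N} - {k0}. t powr (- real (Suc k0) / real q) * M)"
    proof (rule sum_mono)
      fix k assume k: "k \<in> {1..N} - {k0}"
      show "\<bar>t powr (- real k / real q) * L k y\<bar> \<le> t powr (- real (Suc k0) / real q) * M"
      proof (cases "k < k0")
        case True
        then have "L k y = 0" using below k y nbhd(3) by auto
        then show ?thesis using M(1) by simp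
      next
        case False
        then have "real (Suc k0) \<le> real k" using k by auto
        then have "real (Suc k0) / real q \<le> real k / real q" by (rule divide_right_mono) simp
        then have "- real k / real q \<le> - real (Suc k0) / real q" by (simp del: of_nat_Suc)
        then have "t powr (- real k / real q) \<le> t powr (- real (Suc k0) / real q)" using t by (intro powr_mono)
        moreover have "k - 1 \<le> N" using k by auto
        then have "\<bar>L k y\<bar> \<le> M" using M(2)[rule_format, of "k - 1" y] y k by simp
        ultimately have "t powr (- real k / real q) * \<bar>L k y\<bar> \<le> t powr (- real (Suc k0) / real q) * M"
          by (intro mult_mono) auto
        then show ?thesis by (simp add: abs_mult)
      qed
    qed
    also have "\<dots> \<le> (\<Sum>k=1..N. t powr (- real (Suc k0) / real q) * M)" using M(1) by (intro sum_mono2) auto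
    also have "\<dots> = real N * M * t powr (- real (Suc k0) / real q)" by simp
    finally show ?thesis .
  qed
  then show ?thesis using M(1) by (intro exI[of _ "real N * M"]) auto
qed

text \<open>The truncated system is already averaged, so the deviation itself serves as the almost
  linear variable and the distances are zero.\<close>

lemma trunc_leading:
  assumes N: "max n m \<le> N"
  shows "\<exists>C\<ge>0. \<exists>T\<ge>1. leading_on (trunc N) C T"
proof -
  have nm: "n \<le> N" "m \<le> N" using N by auto
  have "\<exists>C\<ge>0. \<forall>t\<ge>1. \<forall>y\<in>nbhd.
    \<bar>(\<Sum>k=1..N. t powr (- real k / real q) * \<Lambda> k y) - t powr (- real n / real q) * \<Lambda> n y\<bar> \<le> C * t powr (- real (Suc n) / real q)"
    by (rule tail_bound[OF \<Lambda>_below n1(1) nm(1)]) (rule smooth_averaged(3))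
  then obtain C1 where C1: "0 \<le> C1" "\<forall>t\<ge>1. \<forall>y\<in>nbhd.
    \<bar>(\<Sum>k=1..N. t powr (- real k / real q) * \<Lambda> k y) - t powr (- real n / real q) * \<Lambda> n y\<bar> \<le> C1 * t powr (- real (Suc n) / real q)"
    by (elim exE conjE) (rule that)
  have "\<exists>C\<ge>0. \<forall>t\<ge>1. \<forall>y\<in>nbhd.
    \<bar>(\<Sum>k=1..N. t powr (- real k / real q) * \<Omega> k y) - t powr (- real m / real q) * \<Omega> m y\<bar> \<le> C * t powr (- real (Suc m) / real q)"
    by (rule tail_bound[OF \<Omega>_below m1(1) nm(2)]) (rule smooth_averaged(4))
  then obtain C2 where C2: "0 \<le> C2" "\<forall>t\<ge>1. \<forall>y\<in>nbhd.
    \<bar>(\<Sum>k=1..N. t powr (- real k / real q) * \<Omega> k y) - t powr (- real m / real q) * \<Omega> m y\<bar> \<le> C2 * t powr (- real (Suc m) / real q)"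
    by (elim exE conjE) (rule that)
  define C where "C = max C1 C2"
  have C: "0 \<le> C" using C1 by (simp add: C_def)
  have mono: "z \<le> C * t powr p" if "z \<le> C1 * t powr p \<or> z \<le> C2 * t powr p" for z t p
    using that mult_right_mono[of C1 C "t powr p"] mult_right_mono[of C2 C "t powr p"]
    by (auto simp: C_def)
  show ?thesis
  proof (rule exI[of _ C], rule conjI[OF C], rule exI[of _ 1], rule conjI[OF order_refl], intro allI impI)
    fix J and R \<Psi> :: "real \<Rightarrow> real"
    assume J: "J \<subseteq> {1..}" and sol: "solves2 (trunc N) J R \<Psi>" and near: "\<forall>t\<in>J. \<bar>R t - \<rho>\<^sub>0\<bar> \<le> b \<and> \<bar>\<Psi> t - \<phi>\<^sub>0\<bar> \<le> b"
    show "\<exists>x y. \<forall>t\<in>J. leading C J R \<Psi> x y t"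
    proof (rule exI[of _ "\<lambda>t. R t - \<rho>\<^sub>0"], rule exI[of _ "\<lambda>t. \<Psi> t - \<phi>\<^sub>0"], intro ballI conjI)
      fix t assume t: "t \<in> J"
      then have t1: "1 \<le> t" using J by auto
      have y: "(R t, \<Psi> t) \<in> nbhd" using bspec[OF near t] by (auto simp: abs_le_iff)
      have "((\<lambda>t. R t - \<rho>\<^sub>0) has_real_derivative fst (trunc N t (R t, \<Psi> t)) - 0) (at t within J)"
        "((\<lambda>t. \<Psi> t - \<phi>\<^sub>0) has_real_derivative snd (trunc N t (R t, \<Psi> t)) - 0) (at t within J)"
        using sol t unfolding solves2_def by (intro DERIV_diff DERIV_const; blast)+
      then show "\<exists>D. ((\<lambda>t. R t - \<rho>\<^sub>0) has_real_derivative D) (at t within J) \<and>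
          \<bar>D - t powr (- real n / real q) * \<Lambda> n (R t, \<Psi> t)\<bar> \<le> C * t powr (- real (Suc n) / real q)"
        "\<exists>D. ((\<lambda>t. \<Psi> t - \<phi>\<^sub>0) has_real_derivative D) (at t within J) \<and>
          \<bar>D - t powr (- real m / real q) * \<Omega> m (R t, \<Psi> t)\<bar> \<le> C * t powr (- real (Suc m) / real q)"
        using mono[OF disjI1[OF C1(2)[rule_format, OF t1 y]]] mono[OF disjI2[OF C2(2)[rule_format, OF t1 y]]]
        unfolding trunc_def fst_conv snd_conv diff_0_right by blast+
    qed (use C in auto)
  qed
qed

lemma trunc_perturbed:
  assumes N: "max n m \<le> N"
  shows "perturbed_equilibrium q n m l \<nu> \<eta> w \<rho>\<^sub>0 \<phi>\<^sub>0 b (trunc N)"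
proof
  show "n \<in> {1..q}" "m \<in> {1..q}" "0 < b" by (fact n m b(1))+
  have cont: "continuous_on ({0<..} \<times> nbhd) (\<lambda>x. \<Sum>k=1..N. fst x powr (- real k / real q) * L k (snd x))"
    if "\<And>k. 1 \<le> k \<Longrightarrow> smooth_on (strip \<R>) (L k)" for L :: "nat \<Rightarrow> real \<times> real \<Rightarrow> real"
  proof (intro continuous_on_sum continuous_on_mult)
    fix k assume "k \<in> {1..N}"
    then have "continuous_on nbhd (L k)"
      using continuous_on_subset[OF smooth_on_continuous[OF that] nbhd(3)] by auto
    then show "continuous_on ({0<..} \<times> nbhd) (\<lambda>x. L k (snd x))"
      by (rule continuous_on_compose2) (auto intro!: continuous_intros)
    show "continuous_on ({0<..} \<times> nbhd) (\<lambda>x. fst x powr (- real k / real q))"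
      by (intro continuous_intros) auto
  qed
  show "continuous_on ({0<..} \<times> nbhd) (\<lambda>(t, y). trunc N t y)"
    unfolding trunc_def case_prod_beta by (intro continuous_on_Pair cont smooth_averaged)
  show "\<exists>L. \<forall>t\<in>{a..c}. \<forall>y\<in>nbhd. \<forall>z\<in>nbhd. norm (trunc N t y - trunc N t z) \<le> L * norm (y - z)" if a: "0 < a" for a c
  proof -
    have *: "\<exists>K. \<forall>t\<in>{a..c}. \<forall>y\<in>nbhd. \<forall>z\<in>nbhd.
        \<bar>(\<Sum>k=1..N. t powr (- real k / real q) * L k y) - (\<Sum>k=1..N. t powr (- real k / real q) * L k z)\<bar> \<le> K * norm (y - z)"
      if L: "\<And>k. 1 \<le> k \<Longrightarrow> smooth_on (strip \<R>) (L k)" for L :: "nat \<Rightarrow> real \<times> real \<Rightarrow> real"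
    proof -
      have "\<exists>B\<ge>0. \<forall>y\<in>nbhd. \<forall>z\<in>nbhd. \<bar>L k y - L k z\<bar> \<le> B * norm (y - z)" if "1 \<le> k" for k
        by (rule smooth_on_lipschitz[OF L[OF that] nbhd])
      then obtain B where B: "\<And>k. 1 \<le> k \<Longrightarrow> 0 \<le> B k" "\<And>k y z. 1 \<le> k \<Longrightarrow> y \<in> nbhd \<Longrightarrow> z \<in> nbhd \<Longrightarrow> \<bar>L k y - L k z\<bar> \<le> B k * norm (y - z)"
        by metis
      have "\<bar>(\<Sum>k=1..N. t powr (- real k / real q) * L k y) - (\<Sum>k=1..N. t powr (- real k / real q) * L k z)\<bar>
          \<le> (\<Sum>k=1..N. a powr (- real k / real q) * B k) * norm (y - z)"
        if t: "t \<in> {a..c}" and yz: "y \<in> nbhd" "z \<in> nbhd" for t y z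
      proof -
        have "\<bar>(\<Sum>k=1..N. t powr (- real k / real q) * L k y) - (\<Sum>k=1..N. t powr (- real k / real q) * L k z)\<bar>
          = \<bar>\<Sum>k=1..N. t powr (- real k / real q) * (L k y - L k z)\<bar>"
          by (simp only: sum_subtractf right_diff_distrib)
        also have "\<dots> \<le> (\<Sum>k=1..N. \<bar>t powr (- real k / real q) * (L k y - L k z)\<bar>)" by (rule sum_abs)
        also have "\<dots> \<le> (\<Sum>k=1..N. a powr (- real k / real q) * (B k * norm (y - z)))"
        proof (rule sum_mono)
          fix k assume "k \<in> {1..N}"
          then have k: "1 \<le> k" by simp
          have "t powr (- real k / real q) \<le> a powr (- real k / real q)"
            using a t by (intro powr_mono2') auto
          then show "\<bar>t powr (- real k / real q) * (L k y - L k z)\<bar> \<le> a powr (- real k / real q) * (B k * norm (y - z))"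
            unfolding abs_mult using B(2)[OF k yz] by (intro mult_mono) auto
        qed
        also have "\<dots> = (\<Sum>k=1..N. a powr (- real k / real q) * B k) * norm (y - z)"
          by (simp add: sum_distrib_right mult.assoc)
        finally show ?thesis .
      qed
      then show ?thesis by blast
    qed
    have "\<exists>K. \<forall>t\<in>{a..c}. \<forall>y\<in>nbhd. \<forall>z\<in>nbhd. \<bar>fst (trunc N t y) - fst (trunc N t z)\<bar> \<le> K * norm (y - z)"
      unfolding trunc_def fst_conv by (rule *) (rule smooth_averaged(3))
    then obtain K1 where K1: "\<forall>t\<in>{a..c}. \<forall>y\<in>nbhd. \<forall>z\<in>nbhd. \<bar>fst (trunc N t y) - fst (trunc N t z)\<bar> \<le> K1 * norm (y - z)"
      by (elim exE) (rule that)
    have "\<exists>K. \<forall>t\<in>{a..c}. \<forall>y\<in>nbhd. \<forall>z\<in>nbhd. \<bar>snd (trunc N t y) - snd (trunc N t z)\<bar> \<le> K * norm (y - z)"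
      unfolding trunc_def snd_conv by (rule *) (rule smooth_averaged(4))
    then obtain K2 where K2: "\<forall>t\<in>{a..c}. \<forall>y\<in>nbhd. \<forall>z\<in>nbhd. \<bar>snd (trunc N t y) - snd (trunc N t z)\<bar> \<le> K2 * norm (y - z)"
      by (elim exE) (rule that)
    have "norm (trunc N t y - trunc N t z) \<le> (K1 + K2) * norm (y - z)"
      if "t \<in> {a..c}" "y \<in> nbhd" "z \<in> nbhd" for t y z
    proof -
      have "norm (trunc N t y - trunc N t z) \<le> \<bar>fst (trunc N t y) - fst (trunc N t z)\<bar> + \<bar>snd (trunc N t y) - snd (trunc N t z)\<bar>"
        using sqrt_sum_squares_le_sum_abs[of "fst (trunc N t y - trunc N t z)" "snd (trunc N t y - trunc N t z)"] by (simp add: norm_prod_def)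
      also have "\<dots> \<le> K1 * norm (y - z) + K2 * norm (y - z)" using K1 K2 that by (intro add_mono) blast+
      finally show ?thesis by (simp only: distrib_right)
    qed
    then show ?thesis by blast
  qed
  fix \<mu> :: real assume "0 < \<mu>"
  then show "\<exists>r>0. \<exists>C\<ge>0. \<exists>T\<ge>1. reduces q n m l \<nu> \<eta> w \<rho>\<^sub>0 \<phi>\<^sub>0 (trunc N) \<mu> r C T"
    by (rule reduction_if_leading[OF trunc_leading[OF N]])
qed

lemma S_continuous: "continuous_on {0<..} S"
  by (rule smooth_on_continuous[OF smooth(5)])

lemma field_perturbed: "perturbed_equilibrium q n m l \<nu> \<eta> w \<rho>\<^sub>0 \<phi>\<^sub>0 b field"
proof
  show "n \<in> {1..q}" "m \<in> {1..q}" "0 < b" by (fact n m b(1))+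
  have cont: "continuous_on ({0<..} \<times> nbhd) (\<lambda>x. h (fst (snd x), c * S (fst x) + snd (snd x), S (fst x)) (fst x))"
    if h: "smooth_on (strip \<R> \<times> {0<..}) (\<lambda>(x, t). h x t)" for h :: "real \<times> real \<times> real \<Rightarrow> real \<Rightarrow> real"
  proof -
    have Sc: "continuous_on ({0<..} \<times> nbhd) (\<lambda>x. S (fst x))"
      by (rule continuous_on_compose2[OF S_continuous]) (auto intro!: continuous_intros)
    have "continuous_on ({0<..} \<times> nbhd) (\<lambda>x. (\<lambda>(x, t). h x t) ((fst (snd x), c * S (fst x) + snd (snd x), S (fst x)), fst x))"
      by (rule continuous_on_compose2[OF smooth_on_continuous[OF h]])
        (use nbhd(3) kappa'_nonzero in \<open>auto intro!: continuous_intros Sc\<close>)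
    then show ?thesis by simp
  qed
  have S'c: "continuous_on ({0<..} \<times> nbhd) (\<lambda>x. deriv S (fst x))"
    by (rule continuous_on_compose2[OF deriv_S_continuous]) (auto intro!: continuous_intros)
  show "continuous_on ({0<..} \<times> nbhd) (\<lambda>(t, y). field t y)"
    unfolding field_def case_prod_beta
    by (intro continuous_on_Pair continuous_on_diff continuous_on_add continuous_on_mult continuous_on_const S'c cont smooth)
  show "\<exists>L. \<forall>t\<in>{a..d}. \<forall>y\<in>nbhd. \<forall>z\<in>nbhd. norm (field t y - field t z) \<le> L * norm (y - z)" if a: "0 < a" for a d
  proof -
    have "compact (S ` {a..d})"
      by (intro compact_continuous_image continuous_on_subset[OF S_continuous]) (use a in auto)
    then have "bounded (S ` {a..d})" by (rule compact_imp_bounded)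
    then obtain B where "\<forall>x\<in>S ` {a..d}. norm x \<le> B" unfolding bounded_iff by (elim exE) (rule that)
    then have B: "\<bar>S t\<bar> \<le> B" if "t \<in> {a..d}" for t using that by simp
    \<comment> \<open>Bounds the angle \<open>c * S t + \<Psi>\<close> on the time interval, so that
      \<open>Q\<close> is a compact convex box containing all arguments of \<open>f\<close> and
      \<open>g\<close>.\<close>
    define \<Phi> where "\<Phi> = \<bar>c\<bar> * B + \<bar>\<phi>\<^sub>0\<bar> + b"
    define Q where "Q = ({\<rho>\<^sub>0 - b..\<rho>\<^sub>0 + b} \<times> {- \<Phi>..\<Phi>} \<times> {- B..B}) \<times> {a..d}"
    have Q: "compact Q" "convex Q" "Q \<subseteq> strip \<R> \<times> {0<..}"
    proof -
      show "compact Q" unfolding Q_def by (intro compact_Times compact_Icc)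
      show "convex Q" unfolding Q_def by (intro convex_Times convex_real_interval)
      show "Q \<subseteq> strip \<R> \<times> {0<..}" unfolding Q_def
        by (intro Sigma_mono subset_UNIV) (use b(2,3) a in auto)
    qed
    have *: "\<exists>K. \<forall>t\<in>{a..d}. \<forall>y\<in>nbhd. \<forall>z\<in>nbhd.
        \<bar>h (fst y, c * S t + snd y, S t) t - h (fst z, c * S t + snd z, S t) t\<bar> \<le> K * norm (y - z)"
      if h: "smooth_on (strip \<R> \<times> {0<..}) (\<lambda>(x, t). h x t)" for h :: "real \<times> real \<times> real \<Rightarrow> real \<Rightarrow> real"
    proof -
      obtain K where K: "\<And>x y. x \<in> Q \<Longrightarrow> y \<in> Q \<Longrightarrow> \<bar>(\<lambda>(x, t). h x t) x - (\<lambda>(x, t). h x t) y\<bar> \<le> K * norm (x - y)"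
        using smooth_on_lipschitz[OF h Q] by blast
      have inQ: "((fst y, c * S t + snd y, S t), t) \<in> Q" if t: "t \<in> {a..d}" and y: "y \<in> nbhd" for t y
      proof -
        have "\<bar>c * S t\<bar> \<le> \<bar>c\<bar> * B" unfolding abs_mult by (intro mult_left_mono B t) auto
        moreover have "\<bar>snd y\<bar> \<le> \<bar>\<phi>\<^sub>0\<bar> + b" using y by auto
        ultimately have "\<bar>c * S t + snd y\<bar> \<le> \<Phi>" unfolding \<Phi>_def by linarith
        then show ?thesis using B[OF t] t y by (auto simp: Q_def abs_le_iff)
      qed
      have "\<bar>h (fst y, c * S t + snd y, S t) t - h (fst z, c * S t + snd z, S t) t\<bar> \<le> K * norm (y - z)"
        if t: "t \<in> {a..d}" and yz: "y \<in> nbhd" "z \<in> nbhd" for t y z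
      proof -
        \<comment> \<open>The two arguments differ in amplitude and phase only; the shift
          \<open>c * S t\<close>, the value \<open>S t\<close> and the time cancel.\<close>
        have "norm (((fst y, c * S t + snd y, S t), t) - ((fst z, c * S t + snd z, S t), t)) = norm (y - z)"
          by (simp add: norm_prod_def)
        then show ?thesis using K[OF inQ[OF t yz(1)] inQ[OF t yz(2)]] by simp
      qed
      then show ?thesis by blast
    qed
    obtain K1 where K1: "\<forall>t\<in>{a..d}. \<forall>y\<in>nbhd. \<forall>z\<in>nbhd.
        \<bar>f (fst y, c * S t + snd y, S t) t - f (fst z, c * S t + snd z, S t) t\<bar> \<le> K1 * norm (y - z)"
      using *[OF smooth(1)] by (elim exE) (rule that)
    obtain K2 where K2: "\<forall>t\<in>{a..d}. \<forall>y\<in>nbhd. \<forall>z\<in>nbhd.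
        \<bar>g (fst y, c * S t + snd y, S t) t - g (fst z, c * S t + snd z, S t) t\<bar> \<le> K2 * norm (y - z)"
      using *[OF smooth(2)] by (elim exE) (rule that)
    have "norm (field t y - field t z) \<le> (K1 + K2) * norm (y - z)"
      if "t \<in> {a..d}" "y \<in> nbhd" "z \<in> nbhd" for t y z
    proof -
      have "norm (field t y - field t z) \<le> \<bar>f (fst y, c * S t + snd y, S t) t - f (fst z, c * S t + snd z, S t) t\<bar>
          + \<bar>g (fst y, c * S t + snd y, S t) t - g (fst z, c * S t + snd z, S t) t\<bar>"
        using sqrt_sum_squares_le_sum_abs[of "fst (field t y - field t z)" "snd (field t y - field t z)"]
        by (simp add: norm_prod_def field_def)
      also have "\<dots> \<le> K1 * norm (y - z) + K2 * norm (y - z)" using K1 K2 that by (intro add_mono) blast+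
      finally show ?thesis by (simp only: distrib_right)
    qed
    then show ?thesis by blast
  qed
  fix \<mu> :: real assume "0 < \<mu>"
  then show "\<exists>r>0. \<exists>C\<ge>0. \<exists>T\<ge>1. reduces q n m l \<nu> \<eta> w \<rho>\<^sub>0 \<phi>\<^sub>0 field \<mu> r C T"
    by (rule reduction_if_leading[OF field_leading])
qed

lemma truncated_solution_iff:
  "truncated_solution \<R> q N \<Lambda> \<Omega> J \<rho> \<phi> \<longleftrightarrow> (\<forall>t\<in>J. \<rho> t \<in> {0<..\<R>}) \<and> solves2 (trunc N) J \<rho> \<phi>"
  by (auto simp: truncated_solution_def solves_on_def solves2_def trunc_def)

text \<open>Passing between \<open>\<phi>\<close> and \<open>\<Psi>\<close> adds or removes
  \<open>c * S\<close>, which is differentiable at positive times.\<close>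

lemma full_solution_iff:
  assumes J: "J \<subseteq> {0<..}"
  shows "full_solution \<omega> \<R> S f g J \<rho> \<phi> \<longleftrightarrow>
    (\<forall>t\<in>J. \<rho> t \<in> {0<..\<R>}) \<and> solves2 field J \<rho> (\<lambda>t. \<phi> t - c * S t)"
proof -
  have "(\<phi> has_real_derivative \<omega> + g (\<rho> t, \<phi> t, S t) t) (at t within J) \<longleftrightarrow>
    ((\<lambda>t. \<phi> t - c * S t) has_real_derivative \<omega> + g (\<rho> t, \<phi> t, S t) t - c * deriv S t) (at t within J)" if t: "t \<in> J" for t
  proof -
    have S': "((\<lambda>t. c * S t) has_real_derivative c * deriv S t) (at t within J)"
      using t J by (intro DERIV_cmult DERIV_subset[OF S_derivative]) auto
    have "((\<lambda>t. (\<phi> t - c * S t) + c * S t) has_real_derivative \<omega> + g (\<rho> t, \<phi> t, S t) t - c * deriv S t + c * deriv S t) (at t within J)"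
      if "((\<lambda>t. \<phi> t - c * S t) has_real_derivative \<omega> + g (\<rho> t, \<phi> t, S t) t - c * deriv S t) (at t within J)"
      by (rule DERIV_add[OF that S'])
    then show ?thesis using DERIV_diff[OF _ S'] by auto
  qed
  then show ?thesis
    by (auto simp: full_solution_def solves_on_def solves2_def field_def)
qed

end

text \<open>\<open>X\<close> is the real part of the square root of the discriminant. Either its
  square is the discriminant, or the discriminant is negative, which by itself makes the determinant
  positive.\<close>

lemma beta_equal_rates:
  fixes l \<nu> \<eta> w :: real
  shows "\<exists>X\<ge>0. beta1 q n n l \<nu> \<eta> w = (l + w + X) / 2 \<and> beta2 q n n l \<nu> \<eta> w = (l + w - X) / 2 \<and>
    (X\<^sup>2 = (l + w)\<^sup>2 - 4 * det2 l \<nu> \<eta> w \<or> (l + w)\<^sup>2 < 4 * det2 l \<nu> \<eta> w)"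
proof -
  define d where "d = (l + w)\<^sup>2 - 4 * det2 l \<nu> \<eta> w"
  define X where "X = Re (csqrt (of_real d))"
  have "0 \<le> X" by (simp add: X_def csqrt.simps)
  moreover have "beta1 q n n l \<nu> \<eta> w = (l + w + X) / 2" "beta2 q n n l \<nu> \<eta> w = (l + w - X) / 2"
    by (simp_all add: beta1_def beta2_def alpha1_def alpha2_def d_def X_def)
  moreover have "X\<^sup>2 = d \<or> (l + w)\<^sup>2 < 4 * det2 l \<nu> \<eta> w"
  proof (cases "0 \<le> d")
    case True
    then have "X = sqrt d" unfolding X_def by (subst csqrt_of_real_nonneg) auto
    then show ?thesis using True by simp
  next
    case False
    then show ?thesis by (simp add: d_def)
  qed
  ultimately show ?thesis unfolding d_def by blast
qed

text \<open>For equal orders \<open>X < - (l + w)\<close>, hence \<open>X^2 < (l + w)^2\<close>,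
  which makes the determinant positive. For distinct orders the smaller one is not \<open>q\<close>,
  so the fast \<beta> is uncorrected; the correction of the slow one is nonnegative, and dropping it
  preserves the negative sign.\<close>

lemma signs_if_beta_neg:
  assumes n: "n \<in> {1..q}" and m: "m \<in> {1..q}"
    and nz: "n < m \<Longrightarrow> l \<noteq> 0" "m < n \<Longrightarrow> w \<noteq> 0"
    and neg: "beta1 q n m l \<nu> \<eta> w < 0" "beta2 q n m l \<nu> \<eta> w < 0"
  shows "0 < l * w - \<nu> * \<eta> \<and> ((n = m \<longrightarrow> l + w < 0) \<and> (n < m \<longrightarrow> l < 0) \<and> (m < n \<longrightarrow> w < 0))"
proof -
  consider "n = m" | "n < m" | "m < n" by linarith
  then show ?thesis
  proof cases
    case 1
    obtain X where X: "0 \<le> X" "(l + w + X) / 2 < 0"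
      "X\<^sup>2 = (l + w)\<^sup>2 - 4 * det2 l \<nu> \<eta> w \<or> (l + w)\<^sup>2 < 4 * det2 l \<nu> \<eta> w"
      using beta_equal_rates[of q n l \<nu> \<eta> w] neg unfolding 1 by auto
    have "l + w + X < 0" using X(2) by simp
    then have "X < - (l + w)" by linarith
    then have "X\<^sup>2 < (l + w)\<^sup>2" using X(1) power_strict_mono[of X "- (l + w)" 2] by (simp only: power2_minus)
    then have "0 < det2 l \<nu> \<eta> w" using X(3) zero_le_power2[of "l + w"] by linarith
    then show ?thesis using X(1,2) 1 by (auto simp: det2_def)
  next
    case 2
    then have "n \<noteq> q" using m by auto
    then have l: "l < 0" using neg(1) 2 by (simp add: beta1_def alpha1_def)
    have "0 \<le> (real m - real n) / (2 * real q) * of_bool (m = q)" using 2 by simp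
    moreover have "beta2 q n m l \<nu> \<eta> w = det2 l \<nu> \<eta> w / l + (real m - real n) / (2 * real q) * of_bool (m = q)"
      using 2 by (simp add: beta2_def alpha2_def)
    ultimately have "det2 l \<nu> \<eta> w / l < 0" using neg(2) by linarith
    then show ?thesis using l 2 by (simp add: det2_def divide_less_0_iff)
  next
    case 3
    then have "m \<noteq> q" using n by auto
    then have w: "w < 0" using neg(2) 3 by (simp add: beta2_def alpha2_def)
    have "0 \<le> (real n - real m) / (2 * real q) * of_bool (n = q)" using 3 by simp
    moreover have "beta1 q n m l \<nu> \<eta> w = det2 l \<nu> \<eta> w / w + (real n - real m) / (2 * real q) * of_bool (n = q)"
      using 3 by (simp add: beta1_def alpha1_def)
    ultimately have "det2 l \<nu> \<eta> w / w < 0" using neg(1) by linarith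
    then show ?thesis using w 3 by (simp add: det2_def divide_less_0_iff)
  qed
qed

text \<open>\<open>max n m < q\<close> removes the corrections; being nonnegative, they could
  otherwise make a \<beta> positive with a negative \<alpha>.\<close>

lemma signs_if_beta_pos:
  assumes q: "max n m < q"
    and pos: "beta1 q n m l \<nu> \<eta> w > 0" "beta2 q n m l \<nu> \<eta> w > 0"
  shows "0 < l * w - \<nu> * \<eta> \<and> ((n = m \<longrightarrow> 0 < l + w) \<and> (n < m \<longrightarrow> 0 < l) \<and> (m < n \<longrightarrow> 0 < w))"
proof -
  have nq: "n \<noteq> q" "m \<noteq> q" using q by auto
  consider "n = m" | "n < m" | "m < n" by linarith
  then show ?thesis
  proof cases
    case 1
    obtain X where X: "0 \<le> X" "(l + w - X) / 2 > 0"
      "X\<^sup>2 = (l + w)\<^sup>2 - 4 * det2 l \<nu> \<eta> w \<or> (l + w)\<^sup>2 < 4 * det2 l \<nu> \<eta> w"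
      using beta_equal_rates[of q n l \<nu> \<eta> w] pos unfolding 1 by auto
    have "X < l + w" using X(2) by simp
    then have "X\<^sup>2 < (l + w)\<^sup>2" using X(1) by (intro power_strict_mono) auto
    then have "0 < det2 l \<nu> \<eta> w" using X(3) zero_le_power2[of "l + w"] by linarith
    then show ?thesis using X(1,2) 1 by (auto simp: det2_def)
  next
    case 2
    have l: "0 < l" using pos(1) 2 nq by (simp add: beta1_def alpha1_def)
    have "0 < det2 l \<nu> \<eta> w / l" using pos(2) 2 nq by (simp add: beta2_def alpha2_def)
    then show ?thesis using l 2 by (simp add: det2_def zero_less_divide_iff)
  next
    case 3
    have w: "0 < w" using pos(2) 3 nq by (simp add: beta2_def alpha2_def)
    have "0 < det2 l \<nu> \<eta> w / w" using pos(1) 3 nq by (simp add: beta1_def alpha1_def)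
    then show ?thesis using w 3 by (simp add: det2_def zero_less_divide_iff)
  qed
qed

text \<open>A solution is a pair on an arbitrary interval starting at \<open>t\<^sub>s\<close> and
  is not assumed to last. Part (i) therefore includes its extension to \<open>{t\<^sub>s..}\<close>
  within the domain, and the bound is stated for the extension. In part (ii) the solution has to
  last only until \<open>t\<^sub>e\<close>.\<close>

theorem theorem2:
  fixes \<omega> \<R> \<rho>\<^sub>0 \<phi>\<^sub>0 l \<nu> \<eta> w :: real and q n m :: nat and \<kappa> \<kappa>' :: int
    and S :: "real \<Rightarrow> real" and s :: "nat \<Rightarrow> real"
    and f g :: "real \<times> real \<times> real \<Rightarrow> real \<Rightarrow> real"
    and fc gc u v :: "nat \<Rightarrow> real \<times> real \<times> real \<Rightarrow> real"
    and \<Lambda> \<Omega> :: "nat \<Rightarrow> real \<times> real \<Rightarrow> real"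
  assumes standing: "standing_assumptions \<omega> \<R> q \<kappa> \<kappa>' S s f g fc gc"
    and averaged: "averaged_coefficients \<R> q \<kappa> \<kappa>' s fc gc u v \<Lambda> \<Omega>"
    and n: "n \<in> {1..q}" and m: "m \<in> {1..q}"
    and \<Lambda>_below: "\<forall>k\<in>{1..<n}. \<forall>y\<in>strip \<R>. \<Lambda> k y = 0" and \<Lambda>_n: "\<exists>y\<in>strip \<R>. \<Lambda> n y \<noteq> 0"
    and \<Omega>_below: "\<forall>k\<in>{1..<m}. \<forall>y\<in>strip \<R>. \<Omega> k y = 0" and \<Omega>_m: "\<exists>y\<in>strip \<R>. \<Omega> m y \<noteq> 0"
    and \<rho>\<^sub>0: "\<rho>\<^sub>0 \<in> {0<..<\<R>}"
    and equilibrium: "\<Lambda> n (\<rho>\<^sub>0, \<phi>\<^sub>0) = 0" "\<Omega> m (\<rho>\<^sub>0, \<phi>\<^sub>0) = 0"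
    and l: "l = pdiff (strip \<R>) (1, 0) (\<Lambda> n) (\<rho>\<^sub>0, \<phi>\<^sub>0)"
    and \<nu>: "\<nu> = pdiff (strip \<R>) (0, 1) (\<Lambda> n) (\<rho>\<^sub>0, \<phi>\<^sub>0)"
    and \<eta>: "\<eta> = pdiff (strip \<R>) (1, 0) (\<Omega> m) (\<rho>\<^sub>0, \<phi>\<^sub>0)"
    and w: "w = pdiff (strip \<R>) (0, 1) (\<Omega> m) (\<rho>\<^sub>0, \<phi>\<^sub>0)"
    and nondegenerate: "det2 l \<nu> \<eta> w \<noteq> 0" "n < m \<Longrightarrow> l \<noteq> 0" "m < n \<Longrightarrow> w \<noteq> 0"
  shows
    "(beta1 q n m l \<nu> \<eta> w < 0 \<and> beta2 q n m l \<nu> \<eta> w < 0 \<longrightarrow>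
       (\<forall>N\<ge>max n m.
          (\<exists>t\<^sub>0>0. \<exists>\<rho>' \<phi>'. truncated_solution \<R> q N \<Lambda> \<Omega> {t\<^sub>0..} \<rho>' \<phi>' \<and>
             (\<rho>' \<longlongrightarrow> \<rho>\<^sub>0) at_top \<and> (\<phi>' \<longlongrightarrow> \<phi>\<^sub>0) at_top) \<and>
          (\<forall>t\<^sub>0>0. \<forall>\<rho>' \<phi>'. truncated_solution \<R> q N \<Lambda> \<Omega> {t\<^sub>0..} \<rho>' \<phi>' \<and>
             (\<rho>' \<longlongrightarrow> \<rho>\<^sub>0) at_top \<and> (\<phi>' \<longlongrightarrow> \<phi>\<^sub>0) at_top \<longrightarrow>
             (\<forall>\<epsilon>>0. \<exists>\<delta>\<in>{0<..<\<epsilon>}. \<exists>t\<^sub>\<epsilon>>0. \<forall>t\<^sub>s\<ge>t\<^sub>\<epsilon>. \<forall>J \<rho> \<phi>.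
                is_interval J \<and> t\<^sub>s \<in> J \<and> J \<subseteq> {t\<^sub>s..} \<and> full_solution \<omega> \<R> S f g J \<rho> \<phi> \<and>
                \<bar>\<rho> t\<^sub>s - \<rho>' t\<^sub>s\<bar> + \<bar>\<phi> t\<^sub>s - of_int \<kappa> / of_int \<kappa>' * S t\<^sub>s - \<phi>' t\<^sub>s\<bar> \<le> \<delta> \<longrightarrow>
                (\<exists>r p. full_solution \<omega> \<R> S f g {t\<^sub>s..} r p \<and> (\<forall>t\<in>J. r t = \<rho> t \<and> p t = \<phi> t) \<and>
                   (\<forall>t>t\<^sub>s. \<bar>r t - \<rho>' t\<bar> + \<bar>p t - of_int \<kappa> / of_int \<kappa>' * S t - \<phi>' t\<bar> < \<epsilon>))))))
     \<and>
     (beta1 q n m l \<nu> \<eta> w > 0 \<and> beta2 q n m l \<nu> \<eta> w > 0 \<and> max n m < q \<longrightarrow>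
       (\<exists>\<epsilon>>0. \<exists>T>0. \<forall>\<delta>\<in>{0<..<\<epsilon>}. \<exists>t\<^sub>s\<ge>T. \<exists>t\<^sub>e>t\<^sub>s. \<exists>\<rho> \<phi>.
          full_solution \<omega> \<R> S f g {t\<^sub>s..t\<^sub>e} \<rho> \<phi> \<and>
          \<bar>\<rho> t\<^sub>s - \<rho>\<^sub>0\<bar> + \<bar>\<phi> t\<^sub>s - of_int \<kappa> / of_int \<kappa>' * S t\<^sub>s - \<phi>\<^sub>0\<bar> \<le> \<delta> \<and>
          \<bar>\<rho> t\<^sub>e - \<rho>\<^sub>0\<bar> + \<bar>\<phi> t\<^sub>e - of_int \<kappa> / of_int \<kappa>' * S t\<^sub>e - \<phi>\<^sub>0\<bar> \<ge> \<epsilon>))"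
proof -
  interpret averaged_equilibrium \<omega> \<R> q \<kappa> \<kappa>' S s f g fc gc u v \<Lambda> \<Omega> n m \<rho>\<^sub>0 \<phi>\<^sub>0 l \<nu> \<eta> w
    by unfold_locales (fact standing averaged n m \<Lambda>_below \<Omega>_below \<rho>\<^sub>0 equilibrium l \<nu> \<eta> w)+
  \<comment> \<open>A margin for the deviation that keeps the amplitude in
    \<open>{0<..\<R>}\<close>.\<close>
  define \<epsilon>0 where "\<epsilon>0 = min \<rho>\<^sub>0 (\<R> - \<rho>\<^sub>0) / 2"
  have \<epsilon>0: "0 < \<epsilon>0" using \<rho>\<^sub>0 by (auto simp: \<epsilon>0_def)
  have range: "R \<in> {0<..\<R>}" if "\<bar>R - \<rho>\<^sub>0\<bar> + \<bar>\<Psi> - \<phi>\<^sub>0\<bar> \<le> \<epsilon>0" for R \<Psi>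
  proof -
    have "\<bar>R - \<rho>\<^sub>0\<bar> \<le> \<epsilon>0" using that abs_ge_zero[of "\<Psi> - \<phi>\<^sub>0"] by linarith
    moreover have "\<epsilon>0 < \<rho>\<^sub>0" "\<epsilon>0 < \<R> - \<rho>\<^sub>0" using \<rho>\<^sub>0 by (auto simp: \<epsilon>0_def min_def)
    ultimately show ?thesis by (auto simp: abs_le_iff)
  qed
  show ?thesis
  proof (intro conjI impI allI)
    fix N
    assume "beta1 q n m l \<nu> \<eta> w < 0 \<and> beta2 q n m l \<nu> \<eta> w < 0" and N: "max n m \<le> N"
    then have signs: "0 < l * w - \<nu> * \<eta>" "(n = m \<longrightarrow> l + w < 0) \<and> (n < m \<longrightarrow> l < 0) \<and> (m < n \<longrightarrow> w < 0)"
      using signs_if_beta_neg[OF n m nondegenerate(2,3)] by blast+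
    interpret T: stable_equilibrium q n m l \<nu> \<eta> w \<rho>\<^sub>0 \<phi>\<^sub>0 b "trunc N"
      using trunc_perturbed[OF N] signs by (simp add: stable_equilibrium_def stable_equilibrium_axioms_def)
    obtain a R \<Psi> where a: "0 < a" and sol: "solves2 (trunc N) {a..} R \<Psi>" "(R \<longlongrightarrow> \<rho>\<^sub>0) at_top" "(\<Psi> \<longlongrightarrow> \<phi>\<^sub>0) at_top"
      and near: "\<forall>t\<ge>a. \<bar>R t - \<rho>\<^sub>0\<bar> + \<bar>\<Psi> t - \<phi>\<^sub>0\<bar> < \<epsilon>0"
      using T.convergent_solution[OF \<epsilon>0] by blast
    have "R t \<in> {0<..\<R>}" if "t \<in> {a..}" for t
      by (rule range[OF less_imp_le, of _ "\<Psi> t"]) (use near that in auto)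
    then have "truncated_solution \<R> q N \<Lambda> \<Omega> {a..} R \<Psi>"
      using sol(1) unfolding truncated_solution_iff by blast
    then show "\<exists>t\<^sub>0>0. \<exists>\<rho>' \<phi>'. truncated_solution \<R> q N \<Lambda> \<Omega> {t\<^sub>0..} \<rho>' \<phi>' \<and>
             (\<rho>' \<longlongrightarrow> \<rho>\<^sub>0) at_top \<and> (\<phi>' \<longlongrightarrow> \<phi>\<^sub>0) at_top"
      using a sol(2,3) by blast
  next
    fix N t\<^sub>0 \<rho>' \<phi>' \<epsilon>
    assume neg: "beta1 q n m l \<nu> \<eta> w < 0 \<and> beta2 q n m l \<nu> \<eta> w < 0"
      and h: "truncated_solution \<R> q N \<Lambda> \<Omega> {t\<^sub>0..} \<rho>' \<phi>' \<and> (\<rho>' \<longlongrightarrow> \<rho>\<^sub>0) at_top \<and> (\<phi>' \<longlongrightarrow> \<phi>\<^sub>0) at_top"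
      and \<epsilon>: "0 < (\<epsilon> :: real)"
    have signs: "0 < l * w - \<nu> * \<eta>" "(n = m \<longrightarrow> l + w < 0) \<and> (n < m \<longrightarrow> l < 0) \<and> (m < n \<longrightarrow> w < 0)"
      using neg signs_if_beta_neg[OF n m nondegenerate(2,3)] by blast+
    interpret F: stable_equilibrium q n m l \<nu> \<eta> w \<rho>\<^sub>0 \<phi>\<^sub>0 b field
      using field_perturbed signs by (simp add: stable_equilibrium_def stable_equilibrium_axioms_def)
    \<comment> \<open>\<open>\<epsilon> / 2\<close> leaves room for the deviation of the truncated
      solution, and \<open>\<epsilon>0\<close> keeps the continued solution in the domain.\<close>
    have "0 < min \<epsilon>0 (\<epsilon> / 2)" using \<epsilon>0 \<epsilon> by simp
    from F.stability[OF this] obtain \<delta> T where \<delta>: "\<delta> \<in> {0<..<min \<epsilon>0 (\<epsilon> / 2)}" and T: "0 < T"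
      and stab: "\<forall>a\<ge>T. \<forall>J R \<Psi>. is_interval J \<and> a \<in> J \<and> J \<subseteq> {a..} \<and> solves2 field J R \<Psi> \<and>
      \<bar>R a - \<rho>\<^sub>0\<bar> + \<bar>\<Psi> a - \<phi>\<^sub>0\<bar> \<le> \<delta> \<longrightarrow>
      (\<exists>R' \<Psi>'. solves2 field {a..} R' \<Psi>' \<and> (\<forall>t\<in>J. R' t = R t \<and> \<Psi>' t = \<Psi> t) \<and>
         (\<forall>t\<ge>a. \<bar>R' t - \<rho>\<^sub>0\<bar> + \<bar>\<Psi>' t - \<phi>\<^sub>0\<bar> < min \<epsilon>0 (\<epsilon> / 2)))"
      by (elim bexE exE conjE) (rule that)
    have "((\<lambda>t. \<bar>\<rho>' t - \<rho>\<^sub>0\<bar> + \<bar>\<phi>' t - \<phi>\<^sub>0\<bar>) \<longlongrightarrow> \<bar>\<rho>\<^sub>0 - \<rho>\<^sub>0\<bar> + \<bar>\<phi>\<^sub>0 - \<phi>\<^sub>0\<bar>) at_top"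
      using h by (intro tendsto_intros) auto
    then have "\<forall>\<^sub>F t in at_top. \<bar>\<rho>' t - \<rho>\<^sub>0\<bar> + \<bar>\<phi>' t - \<phi>\<^sub>0\<bar> < \<delta> / 2"
      by (rule order_tendstoD) (use \<delta> in simp)
    then obtain T1 where T1: "\<And>t. T1 \<le> t \<Longrightarrow> \<bar>\<rho>' t - \<rho>\<^sub>0\<bar> + \<bar>\<phi>' t - \<phi>\<^sub>0\<bar> < \<delta> / 2"
      by (auto simp: eventually_at_top_linorder)
    have tri: "\<bar>p - x\<bar> + \<bar>p' - x'\<bar> \<le> k + k'" if "\<bar>p - y\<bar> + \<bar>p' - y'\<bar> \<le> k" "\<bar>x - y\<bar> + \<bar>x' - y'\<bar> \<le> k'"
      for p p' x x' y y' k k' :: real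
    proof -
      have "\<bar>p - x\<bar> \<le> \<bar>p - y\<bar> + \<bar>x - y\<bar>" "\<bar>p' - x'\<bar> \<le> \<bar>p' - y'\<bar> + \<bar>x' - y'\<bar>" by linarith+
      then show ?thesis using that by linarith
    qed
    show "\<exists>\<delta>\<in>{0<..<\<epsilon>}. \<exists>t\<^sub>\<epsilon>>0. \<forall>t\<^sub>s\<ge>t\<^sub>\<epsilon>. \<forall>J \<rho> \<phi>.
                is_interval J \<and> t\<^sub>s \<in> J \<and> J \<subseteq> {t\<^sub>s..} \<and> full_solution \<omega> \<R> S f g J \<rho> \<phi> \<and>
                \<bar>\<rho> t\<^sub>s - \<rho>' t\<^sub>s\<bar> + \<bar>\<phi> t\<^sub>s - of_int \<kappa> / of_int \<kappa>' * S t\<^sub>s - \<phi>' t\<^sub>s\<bar> \<le> \<delta> \<longrightarrow>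
                (\<exists>r p. full_solution \<omega> \<R> S f g {t\<^sub>s..} r p \<and> (\<forall>t\<in>J. r t = \<rho> t \<and> p t = \<phi> t) \<and>
                   (\<forall>t>t\<^sub>s. \<bar>r t - \<rho>' t\<bar> + \<bar>p t - of_int \<kappa> / of_int \<kappa>' * S t - \<phi>' t\<bar> < \<epsilon>))"
    \<comment> \<open>One half of \<open>\<delta>\<close> is for the distance to the truncated
      solution, the other for the distance of that solution to the equilibrium, which is below
      \<open>\<delta> / 2\<close> from \<open>T1\<close> on.\<close>
    proof (rule bexI[of _ "\<delta> / 2"], rule exI[of _ "max T T1"], intro conjI allI impI)
      show "\<delta> / 2 \<in> {0<..<\<epsilon>}" using \<delta> \<epsilon> by auto
      show "0 < max T T1" using T by simp
      fix t\<^sub>s J \<rho> \<phi>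
      assume ts: "max T T1 \<le> t\<^sub>s" and H: "is_interval J \<and> t\<^sub>s \<in> J \<and> J \<subseteq> {t\<^sub>s..} \<and> full_solution \<omega> \<R> S f g J \<rho> \<phi> \<and>
                \<bar>\<rho> t\<^sub>s - \<rho>' t\<^sub>s\<bar> + \<bar>\<phi> t\<^sub>s - of_int \<kappa> / of_int \<kappa>' * S t\<^sub>s - \<phi>' t\<^sub>s\<bar> \<le> \<delta> / 2"
      have tT: "T \<le> t\<^sub>s" "T1 \<le> t\<^sub>s" "0 < t\<^sub>s" using ts T by auto
      have J: "J \<subseteq> {0<..}" using H tT(3) by auto
      define \<Psi> where "\<Psi> = (\<lambda>t. \<phi> t - c * S t)"
      have s: "solves2 field J \<rho> \<Psi>" using H full_solution_iff[OF J] by (simp add: \<Psi>_def)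
      have near': "\<bar>\<rho>\<^sub>0 - \<rho>' t\<bar> + \<bar>\<phi>\<^sub>0 - \<phi>' t\<bar> \<le> \<delta> / 2" if "T1 \<le> t" for t
        using T1[OF that] by (simp only: abs_minus_commute)
      have "\<bar>\<rho> t\<^sub>s - \<rho>\<^sub>0\<bar> + \<bar>\<Psi> t\<^sub>s - \<phi>\<^sub>0\<bar> \<le> \<delta> / 2 + \<delta> / 2"
        by (rule tri[OF _ near'[OF tT(2)]]) (use H in \<open>simp add: \<Psi>_def\<close>)
      then have init: "\<bar>\<rho> t\<^sub>s - \<rho>\<^sub>0\<bar> + \<bar>\<Psi> t\<^sub>s - \<phi>\<^sub>0\<bar> \<le> \<delta>" by simp
      obtain R' \<Psi>' where R': "solves2 field {t\<^sub>s..} R' \<Psi>'" "\<forall>t\<in>J. R' t = \<rho> t \<and> \<Psi>' t = \<Psi> t"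
        "\<forall>t\<ge>t\<^sub>s. \<bar>R' t - \<rho>\<^sub>0\<bar> + \<bar>\<Psi>' t - \<phi>\<^sub>0\<bar> < min \<epsilon>0 (\<epsilon> / 2)"
        using stab[rule_format, OF tT(1), of J \<rho> \<Psi>] H s init by blast
      define p where "p = (\<lambda>t. \<Psi>' t + c * S t)"
      have "R' t \<in> {0<..\<R>}" if "t \<in> {t\<^sub>s..}" for t
      proof (rule range[of _ "\<Psi>' t"])
        have "\<bar>R' t - \<rho>\<^sub>0\<bar> + \<bar>\<Psi>' t - \<phi>\<^sub>0\<bar> < min \<epsilon>0 (\<epsilon> / 2)" using R'(3) that by blast
        then show "\<bar>R' t - \<rho>\<^sub>0\<bar> + \<bar>\<Psi>' t - \<phi>\<^sub>0\<bar> \<le> \<epsilon>0" by simp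
      qed
      moreover have "{t\<^sub>s..} \<subseteq> {0<..}" using tT(3) by auto
      ultimately have "full_solution \<omega> \<R> S f g {t\<^sub>s..} R' p"
        using R'(1) full_solution_iff[of "{t\<^sub>s..}" R' p] by (simp add: p_def)
      moreover have "R' t = \<rho> t \<and> p t = \<phi> t" if "t \<in> J" for t
        using R'(2) that by (simp add: p_def \<Psi>_def)
      moreover have "\<bar>R' t - \<rho>' t\<bar> + \<bar>p t - of_int \<kappa> / of_int \<kappa>' * S t - \<phi>' t\<bar> < \<epsilon>" if t: "t\<^sub>s < t" for t
      proof -
        have T1t: "T1 \<le> t" and tt: "t\<^sub>s \<le> t" using t tT(2) by auto
        have "\<bar>R' t - \<rho>' t\<bar> + \<bar>\<Psi>' t - \<phi>' t\<bar> \<le> (\<bar>R' t - \<rho>\<^sub>0\<bar> + \<bar>\<Psi>' t - \<phi>\<^sub>0\<bar>) + \<delta> / 2"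
          by (rule tri[OF order_refl less_imp_le[OF T1[OF T1t]]])
        also have "\<dots> < \<epsilon> / 2 + \<delta> / 2" using R'(3)[rule_format, OF tt] by simp
        also have "\<dots> < \<epsilon>" using \<delta> \<epsilon> by simp
        finally show ?thesis by (simp add: p_def)
      qed
      ultimately show "\<exists>r p. full_solution \<omega> \<R> S f g {t\<^sub>s..} r p \<and> (\<forall>t\<in>J. r t = \<rho> t \<and> p t = \<phi> t) \<and>
                   (\<forall>t>t\<^sub>s. \<bar>r t - \<rho>' t\<bar> + \<bar>p t - of_int \<kappa> / of_int \<kappa>' * S t - \<phi>' t\<bar> < \<epsilon>)"
        by blast
    qed
  next
    assume pos: "beta1 q n m l \<nu> \<eta> w > 0 \<and> beta2 q n m l \<nu> \<eta> w > 0 \<and> max n m < q"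
    then have signs: "0 < l * w - \<nu> * \<eta>" "(n = m \<longrightarrow> 0 < l + w) \<and> (n < m \<longrightarrow> 0 < l) \<and> (m < n \<longrightarrow> 0 < w)"
      using signs_if_beta_pos by blast+
    interpret F: unstable_equilibrium q n m l \<nu> \<eta> w \<rho>\<^sub>0 \<phi>\<^sub>0 b field
      using field_perturbed signs by (simp add: unstable_equilibrium_def unstable_equilibrium_axioms_def)
    obtain \<epsilon> T where \<epsilon>: "0 < \<epsilon>" "\<epsilon> \<le> \<epsilon>0" and T: "0 < T"
      and inst: "\<forall>\<delta>\<in>{0<..<\<epsilon>}. \<exists>a\<ge>T. \<exists>d>a. \<exists>R \<Psi>. solves2 field {a..d} R \<Psi> \<and>
      \<bar>R a - \<rho>\<^sub>0\<bar> + \<bar>\<Psi> a - \<phi>\<^sub>0\<bar> \<le> \<delta> \<and> \<bar>R d - \<rho>\<^sub>0\<bar> + \<bar>\<Psi> d - \<phi>\<^sub>0\<bar> = \<epsilon> \<and>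
      (\<forall>t\<in>{a..d}. \<bar>R t - \<rho>\<^sub>0\<bar> + \<bar>\<Psi> t - \<phi>\<^sub>0\<bar> \<le> \<epsilon>)"
      using F.instability[OF \<epsilon>0] by (elim exE conjE) (rule that)
    show "\<exists>\<epsilon>>0. \<exists>T>0. \<forall>\<delta>\<in>{0<..<\<epsilon>}. \<exists>t\<^sub>s\<ge>T. \<exists>t\<^sub>e>t\<^sub>s. \<exists>\<rho> \<phi>.
          full_solution \<omega> \<R> S f g {t\<^sub>s..t\<^sub>e} \<rho> \<phi> \<and>
          \<bar>\<rho> t\<^sub>s - \<rho>\<^sub>0\<bar> + \<bar>\<phi> t\<^sub>s - of_int \<kappa> / of_int \<kappa>' * S t\<^sub>s - \<phi>\<^sub>0\<bar> \<le> \<delta> \<and>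
          \<bar>\<rho> t\<^sub>e - \<rho>\<^sub>0\<bar> + \<bar>\<phi> t\<^sub>e - of_int \<kappa> / of_int \<kappa>' * S t\<^sub>e - \<phi>\<^sub>0\<bar> \<ge> \<epsilon>"
    proof (rule exI[of _ \<epsilon>], rule conjI[OF \<epsilon>(1)], rule exI[of _ T], rule conjI[OF T], rule ballI)
      fix \<delta> assume "\<delta> \<in> {0<..<\<epsilon>}"
      with inst obtain a d R \<Psi> where a: "T \<le> a" "a < d" and s: "solves2 field {a..d} R \<Psi>"
        and init: "\<bar>R a - \<rho>\<^sub>0\<bar> + \<bar>\<Psi> a - \<phi>\<^sub>0\<bar> \<le> \<delta>" and exit: "\<bar>R d - \<rho>\<^sub>0\<bar> + \<bar>\<Psi> d - \<phi>\<^sub>0\<bar> = \<epsilon>"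
        and near: "\<forall>t\<in>{a..d}. \<bar>R t - \<rho>\<^sub>0\<bar> + \<bar>\<Psi> t - \<phi>\<^sub>0\<bar> \<le> \<epsilon>" by blast
      have "{a..d} \<subseteq> {0<..}" using a T by auto
      \<comment> \<open>Up to the exit the deviation is at most \<open>\<epsilon>\<close>, hence at
        most \<open>\<epsilon>0\<close>, so the amplitude has not left the domain.\<close>
      moreover have "R t \<in> {0<..\<R>}" if "t \<in> {a..d}" for t
        by (rule range[OF order_trans[OF bspec[OF near that] \<epsilon>(2)]])
      ultimately have "full_solution \<omega> \<R> S f g {a..d} R (\<lambda>t. \<Psi> t + c * S t)"
        using s full_solution_iff[of "{a..d}" R "\<lambda>t. \<Psi> t + c * S t"] by simp
      then show "\<exists>t\<^sub>s\<ge>T. \<exists>t\<^sub>e>t\<^sub>s. \<exists>\<rho> \<phi>.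
          full_solution \<omega> \<R> S f g {t\<^sub>s..t\<^sub>e} \<rho> \<phi> \<and>
          \<bar>\<rho> t\<^sub>s - \<rho>\<^sub>0\<bar> + \<bar>\<phi> t\<^sub>s - of_int \<kappa> / of_int \<kappa>' * S t\<^sub>s - \<phi>\<^sub>0\<bar> \<le> \<delta> \<and>
          \<bar>\<rho> t\<^sub>e - \<rho>\<^sub>0\<bar> + \<bar>\<phi> t\<^sub>e - of_int \<kappa> / of_int \<kappa>' * S t\<^sub>e - \<phi>\<^sub>0\<bar> \<ge> \<epsilon>"
        using a init exit
        by (intro exI[of _ a] exI[of _ d] exI[of _ R] exI[of _ "\<lambda>t. \<Psi> t + c * S t"] conjI) simp_all
    qed
  qed
qed

end
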